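(* Let $n\ge2$, $p\in(1,\infty)$, let $\Omega\subset\mathbb{R}^n$ be a bounded one-sided chord arc domain, let $L:=-\mathrm{div}(A\nabla\cdot)$ be a uniformly elliptic operator on $\Omega$, and let $\alpha$ be a measurable function on $\partial\Omega$ satisfying the standing assumption on $\alpha$ given in the context. Then the Robin problem $(\mathrm R_p)_L$ is solvable if and only if the Robin problem $(\widetilde{\mathrm R}_p)_L$ is solvable.
   Context: **Domains.** For a domain $\Omega\subset\mathbb{R}^n$ put $\delta(x):=\mathrm{dist}(x,\partial\Omega)$. $\Omega$ satisfies the corkscrew condition if there is $c\in(0,1)$ such that for all $x\in\partial\Omega$, $r\in(0,\mathrm{diam}(\Omega))$ there is $y\in B(x,r)\cap\Omega$ with $B(y,cr)\subset B(x,r)\cap\Omega$. $\Omega$ satisfies the Harnack chain condition if there is $M\in[1,\infty)$ such that any $x,y\in\Omega$ can be joined by open balls $B_1,\dots,B_N\subset\Omega$ with $x\in B_1$, $y\in B_N$, $B_k\cap B_{k+1}\ne\emptyset$, $M^{-1}\mathrm{diam}(B_k)\le\mathrm{dist}(B_k,\partial\Omega)\le M\,\mathrm{diam}(B_k)$, where $N$ depends only on $M$ and $|x-y|/\min\{\delta(x),\delta(y)\}$. A one-sided chord arc domain (CAD) is a domain satisfying the corkscrew and Harnack chain conditions, whose boundary is $(n-1)$-Ahlfors regular (with $\sigma:=\mathcal{H}^{n-1}|_{\partial\Omega}$, there is $C>0$ with $C^{-1}r^{n-1}\le\sigma(B(x,r))\le Cr^{n-1}$ for all $x\in\partial\Omega$,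 $r\in(0,\mathrm{diam}(\partial\Omega))$), and which is bounded whenever $\partial\Omega$ is bounded. **Functional.** For $x\in\partial\Omega$ let $\gamma(x):=\{z\in\Omega:|z-x|<2\delta(z)\}$. For $u\in L^2_{\rm loc}(\Omega)$ (vector-valued functions are treated via their modulus) define $$\widetilde{\mathcal N}(u)(x):=\sup_{y\in\gamma(x)}\Big[\frac{1}{|B(y,\delta(y)/4)|}\int_{B(y,\delta(y)/4)}|u|^2\,dz\Big]^{1/2}.$$ **Operator.** $A=\{a_{ij}\}$ is an $n\times n$ matrix of real-valued bounded measurable functions on $\Omega$; $L=-\mathrm{div}(A\nabla\cdot)$ is uniformly elliptic if for some $\mu_0\in(0,1]$, $\mu_0|\xi|^2\le\sum_{i,j}a_{ij}(x)\xi_i\xi_j\le\mu_0^{-1}|\xi|^2$ for all $x\in\Omega$, $\xi\in\mathbb{R}^n$. **Standing assumption on $\alpha$.** $0\le\alpha\in L^{n-1+\varepsilon_0}(\partial\Omega,\sigma)$ and $\alpha\ge c_0$ on $E_0$, where $\varepsilon_0,c_0\in(0,\infty)$ are constants and $E_0\subset\partial\Omega$ is measurable with $\sigma(E_0)>0$. **Weak solutions.** For $f\in L^2(\partial\Omega,\sigma)$, the weak solution of $Lu=0$ in $\Omega$ with Robin condition $\frac{\partial u}{\partial\boldsymbol\nu}+\alpha u=f$ on $\partial\Omega$ (where $\frac{\partial u}{\partial\boldsymbol\nu}=A\nabla u\cdot\boldsymbol\nu$) is the unique $u\in W^{1,2}(\Omega)$ with $$\int_\Omega A\nabla u\cdot\nabla\phi\,dx+\int_{\partial\Omega}\alpha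 u\phi\,d\sigma=\int_{\partial\Omega}f\phi\,d\sigma\quad\forall\phi\in C_{\rm c}^\infty(\mathbb{R}^n),$$ boundary values being traces. **Solvability.** $C_{\rm c}(\partial\Omega)$: continuous functions on $\partial\Omega$ with compact support. - $(\mathrm R_p)_L$ is solvable if there is $C>0$ such that for every $f\in C_{\rm c}(\partial\Omega)$ the weak solution $u$ of $Lu=0$ in $\Omega$, $\frac{\partial u}{\partial\boldsymbol\nu}+\alpha u=f$ on $\partial\Omega$, satisfies $\|\widetilde{\mathcal N}(\nabla u)\|_{L^p(\partial\Omega,\sigma)}\le C\|f\|_{L^p(\partial\Omega,\sigma)}$. - $(\widetilde{\mathrm R}_p)_L$ is solvable if there is $C>0$ such that for every $f\in C_{\rm c}(\partial\Omega)$ the same weak solution $u$ satisfies $\|\widetilde{\mathcal N}(\nabla u)\|_{L^p(\partial\Omega,\sigma)}+\|\widetilde{\mathcal N}(u)\|_{L^p(\partial\Omega,\sigma)}\le C\|f\|_{L^p(\partial\Omega,\sigma)}$. *)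

theory Defs
  imports "HOL-Analysis.Analysis"
begin

section \<open>Hausdorff measure\<close>

text \<open>The library's \<open>diameter\<close> is 0 on unbounded sets; here it has to be infinite there.\<close>

definition ediam :: "'a::metric_space set \<Rightarrow> ennreal" where
  "ediam S = (SUP (x, y) \<in> S \<times> S. ennreal (dist x y))"

definition hausdorff_content :: "nat \<Rightarrow> real \<Rightarrow> 'a::metric_space set \<Rightarrow> ennreal" where
  "hausdorff_content s d E =
     (INF C \<in> {C :: nat \<Rightarrow> 'a set. E \<subseteq> (\<Union>i. C i) \<and> (\<forall>i. ediam (C i) \<le> ennreal d)}.
        \<Sum>i. if C i = {} then 0 else ennreal (unit_ball_vol (real s)) * (ediam (C i) / 2) ^ s)"

definition hausdorff_outer :: "nat \<Rightarrow> 'a::metric_space set \<Rightarrow> ennreal" where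
  "hausdorff_outer s E = (SUP d \<in> {0<..}. hausdorff_content s d E)"

text \<open>The measure lives on all Caratheodory measurable sets, not only on the Borel sets.\<close>

definition hausdorff_measure :: "nat \<Rightarrow> 'a::metric_space measure" where
  "hausdorff_measure s =
     measure_of UNIV (lambda_system UNIV UNIV (hausdorff_outer s)) (hausdorff_outer s)"

definition surface_measure :: "(real^'n) set \<Rightarrow> (real^'n) measure" where
  "surface_measure \<Omega> = restrict_space (hausdorff_measure (CARD('n) - 1)) (frontier \<Omega>)"


section \<open>One-sided chord arc domains\<close>

definition bdist :: "'a::metric_space set \<Rightarrow> 'a \<Rightarrow> real" where
  "bdist \<Omega> x = infdist x (frontier \<Omega>)"

definition corkscrew_condition :: "'a::metric_space set \<Rightarrow> bool" where
  "corkscrew_condition \<Omega> \<longleftrightarrow>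
     (\<exists>c. 0 < c \<and> c < 1 \<and>
        (\<forall>x \<in> frontier \<Omega>. \<forall>r. 0 < r \<and> ennreal r < ediam \<Omega> \<longrightarrow>
           (\<exists>y \<in> ball x r \<inter> \<Omega>. ball y (c * r) \<subseteq> ball x r \<inter> \<Omega>)))"

text \<open>
  The ball \<open>B\<^sub>k\<close> is \<open>ball (z k) (r k)\<close>. The function \<open>N\<close> is chosen after \<open>M\<close> and before
  the two points, and it sees these only through the ratio of their distance to the minimum
  of their distances to the boundary.
\<close>

definition harnack_chain_condition :: "'a::metric_space set \<Rightarrow> bool" where
  "harnack_chain_condition \<Omega> \<longleftrightarrow>
     (\<exists>M \<ge> 1. \<exists>N :: real \<Rightarrow> nat. \<forall>x \<in> \<Omega>. \<forall>y \<in> \<Omega>.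
        \<exists>(m::nat) (z :: nat \<Rightarrow> 'a) (r :: nat \<Rightarrow> real).
          1 \<le> m \<and> m \<le> N (dist x y / min (bdist \<Omega> x) (bdist \<Omega> y)) \<and>
          x \<in> ball (z 1) (r 1) \<and> y \<in> ball (z m) (r m) \<and>
          (\<forall>k \<in> {1..<m}. ball (z k) (r k) \<inter> ball (z (k + 1)) (r (k + 1)) \<noteq> {}) \<and>
          (\<forall>k \<in> {1..m}. 0 < r k \<and> ball (z k) (r k) \<subseteq> \<Omega> \<and>
             inverse M * diameter (ball (z k) (r k)) \<le> setdist (ball (z k) (r k)) (frontier \<Omega>) \<and>
             setdist (ball (z k) (r k)) (frontier \<Omega>) \<le> M * diameter (ball (z k) (r k))))"

definition ahlfors_regular_boundary :: "(real^'n) set \<Rightarrow> bool" where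
  "ahlfors_regular_boundary \<Omega> \<longleftrightarrow>
     (\<exists>C > 0. \<forall>x \<in> frontier \<Omega>. \<forall>r. 0 < r \<and> ennreal r < ediam (frontier \<Omega>) \<longrightarrow>
        ennreal (inverse C * r ^ (CARD('n) - 1))
          \<le> emeasure (surface_measure \<Omega>) (ball x r \<inter> frontier \<Omega>) \<and>
        emeasure (surface_measure \<Omega>) (ball x r \<inter> frontier \<Omega>)
          \<le> ennreal (C * r ^ (CARD('n) - 1)))"

definition one_sided_CAD :: "(real^'n) set \<Rightarrow> bool" where
  "one_sided_CAD \<Omega> \<longleftrightarrow>
     open \<Omega> \<and> connected \<Omega> \<and> \<Omega> \<noteq> {} \<and>
     corkscrew_condition \<Omega> \<and> harnack_chain_condition \<Omega> \<and> ahlfors_regular_boundary \<Omega> \<and>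
     (bounded (frontier \<Omega>) \<longrightarrow> bounded \<Omega>)"


section \<open>Norms and the averaged nontangential maximal function\<close>

text \<open>Only used for positive exponents. The functions are \<open>[0,\<infinity>]\<close>-valued, since the
  nontangential maximal function may be infinite.\<close>

definition epowr :: "ennreal \<Rightarrow> real \<Rightarrow> ennreal" where
  "epowr t p = (if t = top then top else ennreal (enn2real t powr p))"

definition Lp_norm :: "'a measure \<Rightarrow> real \<Rightarrow> ('a \<Rightarrow> ennreal) \<Rightarrow> ennreal" where
  "Lp_norm M p F = epowr (\<integral>\<^sup>+ x. epowr (F x) p \<partial>M) (1 / p)"

definition nt_cone :: "'a::metric_space set \<Rightarrow> 'a \<Rightarrow> 'a set" where
  "nt_cone \<Omega> x = {z \<in> \<Omega>. dist z x < 2 * bdist \<Omega> z}"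

definition nt_max ::
    "(real^'n) set \<Rightarrow> (real^'n \<Rightarrow> 'b::real_normed_vector) \<Rightarrow> real^'n \<Rightarrow> ennreal" where
  "nt_max \<Omega> u x =
     (SUP y \<in> nt_cone \<Omega> x.
        epowr ((\<integral>\<^sup>+ z \<in> ball y (bdist \<Omega> y / 4). ennreal ((norm (u z))\<^sup>2) \<partial>lebesgue)
                 / emeasure lebesgue (ball y (bdist \<Omega> y / 4))) (1/2))"


section \<open>Sobolev functions and traces\<close>

definition grad :: "(real^'n \<Rightarrow> real) \<Rightarrow> real^'n \<Rightarrow> real^'n" where
  "grad \<phi> x = (\<chi> i. frechet_derivative \<phi> (at x) (axis i 1))"

primrec Ck :: "nat \<Rightarrow> (real^'n \<Rightarrow> real) \<Rightarrow> bool" where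
  "Ck 0 \<phi> = continuous_on UNIV \<phi>"
| "Ck (Suc k) \<phi> = ((\<forall>x. \<phi> differentiable (at x)) \<and> (\<forall>i. Ck k (\<lambda>x. grad \<phi> x $ i)))"

definition test_functions :: "(real^'n) set \<Rightarrow> (real^'n \<Rightarrow> real) set" where
  "test_functions U =
     {\<phi>. (\<forall>k. Ck k \<phi>) \<and> compact (closure {x. \<phi> x \<noteq> 0}) \<and> closure {x. \<phi> x \<noteq> 0} \<subseteq> U}"

definition in_L2 :: "'a measure \<Rightarrow> ('a \<Rightarrow> 'b::real_normed_vector) \<Rightarrow> bool" where
  "in_L2 M u \<longleftrightarrow> u \<in> borel_measurable M \<and> Lp_norm M 2 (\<lambda>x. ennreal (norm (u x))) < \<infinity>"

text \<open>\<open>u \<in> W\<^sup>1\<^sup>,\<^sup>2(\<Omega>)\<close> with weak gradient \<open>Du\<close>.\<close>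

definition sobolev_W12 ::
    "(real^'n) set \<Rightarrow> (real^'n \<Rightarrow> real) \<Rightarrow> (real^'n \<Rightarrow> real^'n) \<Rightarrow> bool" where
  "sobolev_W12 \<Omega> u Du \<longleftrightarrow>
     in_L2 (lebesgue_on \<Omega>) u \<and> in_L2 (lebesgue_on \<Omega>) Du \<and>
     (\<forall>\<phi> \<in> test_functions \<Omega>. \<forall>i.
        integral\<^sup>L (lebesgue_on \<Omega>) (\<lambda>x. u x * grad \<phi> x $ i)
          = - integral\<^sup>L (lebesgue_on \<Omega>) (\<lambda>x. Du x $ i * \<phi> x))"

text \<open>
  The trace operator is the continuous extension, from \<open>W\<^sup>1\<^sup>,\<^sup>2(\<Omega>)\<close> to \<open>L\<^sup>2(\<partial>\<Omega>,\<sigma>)\<close>, of the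
  restriction of smooth functions to the boundary. We use its graph: \<open>g\<close> is the trace of
  \<open>u\<close> if smooth functions converge to \<open>u\<close> in \<open>W\<^sup>1\<^sup>,\<^sup>2(\<Omega>)\<close> while their restrictions to the
  boundary converge to \<open>g\<close> in \<open>L\<^sup>2(\<partial>\<Omega>,\<sigma>)\<close>.
\<close>

definition has_trace ::
    "(real^'n) set \<Rightarrow> (real^'n \<Rightarrow> real) \<Rightarrow> (real^'n \<Rightarrow> real^'n) \<Rightarrow> (real^'n \<Rightarrow> real) \<Rightarrow> bool" where
  "has_trace \<Omega> u Du g \<longleftrightarrow>
     in_L2 (surface_measure \<Omega>) g \<and>
     (\<exists>\<phi> :: nat \<Rightarrow> real^'n \<Rightarrow> real.
        (\<forall>k. \<phi> k \<in> test_functions UNIV) \<and>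
        (\<lambda>k. Lp_norm (lebesgue_on \<Omega>) 2 (\<lambda>x. ennreal \<bar>\<phi> k x - u x\<bar>)) \<longlonglongrightarrow> 0 \<and>
        (\<lambda>k. Lp_norm (lebesgue_on \<Omega>) 2 (\<lambda>x. ennreal (norm (grad (\<phi> k) x - Du x)))) \<longlonglongrightarrow> 0 \<and>
        (\<lambda>k. Lp_norm (surface_measure \<Omega>) 2 (\<lambda>x. ennreal \<bar>\<phi> k x - g x\<bar>)) \<longlonglongrightarrow> 0)"


section \<open>The Robin problem\<close>

definition uniformly_elliptic :: "(real^'n) set \<Rightarrow> (real^'n \<Rightarrow> real^'n^'n) \<Rightarrow> bool" where
  "uniformly_elliptic \<Omega> A \<longleftrightarrow>
     (\<forall>i j. (\<lambda>x. A x $ i $ j) \<in> borel_measurable (lebesgue_on \<Omega>)) \<and>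
     bounded (A ` \<Omega>) \<and>
     (\<exists>\<mu>. 0 < \<mu> \<and> \<mu> \<le> 1 \<and>
        (\<forall>x \<in> \<Omega>. \<forall>\<xi> :: real^'n.
           \<mu> * (norm \<xi>)\<^sup>2 \<le> (\<Sum>i\<in>UNIV. \<Sum>j\<in>UNIV. A x $ i $ j * \<xi> $ i * \<xi> $ j) \<and>
           (\<Sum>i\<in>UNIV. \<Sum>j\<in>UNIV. A x $ i $ j * \<xi> $ i * \<xi> $ j) \<le> inverse \<mu> * (norm \<xi>)\<^sup>2))"

definition robin_coefficient :: "(real^'n) set \<Rightarrow> (real^'n \<Rightarrow> real) \<Rightarrow> bool" where
  "robin_coefficient \<Omega> \<alpha> \<longleftrightarrow>
     \<alpha> \<in> borel_measurable (surface_measure \<Omega>) \<and>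
     (AE x in surface_measure \<Omega>. 0 \<le> \<alpha> x) \<and>
     (\<exists>\<epsilon>\<^sub>0 > 0. Lp_norm (surface_measure \<Omega>) (real CARD('n) - 1 + \<epsilon>\<^sub>0) (\<lambda>x. ennreal \<bar>\<alpha> x\<bar>) < \<infinity>) \<and>
     (\<exists>c\<^sub>0 > 0. \<exists>E\<^sub>0 \<in> sets (surface_measure \<Omega>).
        emeasure (surface_measure \<Omega>) E\<^sub>0 > 0 \<and>
        (AE x in surface_measure \<Omega>. x \<in> E\<^sub>0 \<longrightarrow> c\<^sub>0 \<le> \<alpha> x))"

text \<open>
  \<open>u\<close>, with weak gradient \<open>Du\<close>, is a weak solution with boundary datum \<open>f\<close>. The boundary
  term containing \<open>\<alpha>\<close> is required to converge absolutely, because the Bochner integral of a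
  non-integrable function is 0 by convention.
\<close>

definition robin_weak_solution ::
    "(real^'n) set \<Rightarrow> (real^'n \<Rightarrow> real^'n^'n) \<Rightarrow> (real^'n \<Rightarrow> real) \<Rightarrow> (real^'n \<Rightarrow> real) \<Rightarrow>
     (real^'n \<Rightarrow> real) \<Rightarrow> (real^'n \<Rightarrow> real^'n) \<Rightarrow> bool" where
  "robin_weak_solution \<Omega> A \<alpha> f u Du \<longleftrightarrow>
     sobolev_W12 \<Omega> u Du \<and>
     (\<exists>g. has_trace \<Omega> u Du g \<and>
        (\<forall>\<phi> \<in> test_functions UNIV.
           integrable (surface_measure \<Omega>) (\<lambda>x. \<alpha> x * g x * \<phi> x) \<and>
           integral\<^sup>L (lebesgue_on \<Omega>) (\<lambda>x. (A x *v Du x) \<bullet> grad \<phi> x)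
             + integral\<^sup>L (surface_measure \<Omega>) (\<lambda>x. \<alpha> x * g x * \<phi> x)
             = integral\<^sup>L (surface_measure \<Omega>) (\<lambda>x. f x * \<phi> x)))"

definition Cc_boundary :: "(real^'n) set \<Rightarrow> (real^'n \<Rightarrow> real) set" where
  "Cc_boundary \<Omega> =
     {f. continuous_on (frontier \<Omega>) f \<and> compact (closure {x \<in> frontier \<Omega>. f x \<noteq> 0})}"

definition robin_solvable ::
    "real \<Rightarrow> (real^'n) set \<Rightarrow> (real^'n \<Rightarrow> real^'n^'n) \<Rightarrow> (real^'n \<Rightarrow> real) \<Rightarrow> bool" where
  "robin_solvable p \<Omega> A \<alpha> \<longleftrightarrow>
     (\<exists>C > 0. \<forall>f \<in> Cc_boundary \<Omega>. \<forall>u Du. robin_weak_solution \<Omega> A \<alpha> f u Du \<longrightarrow>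
        Lp_norm (surface_measure \<Omega>) p (nt_max \<Omega> Du)
          \<le> ennreal C * Lp_norm (surface_measure \<Omega>) p (\<lambda>x. ennreal \<bar>f x\<bar>))"

definition robin_solvable_full ::
    "real \<Rightarrow> (real^'n) set \<Rightarrow> (real^'n \<Rightarrow> real^'n^'n) \<Rightarrow> (real^'n \<Rightarrow> real) \<Rightarrow> bool" where
  "robin_solvable_full p \<Omega> A \<alpha> \<longleftrightarrow>
     (\<exists>C > 0. \<forall>f \<in> Cc_boundary \<Omega>. \<forall>u Du. robin_weak_solution \<Omega> A \<alpha> f u Du \<longrightarrow>
        Lp_norm (surface_measure \<Omega>) p (nt_max \<Omega> Du) + Lp_norm (surface_measure \<Omega>) p (nt_max \<Omega> u)
          \<le> ennreal C * Lp_norm (surface_measure \<Omega>) p (\<lambda>x. ennreal \<bar>f x\<bar>))"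

end

theory Submission
  imports Defs
begin

text \<open>
  Write \<open>\<delta>\<close> for the distance to the boundary, \<open>\<rho>(w)\<close> for the mean of \<open>u\<close> over \<open>B(w, \<delta>(w)/4)\<close> and \<open>D(w)\<close> for the
  quadratic mean of \<open>\<nabla>u\<close> over the same ball. By Poincare's inequality \<open>\<rho>\<close> changes by at most a multiple
  of \<open>\<delta> D\<close> between neighbouring balls. Chains of such balls lead from any point of a cone at a
  boundary point \<open>x\<close>, through corkscrew points at dyadic scales, to a fixed interior point \<open>y*\<close>. Along
  the chain \<open>D(w)\<^sup>q\<close> is at most an average of the \<open>q\<close>-th power of the nontangential maximal function of
  \<open>\<nabla>u\<close> over a surface ball of radius comparable to \<open>\<delta>(w)\<close>, so summing over the scales and integrating in \<open>x\<close>
  bounds \<open>\<rho> - \<rho>(y*)\<close> in \<open>L\<^sup>q\<close> without any maximal theorem.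

  It remains to bound \<open>\<rho>(y*)\<close> by the data. For \<open>q = 1\<close> the same argument, together with a trace
  estimate for smooth functions, gives the bound for the trace \<open>g\<close> of \<open>u\<close> in place of \<open>\<rho>\<close>. Testing the equation
  with \<open>tanh(m u)\<close> and letting \<open>m\<close> tend to infinity gives \<open>\<integral> \<alpha>|g| \<le> \<integral> |f|\<close>, which controls \<open>g\<close> on the set
  where \<open>\<alpha> \<ge> c\<^sub>0\<close>.
\<close>

section \<open>Chains of neighbouring points\<close>

text \<open>The hypothesis bounds only the gradient, which does not see additive constants; one
  number has to come from the equation, and the lower bound for \<alpha> on a set of positive
  measure provides it. Since the weak formulation admits smooth test functions only, the truncation
  is applied to the smooth functions \<phi>_k that the definition of the trace supplies. The
  gradient of tanh(m \<phi>_k) is the gradient of \<phi>_k times a factor between 0 and m;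
  ellipticity gives the main part a sign, and for fixed m the error vanishes as k grows. The same
  functions carry the boundary values: at a boundary point \<phi>_k is the limit of its means at
  corkscrew points, and this passes to the trace by mean-square convergence. The exponent 1 is
  enough for the single number, because the boundary has finite measure and L^p norms control L^1
  norms. Corkscrew points are chosen without regard to measurability, so estimates over the boundary
  are stated with a measurable majorant \<open>H\<close>.\<close>

lemma bdist_nonneg: "0 \<le> bdist \<Omega> x"
  by (simp add: bdist_def infdist_nonneg)

lemma bdist_lipschitz: "\<bar>bdist \<Omega> x - bdist \<Omega> y\<bar> \<le> dist x y"
  unfolding bdist_def by (rule infdist_triangle_abs)

lemma bdist_le_add: "bdist \<Omega> x \<le> bdist \<Omega> y + dist x y"
  using bdist_lipschitz[of \<Omega> x y] by linarith

lemma continuous_on_bdist: "continuous_on S (bdist \<Omega>)"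
  unfolding bdist_def by (intro continuous_intros)

lemma frontier_bounded_ne:
  fixes \<Omega> :: "'a::euclidean_space set"
  assumes "bounded \<Omega>" "\<Omega> \<noteq> {}"
  shows "frontier \<Omega> \<noteq> {}"
  using assms by (auto simp: frontier_eq_empty)

text \<open>Boundedness supplies a nonempty frontier; \<open>infdist\<close> to the empty set is 0,
  so the claim fails for the whole space.\<close>

lemma bdist_pos:
  fixes \<Omega> :: "'a::euclidean_space set"
  assumes "open \<Omega>" "bounded \<Omega>" "x \<in> \<Omega>"
  shows "0 < bdist \<Omega> x"
proof -
  have "x \<notin> frontier \<Omega>" using assms by (simp add: frontier_def interior_open)
  moreover have "frontier \<Omega> \<noteq> {}" using assms frontier_bounded_ne by blast
  ultimately show ?thesis unfolding bdist_def
    by (intro infdist_pos_not_in_closed) auto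
qed

lemma bdist_le_dist: "x \<in> frontier \<Omega> \<Longrightarrow> bdist \<Omega> y \<le> dist y x"
  unfolding bdist_def by (rule infdist_le)

lemma ball_bdist_subset:
  fixes \<Omega> :: "'a::euclidean_space set"
  assumes "x \<in> \<Omega>"
  shows "ball x (bdist \<Omega> x) \<subseteq> \<Omega>"
proof (rule ccontr)
  assume *: "\<not> ?thesis"
  have "0 < bdist \<Omega> x"
  proof (rule ccontr)
    assume "\<not> 0 < bdist \<Omega> x"
    then have "ball x (bdist \<Omega> x) = {}" by simp
    with * show False by simp
  qed
  then have "x \<in> ball x (bdist \<Omega> x) \<inter> \<Omega>" using assms by simp
  moreover have "ball x (bdist \<Omega> x) - \<Omega> \<noteq> {}" using * by (simp add: Diff_eq_empty_iff)
  ultimately have "ball x (bdist \<Omega> x) \<inter> frontier \<Omega> \<noteq> {}"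
    by (intro connected_Int_frontier connected_ball) blast+
  then obtain z where z: "z \<in> frontier \<Omega>" "dist x z < bdist \<Omega> x" by auto
  then show False using bdist_le_dist[of z \<Omega> x] by auto
qed

lemma bdist_ge_ball:
  fixes \<Omega> :: "'a::euclidean_space set"
  assumes "ball y r \<subseteq> \<Omega>" "open \<Omega>" "frontier \<Omega> \<noteq> {}"
  shows "r \<le> bdist \<Omega> y"
proof -
  have "r \<le> dist y z" if "z \<in> frontier \<Omega>" for z
  proof (rule ccontr)
    assume "\<not> r \<le> dist y z"
    then have "z \<in> \<Omega>" using assms(1) by auto
    then show False using that assms(2) by (simp add: frontier_def interior_open)
  qed
  then show ?thesis unfolding bdist_def infdist_notempty[OF assms(3)]
    by (intro cINF_greatest assms(3))
qed

lemma nearest_frontier_point: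
  fixes \<Omega> :: "'a::euclidean_space set"
  assumes "bounded \<Omega>" "\<Omega> \<noteq> {}"
  obtains z where "z \<in> frontier \<Omega>" "dist y z = bdist \<Omega> y"
proof -
  obtain z where "z \<in> frontier \<Omega>" "infdist y (frontier \<Omega>) = dist y z"
    by (rule infdist_attains_inf[OF frontier_closed frontier_bounded_ne[OF assms]])
  with that show ?thesis by (simp add: bdist_def)
qed

section \<open>Hops between neighbouring points\<close>

abbreviation wball :: "'a::metric_space set \<Rightarrow> 'a \<Rightarrow> 'a set" where
  "wball \<Omega> w \<equiv> ball w (bdist \<Omega> w / 4)"

text \<open>Both inequalities are imposed so that the relation is symmetric. With the fraction 1/8
  the balls \<open>wball\<close> at the two ends still share a ball of comparable size, on which two
  means of a function can be compared.\<close>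

definition hop :: "'a::metric_space set \<Rightarrow> ('a \<times> 'a) set" where
  "hop \<Omega> = {(a, b). a \<in> \<Omega> \<and> b \<in> \<Omega> \<and> dist a b \<le> bdist \<Omega> a / 8 \<and> dist a b \<le> bdist \<Omega> b / 8}"

lemma hop_refl: "a \<in> \<Omega> \<Longrightarrow> (a, a) \<in> hop \<Omega>"
  by (auto simp: hop_def bdist_nonneg)

lemma hop_sym: "sym (hop \<Omega>)"
  by (auto simp: hop_def sym_def dist_commute)

lemma hop_bdist:
  assumes "(a, b) \<in> hop \<Omega>"
  shows "bdist \<Omega> b \<le> 9/8 * bdist \<Omega> a"
  using assms bdist_le_add[of \<Omega> b a] unfolding dist_commute[of b a] by (simp add: hop_def)

lemma relpow_hop_in:
  "(a, b) \<in> hop \<Omega> ^^ k \<Longrightarrow> a \<in> \<Omega> \<Longrightarrow> b \<in> \<Omega>"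
  by (cases k) (auto simp: hop_def)

lemma relpow_hop_sym: "(a, b) \<in> hop \<Omega> ^^ k \<Longrightarrow> (b, a) \<in> hop \<Omega> ^^ k"
proof (induction k arbitrary: b)
  case (Suc k)
  then obtain c where "(a, c) \<in> hop \<Omega> ^^ k" "(c, b) \<in> hop \<Omega>" by auto
  from relpow_Suc_I2[OF symD[OF hop_sym this(2)] Suc.IH[OF this(1)]] show ?case .
qed auto

text \<open>A chain is prolonged by staying at its end, so that a single length can serve all pairs
  of points. The start has to lie in \<Omega>, since zero hops relate every point to itself.\<close>

lemma relpow_hop_mono:
  assumes "(a, b) \<in> hop \<Omega> ^^ k" "k \<le> m" "a \<in> \<Omega>"
  shows "(a, b) \<in> hop \<Omega> ^^ m"
  using assms(2)
proof (induction m rule: dec_induct)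
  case (step m)
  have "b \<in> \<Omega>" using assms relpow_hop_in by blast
  from relpow_Suc_I[OF step.IH hop_refl[OF this]] show ?case .
qed (rule assms(1))

text \<open>Each hop moves by at most 1/8 of the current distance to the boundary, and that distance
  grows by a factor of at most 9/8; the geometric sum of the moves is
  \<open>(9/8)^k - 1\<close>.\<close>

lemma relpow_hop_dist:
  "(a, b) \<in> hop \<Omega> ^^ k \<Longrightarrow> dist a b \<le> ((9/8)^k - 1) * bdist \<Omega> a \<and> bdist \<Omega> b \<le> (9/8)^k * bdist \<Omega> a"
proof (induction k arbitrary: b)
  case (Suc k)
  then obtain c where c: "(a, c) \<in> hop \<Omega> ^^ k" "(c, b) \<in> hop \<Omega>" by auto
  have "dist a b \<le> dist a c + dist c b" by (rule dist_triangle)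
  also have "dist c b \<le> bdist \<Omega> c / 8" using c(2) by (auto simp: hop_def)
  also have "bdist \<Omega> c \<le> (9/8)^k * bdist \<Omega> a" using Suc.IH[OF c(1)] by simp
  finally have "dist a b \<le> ((9/8)^Suc k - 1) * bdist \<Omega> a"
    using Suc.IH[OF c(1)] by (simp add: algebra_simps)
  moreover from this have "bdist \<Omega> b \<le> (9/8)^Suc k * bdist \<Omega> a"
    using bdist_le_add[of \<Omega> b a] unfolding dist_commute[of b a] left_diff_distrib by linarith
  ultimately show ?case by blast
qed auto

text \<open>Cut into \<open>k\<close> equal pieces, the segment has pieces of length at most
  \<open>\<eta> / 8\<close>; each is a hop because \<eta> bounds the distance to the boundary from
  below at both ends.\<close>

lemma segment_relpow_hop:
  fixes \<Omega> :: "'a::euclidean_space set"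
  assumes seg: "\<And>t. 0 \<le> t \<Longrightarrow> t \<le> 1 \<Longrightarrow> a + t *\<^sub>R (b - a) \<in> \<Omega> \<and> \<eta> \<le> bdist \<Omega> (a + t *\<^sub>R (b - a))"
    and "8 * dist a b \<le> real k * \<eta>" and "k > 0"
  shows "(a, b) \<in> hop \<Omega> ^^ k"
proof -
  define p where "p i = a + (real i / real k) *\<^sub>R (b - a)" for i
  have "(p 0, p i) \<in> hop \<Omega> ^^ i" if "i \<le> k" for i
    using that
  proof (induction i)
    case (Suc i)
    have "p (Suc i) - p i = (1 / real k) *\<^sub>R (b - a)"
      by (simp add: p_def add_divide_distrib scaleR_add_left)
    then have "norm (p (Suc i) - p i) = norm (b - a) / real k" by simp
    then have "dist (p i) (p (Suc i)) = dist a b / real k"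
      by (simp add: dist_norm norm_minus_commute)
    also have "\<dots> \<le> \<eta> / 8" using assms(2,3) by (simp add: field_simps)
    finally have d: "dist (p i) (p (Suc i)) \<le> \<eta> / 8" .
    have pj: "p j \<in> \<Omega> \<and> \<eta> \<le> bdist \<Omega> (p j)" if "j \<le> k" for j
      unfolding p_def using that assms(3) by (intro seg) auto
    have "(p i, p (Suc i)) \<in> hop \<Omega>"
      using Suc.prems d pj[of i] pj[of "Suc i"] unfolding hop_def by auto
    with Suc show ?case by auto
  qed auto
  from this[of k] show ?thesis using assms(3) by (simp add: p_def)
qed

lemma relpow_hop_convex:
  fixes \<Omega> :: "'a::euclidean_space set"
  assumes "convex B" "B \<subseteq> \<Omega>" "a \<in> B" "b \<in> B" "\<And>z. z \<in> B \<Longrightarrow> \<eta> \<le> bdist \<Omega> z"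
    and "8 * dist a b \<le> real k * \<eta>" "k > 0"
  shows "(a, b) \<in> hop \<Omega> ^^ k"
proof (rule segment_relpow_hop[OF _ assms(6,7)])
  fix t :: real assume t: "0 \<le> t" "t \<le> 1"
  have "(1 - t) *\<^sub>R a + t *\<^sub>R b \<in> B" using assms t by (intro convexD_alt) auto
  then have "a + t *\<^sub>R (b - a) \<in> B" by (simp add: algebra_simps)
  then show "a + t *\<^sub>R (b - a) \<in> \<Omega> \<and> \<eta> \<le> bdist \<Omega> (a + t *\<^sub>R (b - a))" using assms by auto
qed

text \<open>In a chain ball of radius r the distance to the boundary is at least 2r/M, while two
  points are at most 2r apart, so 8M hops cross the ball. Passing through a point of each overlap
  makes the total proportional to the number of balls.\<close>

lemma harnack_chain_relpow:
  fixes \<Omega> :: "'a::euclidean_space set"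
  assumes M: "1 \<le> M" and m: "1 \<le> (m::nat)" "x \<in> ball (z 1) (r 1)" "y \<in> ball (z m) (r m)"
    and ov: "\<forall>k \<in> {1..<m}. ball (z k) (r k) \<inter> ball (z (k + 1)) (r (k + 1)) \<noteq> {}"
    and B: "\<forall>k \<in> {1..m}. 0 < r k \<and> ball (z k) (r k) \<subseteq> \<Omega> \<and>
       inverse M * diameter (ball (z k) (r k)) \<le> setdist (ball (z k) (r k)) (frontier \<Omega>)"
    and K: "8 * M \<le> real K" and fr: "frontier \<Omega> \<noteq> {}"
  shows "(x, y) \<in> hop \<Omega> ^^ (K * m)"
proof -
  have Kpos: "K > 0" using K M by (simp add: nat_le_real_less)
  have inball: "(a, b) \<in> hop \<Omega> ^^ K" if "k \<in> {1..m}" "a \<in> ball (z k) (r k)" "b \<in> ball (z k) (r k)" for k a b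
  proof (rule relpow_hop_convex[OF convex_ball _ that(2,3) _ _ Kpos])
    have rk: "0 < r k" "ball (z k) (r k) \<subseteq> \<Omega>" 
       "inverse M * diameter (ball (z k) (r k)) \<le> setdist (ball (z k) (r k)) (frontier \<Omega>)" using B that(1) by auto
    then show "ball (z k) (r k) \<subseteq> \<Omega>" by simp
    have dm: "diameter (ball (z k) (r k)) = 2 * r k" using rk by (simp add: diameter_ball)
    show "2 * r k / M \<le> bdist \<Omega> w" if "w \<in> ball (z k) (r k)" for w
    proof -
      have "setdist (ball (z k) (r k)) (frontier \<Omega>) \<le> setdist {w} (frontier \<Omega>)"
        using that by (intro setdist_subset_left) auto
      also have "\<dots> = bdist \<Omega> w" unfolding bdist_def using infdist_eq_setdist by metis
      finally show ?thesis using rk dm by (simp add: field_simps)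
    qed
    have "dist a b \<le> 2 * r k" using that dist_triangle2[of a b "z k"] by (simp add: dist_commute)
    then have "8 * dist a b \<le> 8 * M * (2 * r k / M)" using M by simp
    also have "\<dots> \<le> real K * (2 * r k / M)" using K rk M by (intro mult_right_mono) auto
    finally show "8 * dist a b \<le> real K * (2 * r k / M)" .
  qed
  have main: "\<forall>b \<in> ball (z k) (r k). (x, b) \<in> hop \<Omega> ^^ (K * k)" if "1 \<le> k" "k \<le> m" for k
    using that
  proof (induction k rule: nat_induct_at_least)
    case base
    then show ?case using inball[of 1 x] m by auto
  next
    case (Suc k)
    obtain c where c: "c \<in> ball (z k) (r k)" "c \<in> ball (z (Suc k)) (r (Suc k))"
      using ov Suc.prems Suc.hyps by force
    have "(x, c) \<in> hop \<Omega> ^^ (K * k)" using Suc c by auto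
    moreover have "(c, b) \<in> hop \<Omega> ^^ K" if "b \<in> ball (z (Suc k)) (r (Suc k))" for b
      using inball[of "Suc k" c b] c that Suc.prems by auto
    moreover have "hop \<Omega> ^^ (K * Suc k) = (hop \<Omega> ^^ (K * k)) O (hop \<Omega> ^^ K)"
      unfolding relpow_add[symmetric] by (simp add: add.commute)
    ultimately show ?case by (simp add: relcompI)
  qed
  from main[of m] m show ?thesis by auto
qed

text \<open>The number of balls in a Harnack chain may depend on the ratio in an arbitrary
  way. By the intermediate value theorem, moving the point closer to the boundary towards its
  nearest boundary point makes the ratio equal to \<open>R + 1\<close>, so a single value of \<open>N\<close> is used.\<close>

lemma harnack_relpow:
  fixes \<Omega> :: "'a::euclidean_space set"
  assumes "open \<Omega>" "bounded \<Omega>" "harnack_chain_condition \<Omega>" "0 \<le> R"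
  obtains m where "\<And>x y. x \<in> \<Omega> \<Longrightarrow> y \<in> \<Omega> \<Longrightarrow> dist x y \<le> R * min (bdist \<Omega> x) (bdist \<Omega> y) \<Longrightarrow>
     (x, y) \<in> hop \<Omega> ^^ m"
proof -
  from assms(3) obtain M N where M: "M \<ge> 1" and N: "\<forall>x \<in> \<Omega>. \<forall>y \<in> \<Omega>.
        \<exists>(m::nat) (z :: nat \<Rightarrow> 'a) (r :: nat \<Rightarrow> real).
          1 \<le> m \<and> m \<le> N (dist x y / min (bdist \<Omega> x) (bdist \<Omega> y)) \<and>
          x \<in> ball (z 1) (r 1) \<and> y \<in> ball (z m) (r m) \<and>
          (\<forall>k \<in> {1..<m}. ball (z k) (r k) \<inter> ball (z (k + 1)) (r (k + 1)) \<noteq> {}) \<and>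
          (\<forall>k \<in> {1..m}. 0 < r k \<and> ball (z k) (r k) \<subseteq> \<Omega> \<and>
             inverse M * diameter (ball (z k) (r k)) \<le> setdist (ball (z k) (r k)) (frontier \<Omega>) \<and>
             setdist (ball (z k) (r k)) (frontier \<Omega>) \<le> M * diameter (ball (z k) (r k)))"
    unfolding harnack_chain_condition_def by blast
  define K where "K = nat \<lceil>8 * M\<rceil>"
  have K: "8 * M \<le> real K" unfolding K_def by linarith
  \<comment> \<open>The first leg runs from x towards its nearest boundary point. Its length is at
    most \<delta>(x), and \<delta> stays above \<delta>(x)/(R+2) on it, so 8(R+2) hops
    suffice.\<close>
  define k where "k = nat \<lceil>8 * (R + 2)\<rceil>"
  have k: "8 * (R + 2) \<le> real k" unfolding k_def by linarith
  then have kpos: "k > 0" using assms(4) by (simp add: nat_le_real_less)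
  have exact: "(x, y) \<in> hop \<Omega> ^^ (K * N (R + 1))"
    if xy: "x \<in> \<Omega>" "y \<in> \<Omega>" "dist x y / min (bdist \<Omega> x) (bdist \<Omega> y) = R + 1" for x y
  proof -
    obtain m z r where h: "1 \<le> (m::nat)" "m \<le> N (R + 1)" "x \<in> ball (z 1) (r 1)" "y \<in> ball (z m) (r m)"
       "\<forall>k \<in> {1..<m}. ball (z k) (r k) \<inter> ball (z (k + 1)) (r (k + 1)) \<noteq> {}"
       "\<forall>k \<in> {1..m}. 0 < r k \<and> ball (z k) (r k) \<subseteq> \<Omega> \<and>
             inverse M * diameter (ball (z k) (r k)) \<le> setdist (ball (z k) (r k)) (frontier \<Omega>)"
      using N[rule_format, OF xy(1,2), unfolded xy(3)] by blast
    have "frontier \<Omega> \<noteq> {}" using frontier_bounded_ne[OF assms(2)] xy(1) by blast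
    from harnack_chain_relpow[OF M h(1,3,4,5,6) K this] show ?thesis
      by (rule relpow_hop_mono) (use h(2) xy(1) in simp_all)
  qed
  have ordered: "(x, y) \<in> hop \<Omega> ^^ (k + K * N (R + 1))"
    if xy: "x \<in> \<Omega>" "y \<in> \<Omega>" "bdist \<Omega> x \<le> bdist \<Omega> y" "dist x y \<le> R * bdist \<Omega> x" for x y
  proof -
    obtain z where z: "z \<in> frontier \<Omega>" "dist x z = bdist \<Omega> x"
      using nearest_frontier_point[of \<Omega> x] assms xy by blast
    have dx: "0 < bdist \<Omega> x" and dy: "0 < bdist \<Omega> y" using bdist_pos assms xy by auto
    define q where "q s = x + s *\<^sub>R (z - x)" for s
    have dqx: "dist x (q s) = s * bdist \<Omega> x" if "0 \<le> s" for s
      using that z by (simp add: q_def dist_norm norm_minus_commute)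
    have bq: "bdist \<Omega> (q s) = (1 - s) * bdist \<Omega> x" if "0 \<le> s" "s \<le> 1" for s
    proof (rule antisym)
      have "dist (q s) z = norm ((1 - s) *\<^sub>R (x - z))" by (simp add: q_def dist_norm algebra_simps)
      also have "\<dots> = (1 - s) * bdist \<Omega> x" using that z by (simp add: dist_norm)
      finally show "bdist \<Omega> (q s) \<le> (1 - s) * bdist \<Omega> x" using bdist_le_dist[OF z(1), of "q s"] by simp
      show "(1 - s) * bdist \<Omega> x \<le> bdist \<Omega> (q s)"
        using bdist_le_add[of \<Omega> x "q s"] dqx[OF that(1)] by (simp add: algebra_simps)
    qed
    have qin: "q s \<in> \<Omega>" if "0 \<le> s" "s < 1" for s
      using ball_bdist_subset[OF xy(1)] dqx[OF that(1)] that dx by (auto simp: subset_iff)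
    \<comment> \<open>After the fraction S of the way the distance to the boundary is
      \<delta>(x)/(R+2), while y is still at least S \<delta>(x) away, because \<delta>(y) \<ge>
      \<delta>(x). The quotient is then at least S(R+2) = R+1; at the start it is at most R.\<close>
    define S where "S = (R + 1) / (R + 2)"
    have S: "0 < S" "S < 1" "1 - S = 1 / (R + 2)" using assms(4) by (auto simp: S_def field_simps)
    define f where "f s = dist (q s) y / min (bdist \<Omega> (q s)) (bdist \<Omega> y)" for s
    have cq: "continuous_on {0..S} q" unfolding q_def by (intro continuous_intros)
    have cb: "continuous_on {0..S} (\<lambda>s. bdist \<Omega> (q s))"
      using continuous_on_compose2[OF continuous_on_bdist[of UNIV \<Omega>] cq] by auto
    have pos: "0 < bdist \<Omega> (q s)" if "s \<in> {0..S}" for s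
      using that bdist_pos[OF assms(1,2) qin] S by auto
    have "continuous_on {0..S} f" unfolding f_def
      by (intro continuous_intros cq cb) (use pos dy in \<open>smt (verit)\<close>)
    moreover have "f 0 \<le> R + 1"
      using xy dx unfolding f_def by (simp add: q_def field_simps)
    moreover have "R + 1 \<le> f S"
    proof -
      have bS: "bdist \<Omega> (q S) = bdist \<Omega> x / (R + 2)" using bq[of S] S by simp
      then have mn: "min (bdist \<Omega> (q S)) (bdist \<Omega> y) = bdist \<Omega> x / (R + 2)"
      proof -
        have "bdist \<Omega> x / (R + 2) \<le> bdist \<Omega> x / 1" using dx assms(4) by (intro divide_left_mono) auto
        then show ?thesis using xy(3) unfolding bS by simp
      qed
      have "bdist \<Omega> y \<le> bdist \<Omega> (q S) + dist (q S) y" using bdist_le_add[of \<Omega> y "q S"] by (simp add: dist_commute)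
      then have "S * bdist \<Omega> x \<le> dist (q S) y" using bq[of S] S(1,2) xy(3) by (simp add: algebra_simps)
      then show ?thesis using dx assms(4) unfolding f_def mn by (simp add: S_def field_simps)
    qed
    ultimately obtain s where s: "0 \<le> s" "s \<le> S" "f s = R + 1" using IVT'[of f 0 "R+1" S] S by auto
    have qy: "(q s, y) \<in> hop \<Omega> ^^ (K * N (R + 1))"
      using exact[of "q s" y] s S qin xy unfolding f_def by auto
    have "(x, q s) \<in> hop \<Omega> ^^ k"
    proof (rule segment_relpow_hop[OF _ _ kpos])
      fix t :: real assume t: "0 \<le> t" "t \<le> 1"
      have e: "x + t *\<^sub>R (q s - x) = q (t * s)" by (simp add: q_def)
      have ts: "0 \<le> t * s" "t * s \<le> S" using t s by (auto intro: mult_left_le_one_le order_trans)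
      have "(1 - S) * bdist \<Omega> x \<le> (1 - t * s) * bdist \<Omega> x" using ts dx by (intro mult_right_mono) auto
      then show "x + t *\<^sub>R (q s - x) \<in> \<Omega> \<and> bdist \<Omega> x / (R + 2) \<le> bdist \<Omega> (x + t *\<^sub>R (q s - x))"
        unfolding e using qin bq ts S by auto
    next
      have "8 * dist x (q s) \<le> 8 * bdist \<Omega> x" using dqx[of s] s S dx by (simp add: mult_left_le_one_le)
      also have "\<dots> = 8 * (R + 2) * (bdist \<Omega> x / (R + 2))" using assms(4) by (simp add: field_simps)
      also have "\<dots> \<le> real k * (bdist \<Omega> x / (R + 2))" using k dx assms(4) by (intro mult_right_mono) auto
      finally show "8 * dist x (q s) \<le> real k * (bdist \<Omega> x / (R + 2))" .
    qed
    from relcompI[OF this qy] show ?thesis by (simp only: relpow_add)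
  qed
  show ?thesis
  proof
    fix x y assume "x \<in> \<Omega>" "y \<in> \<Omega>" "dist x y \<le> R * min (bdist \<Omega> x) (bdist \<Omega> y)"
    then show "(x, y) \<in> hop \<Omega> ^^ (k + K * N (R + 1))"
      by (cases "bdist \<Omega> x \<le> bdist \<Omega> y")
        (simp_all add: ordered relpow_hop_sym[OF ordered] dist_commute)
  qed
qed

section \<open>Oscillation along chains\<close>

text \<open>Chains between points of a cone leave it but stay in a cone of larger aperture, hence
  the parameter. The cone \<open>nt_cone\<close> lies in the one with K = 2.\<close>

definition wide_cone :: "real \<Rightarrow> 'a::metric_space set \<Rightarrow> 'a \<Rightarrow> 'a set" where
  "wide_cone K \<Omega> x = {w \<in> \<Omega>. dist w x \<le> K * bdist \<Omega> w}"

text \<open>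
  Chain estimates are phrased for the weighted quantity \<open>\<delta>\<^sup>3\<^sup>/\<^sup>4 D\<close>. An exponent below 1 leaves a
  geometric series over the scales; the trace estimate needs an exponent above 1/2.
\<close>

definition hop_potential :: "'a::metric_space set \<Rightarrow> ('a \<Rightarrow> real) \<Rightarrow> ('a \<Rightarrow> real) \<Rightarrow> bool" where
  "hop_potential \<Omega> \<rho> D \<longleftrightarrow>
     (\<forall>a. 0 \<le> D a) \<and> (\<forall>a b. (a, b) \<in> hop \<Omega> \<longrightarrow> \<bar>\<rho> a - \<rho> b\<bar> \<le> bdist \<Omega> a * (D a + D b))"

lemma powr_quarter_split: "0 < (d::real) \<Longrightarrow> d powr (1/4) * (d powr (3/4) * e) = d * e"
  by (simp add: powr_add[symmetric] mult.assoc[symmetric])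

lemma powr_quarter_le:
  assumes "(d::real) \<le> A * e" "1 \<le> A" "0 < d" "0 \<le> e"
  shows "d powr (1/4) \<le> A * e powr (1/4)"
proof -
  have "d powr (1/4) \<le> (A * e) powr (1/4)" using assms by (intro powr_mono2) auto
  also have "\<dots> = A powr (1/4) * e powr (1/4)" using assms by (simp add: powr_mult)
  also have "A powr (1/4) \<le> A powr 1" using assms by (intro powr_mono) auto
  finally show ?thesis using assms by (simp add: mult_right_mono)
qed

text \<open>The differences telescope. A hop costs about \<delta> D, which is \<delta>^(1/4) times
  the weighted quantity bounded by \<open>T\<close>, and along the chain \<delta> exceeds its
  initial value by a factor of at most \<open>(9/8)^k\<close>. The factor 3 dominates the
  contributions 1 and 9/8 of the two ends of a hop.\<close>

lemma relpow_hop_potential: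
  fixes \<Omega> :: "'a::euclidean_space set"
  assumes dom: "open \<Omega>" "bounded \<Omega>" and pot: "hop_potential \<Omega> \<rho> D" and "0 \<le> T" and a: "a \<in> \<Omega>"
    and "(a, b) \<in> hop \<Omega> ^^ k"
    and "\<And>w j. j \<le> k \<Longrightarrow> (a, w) \<in> hop \<Omega> ^^ j \<Longrightarrow> bdist \<Omega> w powr (3/4) * D w \<le> T"
  shows "\<bar>\<rho> a - \<rho> b\<bar> \<le> 3 * real k * (9/8)^k * T * bdist \<Omega> a powr (1/4)"
  using assms(6,7)
proof (induction k arbitrary: b)
  case (Suc k)
  then obtain c where c: "(a, c) \<in> hop \<Omega> ^^ k" "(c, b) \<in> hop \<Omega>" by auto
  have in\<Omega>: "b \<in> \<Omega>" "c \<in> \<Omega>" using c(2) by (auto simp: hop_def)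
  then have pos: "0 < bdist \<Omega> b" "0 < bdist \<Omega> c" "0 < bdist \<Omega> a" using bdist_pos[OF dom] a by auto
  define q :: real where "q = (9/8)^Suc k"
  define A where "A = T * bdist \<Omega> a powr (1/4)"
  have A0: "0 \<le> A" using \<open>0 \<le> T\<close> by (simp add: A_def)
  have q1: "1 \<le> q" "(9/8)^k \<le> q" unfolding q_def by (rule one_le_power, simp, simp)
  have bc: "bdist \<Omega> c \<le> q * bdist \<Omega> a" "bdist \<Omega> b \<le> q * bdist \<Omega> a"
    using relpow_hop_dist[OF c(1)] relpow_hop_dist[OF Suc.prems(1)] q1 pos
      mult_right_mono[OF q1(2), of "bdist \<Omega> a"] unfolding q_def by auto
  have D0: "0 \<le> D b" "0 \<le> D c" using pot by (auto simp: hop_potential_def)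
  have small: "bdist \<Omega> w * D w \<le> q * A"
    if "bdist \<Omega> w powr (3/4) * D w \<le> T" "bdist \<Omega> w \<le> q * bdist \<Omega> a" "0 < bdist \<Omega> w" for w
  proof -
    have "bdist \<Omega> w * D w = bdist \<Omega> w powr (1/4) * (bdist \<Omega> w powr (3/4) * D w)"
      by (rule powr_quarter_split[OF that(3), symmetric])
    also have "\<dots> \<le> (q * bdist \<Omega> a powr (1/4)) * T"
      using that pos \<open>0 \<le> T\<close> powr_quarter_le[OF that(2) q1(1) that(3)] q1
      by (intro order_trans[OF mult_left_mono mult_right_mono]) auto
    finally show ?thesis by (simp add: A_def mult_ac)
  qed
  have "bdist \<Omega> c * D c \<le> q * A"
    using small[of c] Suc.prems(2)[of k c] c(1) bc pos by simp
  moreover have "bdist \<Omega> b * D b \<le> q * A"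
    using small[of b] Suc.prems(2)[of "Suc k" b] Suc.prems(1) bc pos by simp
  moreover have "bdist \<Omega> c * D b \<le> 9/8 * (bdist \<Omega> b * D b)"
  proof -
    have "bdist \<Omega> c \<le> 9/8 * bdist \<Omega> b" using hop_bdist[OF symD[OF hop_sym c(2)]] .
    from mult_right_mono[OF this D0(1)] show ?thesis by simp
  qed
  moreover have "\<bar>\<rho> c - \<rho> b\<bar> \<le> bdist \<Omega> c * (D c + D b)"
    using pot c(2) by (auto simp: hop_potential_def)
  moreover have "\<bar>\<rho> a - \<rho> c\<bar> \<le> 3 * real k * (q * A)"
  proof -
    have "\<bar>\<rho> a - \<rho> c\<bar> \<le> 3 * real k * (9/8)^k * T * bdist \<Omega> a powr (1/4)"
      by (rule Suc.IH[OF c(1)]) (rule Suc.prems(2), simp_all)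
    also have "\<dots> = 3 * real k * ((9/8)^k * A)" by (simp add: A_def)
    also have "\<dots> \<le> 3 * real k * (q * A)" using q1 A0 by (intro mult_left_mono mult_right_mono) auto
    finally show ?thesis .
  qed
  moreover have "0 \<le> q * A" using q1 A0 by simp
  ultimately have "\<bar>\<rho> a - \<rho> b\<bar> \<le> 3 * real k * (q * A) + 3 * (q * A)"
    unfolding distrib_left by linarith
  also have "\<dots> = 3 * real (Suc k) * q * A" by (simp add: algebra_simps)
  finally show ?case by (simp add: q_def A_def mult.assoc)
qed auto

text \<open>The reversed chain bounds \<delta>(a) by a multiple of \<delta>(w); this converts a
  displacement measured against \<delta>(a) into an aperture at w.\<close>

lemma relpow_hop_wide_cone:
  assumes "(a, w) \<in> hop \<Omega> ^^ j" "j \<le> m" "a \<in> \<Omega>" "dist a x \<le> A * bdist \<Omega> a" "0 \<le> A"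
  shows "w \<in> wide_cone (((9/8)^m + A) * (9/8)^m) \<Omega> x" "bdist \<Omega> w \<le> (9/8)^m * bdist \<Omega> a"
proof -
  have h: "(a, w) \<in> hop \<Omega> ^^ m" "(w, a) \<in> hop \<Omega> ^^ m"
    using relpow_hop_mono[OF assms(1,2,3)] relpow_hop_sym by auto
  have 1: "dist a w \<le> ((9/8)^m - 1) * bdist \<Omega> a" "bdist \<Omega> w \<le> (9/8)^m * bdist \<Omega> a"
    using relpow_hop_dist[OF h(1)] by auto
  have 2: "bdist \<Omega> a \<le> (9/8)^m * bdist \<Omega> w" using relpow_hop_dist[OF h(2)] by auto
  have "dist w x \<le> dist a w + dist a x" by (metis dist_commute dist_triangle)
  also have "\<dots> \<le> ((9/8)^m + A) * bdist \<Omega> a"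
    using 1 assms(4) bdist_nonneg[of \<Omega> a] unfolding left_diff_distrib distrib_right by linarith
  also have "\<dots> \<le> ((9/8)^m + A) * ((9/8)^m * bdist \<Omega> w)"
    using 2 assms(5) by (intro mult_left_mono) auto
  finally show "w \<in> wide_cone (((9/8)^m + A) * (9/8)^m) \<Omega> x"
    using relpow_hop_in[OF assms(1,3)] by (simp add: wide_cone_def mult.assoc)
  show "bdist \<Omega> w \<le> (9/8)^m * bdist \<Omega> a" by (rule 1(2))
qed

lemma wide_cone_mono: "K \<le> K' \<Longrightarrow> wide_cone K \<Omega> x \<subseteq> wide_cone K' \<Omega> x"
  unfolding wide_cone_def using bdist_nonneg[of \<Omega>] mult_right_mono by (fastforce intro: order_trans)

section \<open>Corkscrew points at dyadic scales\<close>

lemma dyadic_scale: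
  assumes "0 < (t::real)" "t \<le> D0"
  obtains j where "t \<le> D0 / 2 ^ j" "D0 / 2 ^ j \<le> 2 * t"
proof -
  have D0_pos: "0 < D0" using assms by linarith
  define n where "n = (LEAST n. D0 / 2 ^ n < t)"
  have "\<exists>n. (1/2::real) ^ n < t / D0" using assms D0_pos by (intro real_arch_pow_inv) auto
  then have "\<exists>n. D0 / 2 ^ n < t" using D0_pos by (simp add: field_simps power_one_over)
  then have n: "D0 / 2 ^ n < t" unfolding n_def by (rule LeastI_ex)
  have "n \<noteq> 0" using n assms by (intro notI) auto
  then obtain j where j: "n = Suc j" by (cases n) auto
  have "\<not> D0 / 2 ^ j < t" using not_less_Least[of j "\<lambda>n. D0 / 2 ^ n < t"] j n_def by auto
  moreover have "D0 / 2 ^ j \<le> 2 * t" using n j by (simp add: field_simps)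
  ultimately show ?thesis by (intro that) auto
qed

text \<open>One corkscrew point is fixed for each boundary point and scale. Nothing is assumed about
  the dependence of \<open>Y i x\<close> on x, so functions of x formed with it are not known to be
  measurable.\<close>

locale corkscrew_family =
  fixes \<Omega> :: "'a::euclidean_space set" and c D0 :: real and Y :: "nat \<Rightarrow> 'a \<Rightarrow> 'a"
  assumes open_dom: "open \<Omega>" and bounded_dom: "bounded \<Omega>" and harnack: "harnack_chain_condition \<Omega>"
    and c_pos: "0 < c" and D0_pos: "0 < D0"
    and Y_in: "x \<in> frontier \<Omega> \<Longrightarrow> Y i x \<in> \<Omega>"
    and Y_dist: "x \<in> frontier \<Omega> \<Longrightarrow> dist (Y i x) x < D0 / 2 ^ i"
    and Y_bdist: "x \<in> frontier \<Omega> \<Longrightarrow> c * (D0 / 2 ^ i) \<le> bdist \<Omega> (Y i x)"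
begin

lemma Y_wide_cone:
  assumes "x \<in> frontier \<Omega>"
  shows "dist (Y i x) x \<le> 1 / c * bdist \<Omega> (Y i x)"
proof -
  have "c * dist (Y i x) x \<le> c * (D0 / 2 ^ i)"
    using Y_dist[OF assms, of i] c_pos by (intro mult_left_mono) auto
  with Y_bdist[OF assms, of i] have "c * dist (Y i x) x \<le> bdist \<Omega> (Y i x)" by linarith
  then show ?thesis using c_pos by (simp add: field_simps)
qed

lemma Y_bdist_le: "x \<in> frontier \<Omega> \<Longrightarrow> bdist \<Omega> (Y i x) \<le> D0 / 2 ^ i"
  using bdist_le_dist[of x \<Omega> "Y i x"] Y_dist[of x i] by simp

text \<open>The cost of descending through the scales from \<open>J\<close> to \<open>j\<close>,
  bounded independently of both. It is finite because the weight exponent 3/4 leaves the positive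
  power 1/4.\<close>

lemma geometric_quarter_sum: "J \<le> j \<Longrightarrow>
  (\<Sum>i=J..<j. (D0 / 2 ^ i) powr (1/4)) \<le> D0 powr (1/4) / (1 - (1/2) powr (1/4))"
proof -
  define q :: real where "q = (1/2) powr (1/4)"
  have q: "0 < q" "q < 1" using powr_less_mono2[of "1/4" "1/2" 1] by (auto simp: q_def)
  have e: "(D0 / 2 ^ i) powr (1/4) = D0 powr (1/4) * q ^ i" for i
  proof -
    have "(D0 / 2 ^ i) powr (1/4) = D0 powr (1/4) * ((1/2) ^ i) powr (1/4)"
      using D0_pos by (simp add: powr_mult[symmetric] power_one_over)
    also have "((1/2::real) ^ i) powr (1/4) = q ^ i"
      by (simp add: q_def powr_powr powr_realpow[symmetric] mult.commute del: powr_realpow)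
    finally show ?thesis .
  qed
  have "(\<Sum>i=J..<j. q ^ i) \<le> (\<Sum>i. q ^ i)"
    using q by (intro sum_le_suminf summable_geometric) auto
  also have "\<dots> = 1 / (1 - q)" using q by (intro suminf_geometric) auto
  finally show ?thesis unfolding e q_def[symmetric] sum_distrib_left[symmetric]
    using mult_left_mono[of _ _ "D0 powr (1/4)"] by fastforce
qed

text \<open>Consecutive corkscrew points are joined by boundedly many hops, and the costs of the
  scales form a geometric series. The first estimate uses only points of height up to a multiple of
  the scale \<open>J\<close>; this locality makes the trace estimate small for large
  \<open>J\<close>. The second one continues the chain to \<open>ystar\<close> and starts it at an
  arbitrary cone point.\<close>

lemma oscillation_in_wide_cone:
  assumes "ystar \<in> \<Omega>" "0 \<le> K0"
  obtains K C where "0 < K" "0 < C"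
    "\<And>\<rho> D T x J j. hop_potential \<Omega> \<rho> D \<Longrightarrow> 0 \<le> T \<Longrightarrow> x \<in> frontier \<Omega> \<Longrightarrow> J \<le> j \<Longrightarrow>
       (\<And>w. w \<in> wide_cone K \<Omega> x \<Longrightarrow> bdist \<Omega> w \<le> K * (D0 / 2 ^ J) \<Longrightarrow> bdist \<Omega> w powr (3/4) * D w \<le> T) \<Longrightarrow>
       \<bar>\<rho> (Y J x) - \<rho> (Y j x)\<bar> \<le> C * T"
    "\<And>\<rho> D T x y. hop_potential \<Omega> \<rho> D \<Longrightarrow> 0 \<le> T \<Longrightarrow> x \<in> frontier \<Omega> \<Longrightarrow>
       (\<And>w. w \<in> wide_cone K \<Omega> x \<Longrightarrow> bdist \<Omega> w powr (3/4) * D w \<le> T) \<Longrightarrow>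
       y \<in> wide_cone K0 \<Omega> x \<Longrightarrow> \<bar>\<rho> y - \<rho> ystar\<bar> \<le> C * T"
proof -
  obtain L where L: "0 < L" "\<And>y x. y \<in> closure \<Omega> \<Longrightarrow> x \<in> closure \<Omega> \<Longrightarrow> dist y x \<le> L"
  proof -
    have b: "bounded (closure \<Omega>)" using bounded_dom by (rule bounded_closure)
    show ?thesis
      by (rule that[of "diameter (closure \<Omega>) + 1"])
         (use diameter_bounded_bound[OF b] diameter_ge_0[OF b] in \<open>fastforce simp: add_increasing2\<close>)+
  qed
  have frcl: "x \<in> frontier \<Omega> \<Longrightarrow> x \<in> closure \<Omega>" for x by (simp add: frontier_def)
  have bL: "bdist \<Omega> y \<le> L" if "y \<in> \<Omega>" "x \<in> frontier \<Omega>" for x y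
    using bdist_le_dist[OF that(2), of y] L(2)[of y x] frcl that closure_subset by force
  have ys: "0 < bdist \<Omega> ystar" using bdist_pos open_dom bounded_dom assms by blast
  \<comment> \<open>The summands cover the three kinds of links: two consecutive corkscrew points, a
    cone point and the corkscrew point of comparable height, and the coarsest corkscrew point and
    \<open>ystar\<close>.\<close>
  define R where "R = 4 / c + (K0 + 2 * D0 / L) / min 1 (c * D0 / L) + L / min (c * D0) (bdist \<Omega> ystar)"
  have Rpos: "0 \<le> (K0 + 2 * D0 / L) / min 1 (c * D0 / L)" "0 \<le> L / min (c * D0) (bdist \<Omega> ystar)" "0 \<le> 4 / c"
    using c_pos D0_pos L ys assms by (auto simp: min_def)
  then have R0: "0 \<le> R" by (simp add: R_def)
  obtain m where m: "\<And>x y. x \<in> \<Omega> \<Longrightarrow> y \<in> \<Omega> \<Longrightarrow> dist x y \<le> R * min (bdist \<Omega> x) (bdist \<Omega> y) \<Longrightarrow>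
     (x, y) \<in> hop \<Omega> ^^ m"
    using harnack_relpow[OF open_dom bounded_dom harnack R0] by blast
  define A where "A = max K0 (1 / c)"
  have A0: "0 \<le> A" using assms by (simp add: A_def)
  define K where "K = ((9/8)^m + A) * (9/8)^m"
  have Kge: "(9/8)^m \<le> K"
  proof -
    have "1 * (9/8)^m \<le> ((9/8)^m + A) * (9/8::real)^m" using A0 by (intro mult_right_mono add_increasing2) auto
    then show ?thesis by (simp add: K_def)
  qed
  then have Kpos: "0 < K" by (rule less_le_trans[rotated]) simp
  define B where "B = 3 * real m * (9/8::real)^m"
  have B0: "0 \<le> B" by (simp add: B_def)
  define C where "C = B * (D0 powr (1/4) / (1 - (1/2) powr (1/4))) + B * L powr (1/4) + B * D0 powr (1/4) + 1"
  have half: "(1/2::real) powr (1/4) < 1" using powr_less_mono2[of "1/4" "1/2" "1::real"] by auto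
  have Cparts: "0 \<le> B * (D0 powr (1/4) / (1 - (1/2) powr (1/4)))" "0 \<le> B * L powr (1/4)" "0 \<le> B * D0 powr (1/4)"
    using B0 half by auto
  have link: "\<bar>\<rho> a - \<rho> b\<bar> \<le> B * T * bdist \<Omega> a powr (1/4)"
    if "hop_potential \<Omega> \<rho> D" "0 \<le> T" "a \<in> \<Omega>" "b \<in> \<Omega>" "dist a b \<le> R * min (bdist \<Omega> a) (bdist \<Omega> b)"
      "dist a x \<le> A * bdist \<Omega> a" 
      "\<And>w. w \<in> wide_cone K \<Omega> x \<Longrightarrow> bdist \<Omega> w \<le> K * bdist \<Omega> a \<Longrightarrow> bdist \<Omega> w powr (3/4) * D w \<le> T"
    for \<rho> D T a b x
  proof -
    have "\<bar>\<rho> a - \<rho> b\<bar> \<le> 3 * real m * (9/8)^m * T * bdist \<Omega> a powr (1/4)"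
    proof (rule relpow_hop_potential[OF open_dom bounded_dom that(1,2,3) m[OF that(3,4,5)]])
      fix w j assume "j \<le> m" "(a, w) \<in> hop \<Omega> ^^ j"
      note wc = relpow_hop_wide_cone[OF this(2,1) that(3,6) A0, folded K_def]
      show "bdist \<Omega> w powr (3/4) * D w \<le> T"
        by (rule that(7)[OF wc(1) order_trans[OF wc(2) mult_right_mono[OF Kge bdist_nonneg]]])
    qed
    then show ?thesis by (simp add: B_def)
  qed
  have quarter: "bdist \<Omega> a powr (1/4) \<le> e powr (1/4)" if "bdist \<Omega> a \<le> e" for a e
    using that bdist_nonneg by (intro powr_mono2) auto
  have Ycone: "dist (Y i x) x \<le> A * bdist \<Omega> (Y i x)" if "x \<in> frontier \<Omega>" for i x
    using Y_wide_cone[OF that, of i] mult_right_mono[of "1/c" A "bdist \<Omega> (Y i x)"] bdist_nonneg[of \<Omega> "Y i x"]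
    by (simp add: A_def)
  have local: "\<bar>\<rho> (Y J x) - \<rho> (Y j x)\<bar> \<le> B * (D0 powr (1/4) / (1 - (1/2) powr (1/4))) * T"
    if h: "hop_potential \<Omega> \<rho> D" "0 \<le> T" "x \<in> frontier \<Omega>" "J \<le> j"
       "\<And>w. w \<in> wide_cone K \<Omega> x \<Longrightarrow> bdist \<Omega> w \<le> K * (D0 / 2 ^ J) \<Longrightarrow> bdist \<Omega> w powr (3/4) * D w \<le> T"
    for \<rho> D T x J j
  proof -
    have inc: "\<bar>\<rho> (Y i x) - \<rho> (Y (Suc i) x)\<bar> \<le> B * T * (D0 / 2 ^ i) powr (1/4)" if "J \<le> i" for i
    proof -
      have rJ: "D0 / 2 ^ i \<le> D0 / 2 ^ J" using D0_pos that by (intro divide_left_mono) auto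
      have "dist (Y i x) (Y (Suc i) x) \<le> D0 / 2 ^ i + D0 / 2 ^ Suc i"
        using Y_dist[OF h(3), of i] Y_dist[OF h(3), of "Suc i"] dist_triangle2[of "Y i x" "Y (Suc i) x" x] by simp
      also have "\<dots> \<le> 4 / c * (c * (D0 / 2 ^ Suc i))" using D0_pos c_pos by (simp add: field_simps)
      also have "\<dots> \<le> R * min (bdist \<Omega> (Y i x)) (bdist \<Omega> (Y (Suc i) x))"
      proof (rule mult_mono)
        have "c * (D0 / 2 ^ Suc i) \<le> c * (D0 / 2 ^ i)" using D0_pos c_pos by (simp add: field_simps)
        then show "c * (D0 / 2 ^ Suc i) \<le> min (bdist \<Omega> (Y i x)) (bdist \<Omega> (Y (Suc i) x))"
          using Y_bdist[OF h(3), of i] Y_bdist[OF h(3), of "Suc i"] by simp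
        show "4 / c \<le> R" using Rpos by (simp add: R_def)
      qed (use R0 c_pos D0_pos in auto)
      finally have d: "dist (Y i x) (Y (Suc i) x) \<le> R * min (bdist \<Omega> (Y i x)) (bdist \<Omega> (Y (Suc i) x))" .
      have "\<bar>\<rho> (Y i x) - \<rho> (Y (Suc i) x)\<bar> \<le> B * T * bdist \<Omega> (Y i x) powr (1/4)"
      proof (rule link[OF h(1,2) Y_in[OF h(3)] Y_in[OF h(3)] d Ycone[OF h(3)]])
        fix w assume w: "w \<in> wide_cone K \<Omega> x" "bdist \<Omega> w \<le> K * bdist \<Omega> (Y i x)"
        have "K * bdist \<Omega> (Y i x) \<le> K * (D0 / 2 ^ J)"
          using Kpos Y_bdist_le[OF h(3), of i] rJ by (intro mult_left_mono) auto
        then show "bdist \<Omega> w powr (3/4) * D w \<le> T" using w by (intro h(5)) auto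
      qed
      also have "\<dots> \<le> B * T * (D0 / 2 ^ i) powr (1/4)"
        using B0 h(2) by (intro mult_left_mono quarter Y_bdist_le[OF h(3)]) auto
      finally show ?thesis .
    qed
    have "\<bar>\<rho> (Y J x) - \<rho> (Y j x)\<bar> \<le> (\<Sum>i=J..<j. B * T * (D0 / 2 ^ i) powr (1/4))"
      using h(4)
    proof (induction j rule: dec_induct)
      case (step n)
      then show ?case using \<open>J \<le> n\<close> inc[of n] by simp
    qed simp
    also have "\<dots> = B * T * (\<Sum>i=J..<j. (D0 / 2 ^ i) powr (1/4))" by (simp add: sum_distrib_left)
    also have "\<dots> \<le> B * T * (D0 powr (1/4) / (1 - (1/2) powr (1/4)))"
      using B0 h(2) by (intro mult_left_mono geometric_quarter_sum h(4)) auto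
    finally show ?thesis by (simp add: mult_ac)
  qed
  show ?thesis
  proof (rule that[of K C])
    show "0 < K" by (rule Kpos)
    show "0 < C" using Cparts by (simp add: C_def)
  next
    fix \<rho> D T x J j
    assume h: "hop_potential \<Omega> \<rho> D" "0 \<le> T" "x \<in> frontier \<Omega>" "J \<le> j"
       "\<And>w. w \<in> wide_cone K \<Omega> x \<Longrightarrow> bdist \<Omega> w \<le> K * (D0 / 2 ^ J) \<Longrightarrow> bdist \<Omega> w powr (3/4) * D w \<le> T"
    have "\<bar>\<rho> (Y J x) - \<rho> (Y j x)\<bar> \<le> B * (D0 powr (1/4) / (1 - (1/2) powr (1/4))) * T"
      by (rule local[OF h])
    also have "\<dots> \<le> C * T" using Cparts h(2) by (intro mult_right_mono) (auto simp: C_def)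
    finally show "\<bar>\<rho> (Y J x) - \<rho> (Y j x)\<bar> \<le> C * T" .
  next
    fix \<rho> D T x y
    assume h: "hop_potential \<Omega> \<rho> D" "0 \<le> T" "x \<in> frontier \<Omega>"
       "\<And>w. w \<in> wide_cone K \<Omega> x \<Longrightarrow> bdist \<Omega> w powr (3/4) * D w \<le> T"
       "y \<in> wide_cone K0 \<Omega> x"
    have y: "y \<in> \<Omega>" "dist y x \<le> K0 * bdist \<Omega> y" using h(5) by (auto simp: wide_cone_def)
    have dy: "0 < bdist \<Omega> y" using bdist_pos open_dom bounded_dom y by blast
    \<comment> \<open>Heights are at most \<open>L\<close>; the factor \<open>D0 / L\<close> brings
      them into the range up to \<open>D0\<close> that the dyadic scales cover.\<close>
    define t where "t = bdist \<Omega> y / L * D0"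
    have t: "0 < t" "t \<le> D0" using dy L(1) D0_pos bL[OF y(1) h(3)] by (auto simp: t_def field_simps)
    obtain j where j: "t \<le> D0 / 2 ^ j" "D0 / 2 ^ j \<le> 2 * t" by (rule dyadic_scale[OF t])
    have d1: "dist y (Y j x) \<le> R * min (bdist \<Omega> y) (bdist \<Omega> (Y j x))"
    proof -
      have "dist y (Y j x) \<le> K0 * bdist \<Omega> y + 2 * t"
        using y(2) Y_dist[OF h(3), of j] j(2) dist_triangle2[of y "Y j x" x] by simp
      also have "\<dots> = (K0 + 2 * D0 / L) * bdist \<Omega> y" by (simp add: t_def algebra_simps)
      also have "\<dots> = (K0 + 2 * D0 / L) / min 1 (c * D0 / L) * (min 1 (c * D0 / L) * bdist \<Omega> y)"
      proof -
        have "min 1 (c * D0 / L) \<noteq> 0" using c_pos D0_pos L by (auto simp: min_def)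
        then show ?thesis by simp
      qed
      also have "\<dots> \<le> R * min (bdist \<Omega> y) (bdist \<Omega> (Y j x))"
      proof (rule mult_mono)
        have "min 1 (c * D0 / L) * bdist \<Omega> y \<le> 1 * bdist \<Omega> y" using dy by (intro mult_right_mono) auto
        moreover have "min 1 (c * D0 / L) * bdist \<Omega> y \<le> (c * D0 / L) * bdist \<Omega> y" using dy by (intro mult_right_mono) auto
        moreover have "(c * D0 / L) * bdist \<Omega> y = c * t" by (simp add: t_def)
        moreover have "c * t \<le> c * (D0 / 2 ^ j)" using c_pos j(1) by (intro mult_left_mono) auto
        ultimately show "min 1 (c * D0 / L) * bdist \<Omega> y \<le> min (bdist \<Omega> y) (bdist \<Omega> (Y j x))"
          using Y_bdist[OF h(3), of j] by simp
        show "(K0 + 2 * D0 / L) / min 1 (c * D0 / L) \<le> R" using Rpos by (simp add: R_def)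
        show "0 \<le> min 1 (c * D0 / L) * bdist \<Omega> y" using c_pos D0_pos L(1) dy by simp
      qed (rule R0)
      finally show ?thesis .
    qed
    have d2: "dist (Y 0 x) ystar \<le> R * min (bdist \<Omega> (Y 0 x)) (bdist \<Omega> ystar)"
    proof -
      have "dist (Y 0 x) ystar \<le> L" using L(2) Y_in[OF h(3), of 0] assms(1) closure_subset by blast
      also have "\<dots> = L / min (c * D0) (bdist \<Omega> ystar) * min (c * D0) (bdist \<Omega> ystar)"
      proof -
        have "min (c * D0) (bdist \<Omega> ystar) \<noteq> 0" using c_pos D0_pos ys by (auto simp: min_def)
        then show ?thesis by simp
      qed
      also have "\<dots> \<le> R * min (bdist \<Omega> (Y 0 x)) (bdist \<Omega> ystar)"
      proof (rule mult_mono)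
        show "L / min (c * D0) (bdist \<Omega> ystar) \<le> R" using Rpos by (simp add: R_def)
        show "min (c * D0) (bdist \<Omega> ystar) \<le> min (bdist \<Omega> (Y 0 x)) (bdist \<Omega> ystar)"
          using Y_bdist[OF h(3), of 0] by simp
        show "0 \<le> min (c * D0) (bdist \<Omega> ystar)" using c_pos D0_pos ys by simp
      qed (rule R0)
      finally show ?thesis .
    qed
    have "K0 * bdist \<Omega> y \<le> A * bdist \<Omega> y" using dy by (intro mult_right_mono) (auto simp: A_def)
    then have "dist y x \<le> A * bdist \<Omega> y" using y(2) by linarith
    from link[OF h(1,2) y(1) Y_in[OF h(3)] d1 this h(4)]
    have "\<bar>\<rho> y - \<rho> (Y j x)\<bar> \<le> B * T * bdist \<Omega> y powr (1/4)" by simp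
    also have "\<dots> \<le> B * T * L powr (1/4)"
      using B0 h(2) bL[OF y(1) h(3)] by (intro mult_left_mono quarter) auto
    finally have e1: "\<bar>\<rho> y - \<rho> (Y j x)\<bar> \<le> B * T * L powr (1/4)" .
    from link[OF h(1,2) Y_in[OF h(3)] assms(1) d2 Ycone[OF h(3)] h(4)]
    have "\<bar>\<rho> (Y 0 x) - \<rho> ystar\<bar> \<le> B * T * bdist \<Omega> (Y 0 x) powr (1/4)" by simp
    also have "\<dots> \<le> B * T * D0 powr (1/4)"
      using B0 h(2) Y_bdist_le[OF h(3), of 0] by (intro mult_left_mono quarter) auto
    finally have e2: "\<bar>\<rho> (Y 0 x) - \<rho> ystar\<bar> \<le> B * T * D0 powr (1/4)" .
    have e3: "\<bar>\<rho> (Y 0 x) - \<rho> (Y j x)\<bar> \<le> B * (D0 powr (1/4) / (1 - (1/2) powr (1/4))) * T"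
      by (rule local[OF h(1,2,3) _ h(4)]) auto
    have "C * T = B * (D0 powr (1/4) / (1 - (1/2) powr (1/4))) * T + B * T * L powr (1/4) + B * T * D0 powr (1/4) + T"
      by (simp add: C_def algebra_simps)
    then show "\<bar>\<rho> y - \<rho> ystar\<bar> \<le> C * T" using e1 e2 e3 h(2) by linarith
  qed
qed

end

lemma corkscrew_family_exists:
  fixes \<Omega> :: "'a::euclidean_space set"
  assumes "open \<Omega>" "bounded \<Omega>" "\<Omega> \<noteq> {}" "corkscrew_condition \<Omega>" "harnack_chain_condition \<Omega>"
  obtains c D0 Y where "corkscrew_family \<Omega> c D0 Y"
proof -
  from assms(4) obtain c where c: "0 < c" "c < 1" and cork: "\<And>x r. x \<in> frontier \<Omega> \<Longrightarrow> 0 < r \<Longrightarrow> ennreal r < ediam \<Omega> \<Longrightarrow>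
           (\<exists>y \<in> ball x r \<inter> \<Omega>. ball y (c * r) \<subseteq> ball x r \<inter> \<Omega>)"
    unfolding corkscrew_condition_def by blast
  obtain a where a: "a \<in> \<Omega>" using assms(3) by blast
  obtain e where e: "0 < e" "ball a e \<subseteq> \<Omega>" using assms(1) a openE by blast
  obtain b where b: "b \<in> ball a e" "b \<noteq> a"
  proof -
    obtain v :: 'a where "v \<in> Basis" using nonempty_Basis by blast
    then have "norm ((e/2) *\<^sub>R v) = e/2" "v \<noteq> 0" using e by auto
    then show ?thesis using e by (intro that[of "a + (e/2) *\<^sub>R v"]) (auto simp: dist_norm)
  qed
  \<comment> \<open>Half the distance of two points of \<Omega> is strictly below
    \<open>ediam \<Omega>\<close>, so every scale is admissible in the corkscrew condition.\<close>
  define D0 where "D0 = dist a b / 2"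
  have D0: "0 < D0" using b by (auto simp: D0_def)
  have "ennreal (dist a b) \<le> ediam \<Omega>" unfolding ediam_def using a b e by (intro SUP_upper2[of "(a,b)"]) auto
  moreover have "ennreal r < ennreal (dist a b)" if "r \<le> D0" for r
    using that D0 unfolding D0_def by (intro ennreal_lessI) linarith+
  ultimately have small: "ennreal r < ediam \<Omega>" if "r \<le> D0" for r using that by (meson less_le_trans)
  have rD: "D0 / 2 ^ i \<le> D0" "0 < D0 / 2 ^ i" for i :: nat using D0 by (auto simp: field_simps)
  define Y where "Y i x = (SOME y. y \<in> ball x (D0 / 2 ^ i) \<inter> \<Omega> \<and> ball y (c * (D0 / 2 ^ i)) \<subseteq> ball x (D0 / 2 ^ i) \<inter> \<Omega>)"
    for i :: nat and x
  have Y: "Y i x \<in> ball x (D0 / 2 ^ i) \<inter> \<Omega> \<and> ball (Y i x) (c * (D0 / 2 ^ i)) \<subseteq> ball x (D0 / 2 ^ i) \<inter> \<Omega>"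
    if "x \<in> frontier \<Omega>" for i x
    unfolding Y_def by (rule someI_ex) (use cork[OF that rD(2) small[OF rD(1)], of i] in blast)
  have "corkscrew_family \<Omega> c D0 Y"
  proof
    fix x i assume x: "x \<in> frontier \<Omega>"
    show "Y i x \<in> \<Omega>" using Y[OF x] by blast
    show "dist (Y i x) x < D0 / 2 ^ i" using Y[OF x, of i] by (auto simp: dist_commute)
    show "c * (D0 / 2 ^ i) \<le> bdist \<Omega> (Y i x)"
      by (rule bdist_ge_ball) (use Y[OF x, of i] assms x in auto)
  qed (use assms c D0 in auto)
  then show ?thesis by (rule that)
qed

section \<open>Poincare's inequality\<close>

definition C1_fun :: "(real^'n \<Rightarrow> real) \<Rightarrow> bool" where
  "C1_fun \<phi> \<longleftrightarrow> (\<forall>x. \<phi> differentiable (at x)) \<and> continuous_on UNIV (grad \<phi>)"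

lemma grad_has_derivative:
  assumes "\<phi> differentiable (at x)"
  shows "(\<phi> has_derivative (\<lambda>h. grad \<phi> x \<bullet> h)) (at x)"
proof -
  have d: "(\<phi> has_derivative frechet_derivative \<phi> (at x)) (at x)"
    using assms frechet_derivative_works by blast
  then have lin: "linear (frechet_derivative \<phi> (at x))" by (rule has_derivative_linear)
  have "frechet_derivative \<phi> (at x) h = grad \<phi> x \<bullet> h" for h
  proof -
    have "frechet_derivative \<phi> (at x) h = frechet_derivative \<phi> (at x) (\<Sum>i\<in>UNIV. h $ i *\<^sub>R axis i 1)"
      by (simp add: basis_expansion scalar_mult_eq_scaleR[symmetric])
    also have "\<dots> = (\<Sum>i\<in>UNIV. h $ i * frechet_derivative \<phi> (at x) (axis i 1))"
      by (subst linear_sum[OF lin]) (simp add: linear_scale[OF lin])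
    also have "\<dots> = grad \<phi> x \<bullet> h" by (simp add: grad_def inner_vec_def mult.commute)
    finally show ?thesis .
  qed
  then have "frechet_derivative \<phi> (at x) = (\<lambda>h. grad \<phi> x \<bullet> h)" by blast
  with d show ?thesis by simp
qed

lemma grad_eqI:
  assumes "(\<phi> has_derivative (\<lambda>h. v \<bullet> h)) (at x)"
  shows "grad \<phi> x = v"
  by (simp add: grad_def vec_eq_iff inner_axis frechet_derivative_at[OF assms, symmetric])

lemma C1_fun_continuous: "C1_fun \<phi> \<Longrightarrow> continuous_on UNIV \<phi>"
  unfolding C1_fun_def by (meson continuous_at_imp_continuous_on differentiable_imp_continuous_within)

lemma C1_fun_borel: "C1_fun \<phi> \<Longrightarrow> \<phi> \<in> borel_measurable borel" "C1_fun \<phi> \<Longrightarrow> grad \<phi> \<in> borel_measurable borel"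
  using C1_fun_continuous unfolding C1_fun_def by (blast intro: borel_measurable_continuous_onI)+

lemma ennreal_abs_square: "ennreal \<bar>a\<bar> ^ 2 = ennreal (a\<^sup>2)"
  by (simp add: ennreal_power)

text \<open>The fundamental theorem of calculus along the segment, followed by the Cauchy-Schwarz
  inequality.\<close>

lemma segment_square_bound:
  assumes "C1_fun \<phi>"
  shows "ennreal ((\<phi> y - \<phi> x)\<^sup>2) \<le> ennreal ((dist x y)\<^sup>2) *
     (\<integral>\<^sup>+t. indicator {0..1} t * ennreal ((norm (grad \<phi> (x + t *\<^sub>R (y - x))))\<^sup>2) \<partial>lborel)"
proof -
  define p where "p t = x + t *\<^sub>R (y - x)" for t :: real
  define h where "h t = grad \<phi> (p t) \<bullet> (y - x)" for t
  define I where "I t = (indicator {0..1::real} t :: real)" for t :: real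
  have cg: "continuous_on UNIV (\<lambda>t. grad \<phi> (p t))"
  proof -
    have "continuous_on UNIV (grad \<phi>)" using assms by (simp add: C1_fun_def)
    moreover have "continuous_on UNIV p" unfolding p_def by (intro continuous_intros)
    ultimately show ?thesis by (rule continuous_on_compose2) simp
  qed
  have ch: "continuous_on S h" for S
  proof -
    have "continuous_on UNIV h" unfolding h_def by (rule continuous_on_inner[OF cg continuous_on_const])
    then show ?thesis by (rule continuous_on_subset) simp
  qed
  have "((\<lambda>t. \<phi> (p t)) has_vector_derivative h t) (at t within {0..1})" for t
  proof -
    have "(\<phi> has_derivative (\<lambda>h. grad \<phi> (p t) \<bullet> h)) (at (p t) within p ` {0..1})"
      using assms by (intro has_derivative_at_withinI[OF grad_has_derivative]) (simp add: C1_fun_def)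
    moreover have "(p has_derivative (\<lambda>s. s *\<^sub>R (y - x))) (at t within {0..1})"
      unfolding p_def by (auto intro!: derivative_eq_intros)
    ultimately have "((\<lambda>t. \<phi> (p t)) has_derivative (\<lambda>s. grad \<phi> (p t) \<bullet> (s *\<^sub>R (y - x)))) (at t within {0..1})"
      by (rule has_derivative_in_compose[rotated])
    then show ?thesis by (simp add: has_vector_derivative_def h_def)
  qed
  then have ftc: "integral\<^sup>L lborel (\<lambda>t. I t *\<^sub>R h t) = \<phi> y - \<phi> x"
    unfolding I_def using integral_FTC_atLeastAtMost[of 0 1 "\<lambda>t. \<phi> (p t)" h] ch by (simp add: p_def)
  have int: "integrable lborel (\<lambda>t. I t *\<^sub>R h t)"
    unfolding I_def by (rule borel_integrable_atLeastAtMost'[OF ch, unfolded set_integrable_def])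
  have hm[measurable]: "h \<in> borel_measurable borel" "(\<lambda>t. grad \<phi> (p t)) \<in> borel_measurable borel"
    using ch[of UNIV] cg by (auto intro: borel_measurable_continuous_onI)
  have [measurable]: "I \<in> borel_measurable borel" unfolding I_def by measurable
  \<comment> \<open>The indicator is inserted a second time so that the second Cauchy-Schwarz factor
    is the length of the unit interval.\<close>
  have "ennreal \<bar>\<phi> y - \<phi> x\<bar> \<le> (\<integral>\<^sup>+t. ennreal \<bar>I t * h t\<bar> * ennreal \<bar>I t\<bar> \<partial>lborel)"
  proof -
    have "ennreal \<bar>\<phi> y - \<phi> x\<bar> \<le> (\<integral>\<^sup>+t. ennreal (norm (I t *\<^sub>R h t)) \<partial>lborel)"
      using integral_norm_bound_ennreal[OF int] unfolding ftc by simp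
    also have "\<dots> = (\<integral>\<^sup>+t. ennreal \<bar>I t * h t\<bar> * ennreal \<bar>I t\<bar> \<partial>lborel)"
      by (intro nn_integral_cong) (simp add: I_def indicator_def)
    finally show ?thesis .
  qed
  then have "ennreal \<bar>\<phi> y - \<phi> x\<bar> ^ 2 \<le> (\<integral>\<^sup>+t. ennreal \<bar>I t * h t\<bar> * ennreal \<bar>I t\<bar> \<partial>lborel) ^ 2"
    by (rule power_mono) simp
  also have "\<dots> \<le> (\<integral>\<^sup>+t. ennreal \<bar>I t * h t\<bar> ^ 2 \<partial>lborel) * (\<integral>\<^sup>+t. ennreal \<bar>I t\<bar> ^ 2 \<partial>lborel)"
    by (rule Cauchy_Schwarz_nn_integral) measurable
  also have "(\<integral>\<^sup>+t. ennreal \<bar>I t\<bar> ^ 2 \<partial>lborel) = (\<integral>\<^sup>+t. indicator {0..1::real} t \<partial>lborel)"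
    by (intro nn_integral_cong) (auto simp: I_def indicator_def)
  also have "\<dots> = 1" by simp
  also have "(\<integral>\<^sup>+t. ennreal \<bar>I t * h t\<bar> ^ 2 \<partial>lborel) \<le>
     (\<integral>\<^sup>+t. ennreal ((dist x y)\<^sup>2) * (indicator {0..1} t * ennreal ((norm (grad \<phi> (p t)))\<^sup>2)) \<partial>lborel)"
  proof (rule nn_integral_mono)
    fix t
    have "\<bar>h t\<bar> \<le> norm (grad \<phi> (p t)) * dist x y"
      unfolding h_def dist_norm using Cauchy_Schwarz_ineq2[of "grad \<phi> (p t)" "y - x"]
      by (simp add: norm_minus_commute)
    from power_mono[OF this, of 2]
    have "ennreal ((h t)\<^sup>2) \<le> ennreal ((dist x y)\<^sup>2 * (norm (grad \<phi> (p t)))\<^sup>2)"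
      by (intro ennreal_leI) (simp add: power_mult_distrib mult.commute)
    then show "ennreal \<bar>I t * h t\<bar> ^ 2 \<le> ennreal ((dist x y)\<^sup>2) * (indicator {0..1} t * ennreal ((norm (grad \<phi> (p t)))\<^sup>2))"
      by (cases "t \<in> {0..1}") (simp_all add: I_def ennreal_abs_square ennreal_mult)
  qed
  also have "\<dots> = ennreal ((dist x y)\<^sup>2) * (\<integral>\<^sup>+t. (indicator {0..1} t * ennreal ((norm (grad \<phi> (p t)))\<^sup>2)) \<partial>lborel)"
    by (rule nn_integral_cmult) measurable
  finally show ?thesis by (simp add: ennreal_abs_square p_def)
qed

text \<open>The substitution has Jacobian \<open>t ^ DIM('a)\<close>, and for t at least 1/2 its
  inverse is bounded uniformly in t.\<close>

lemma nn_integral_affine_le: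
  fixes F :: "'a::euclidean_space \<Rightarrow> ennreal"
  assumes [measurable]: "F \<in> borel_measurable borel" and t: "1/2 \<le> t"
  shows "(\<integral>\<^sup>+y. F (s + t *\<^sub>R y) \<partial>lborel) \<le> ennreal (2 ^ DIM('a)) * (\<integral>\<^sup>+y. F y \<partial>lborel)"
proof -
  have "(\<integral>\<^sup>+y. F y \<partial>lborel) = ennreal (t ^ DIM('a)) * (\<integral>\<^sup>+y. F (s + t *\<^sub>R y) \<partial>lborel)"
    using t by (subst lborel_affine[of t s]) (simp_all add: nn_integral_density nn_integral_distr nn_integral_cmult)
  then have "ennreal (2 ^ DIM('a)) * (\<integral>\<^sup>+y. F y \<partial>lborel) = ennreal ((2 * t) ^ DIM('a)) * (\<integral>\<^sup>+y. F (s + t *\<^sub>R y) \<partial>lborel)"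
    using t by (simp add: power_mult_distrib ennreal_mult mult.assoc)
  moreover have "1 \<le> (2 * t) ^ DIM('a)" by (rule one_le_power) (use t in simp)
  then have "1 \<le> ennreal ((2 * t) ^ DIM('a))" by (metis ennreal_1 ennreal_leI)
  ultimately show ?thesis by (metis mult_1 mult_right_mono zero_le)
qed

text \<open>The squared gradient along segments is integrated over both endpoints and the parameter
  t. For t \<ge> 1/2 the point on the segment replaces y as variable; for t \<le> 1/2 the integrals
  are exchanged and it replaces x. One of the two substitutions always has a controlled Jacobian, so
  no singularity arises at t = 0 or t = 1.\<close>

lemma double_integral_ball_bound:
  assumes "C1_fun (\<phi> :: real^'n \<Rightarrow> real)"
  shows "(\<integral>\<^sup>+x. (\<integral>\<^sup>+y. indicator (ball w r) x * indicator (ball w r) y * ennreal ((\<phi> y - \<phi> x)\<^sup>2) \<partial>lborel) \<partial>lborel)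
     \<le> ennreal ((2 * r)\<^sup>2 * 2 ^ CARD('n)) * emeasure lborel (ball w r) *
        (\<integral>\<^sup>+z. indicator (ball w r) z * ennreal ((norm (grad \<phi> z))\<^sup>2) \<partial>lborel)"
proof (cases "r \<le> 0")
  case True
  then have e: "ball w r = {}" by simp
  show ?thesis unfolding e by simp
next
  case False
  then have r: "0 < r" by simp
  define B where "B = ball w r"
  define F where "F z = (indicator B z * ennreal ((norm (grad \<phi> z))\<^sup>2))" for z
  have [measurable]: "grad \<phi> \<in> borel_measurable borel" "B \<in> sets borel" using C1_fun_borel[OF assms] by (auto simp: B_def)
  have Fm[measurable]: "F \<in> borel_measurable borel" unfolding F_def by measurable
  define G where "G t x y = (indicator {0..1::real} t * indicator B x * indicator B y * F (x + t *\<^sub>R (y - x)))" for t x y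
  have I2: "(\<integral>\<^sup>+x. (\<integral>\<^sup>+y. G t x y \<partial>lborel) \<partial>lborel) \<le> ennreal (2 ^ CARD('n)) * emeasure lborel B * (\<integral>\<^sup>+z. F z \<partial>lborel) * indicator {0..1} t" for t
  proof (cases "t \<in> {0..1}")
    case True
    define Q where "Q = ennreal (2 ^ CARD('n)) * (\<integral>\<^sup>+z. F z \<partial>lborel)"
    consider "1/2 \<le> t" | "1/2 \<le> 1 - t" by linarith
    then have "(\<integral>\<^sup>+x. (\<integral>\<^sup>+y. G t x y \<partial>lborel) \<partial>lborel) \<le> (\<integral>\<^sup>+x. Q * indicator B x \<partial>lborel)"
    proof cases
      case 1
      show ?thesis
      proof (rule nn_integral_mono)
        fix x
        have "(\<integral>\<^sup>+y. G t x y \<partial>lborel) \<le> (\<integral>\<^sup>+y. indicator B x * F ((1 - t) *\<^sub>R x + t *\<^sub>R y) \<partial>lborel)"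
          by (intro nn_integral_mono) (auto simp: G_def indicator_def algebra_simps)
        also have "\<dots> = indicator B x * (\<integral>\<^sup>+y. F ((1 - t) *\<^sub>R x + t *\<^sub>R y) \<partial>lborel)"
          by (rule nn_integral_cmult) measurable
        also have "\<dots> \<le> indicator B x * Q" unfolding Q_def
          using nn_integral_affine_le[OF Fm 1, of "(1 - t) *\<^sub>R x"] by (intro mult_left_mono) auto
        finally show "(\<integral>\<^sup>+y. G t x y \<partial>lborel) \<le> Q * indicator B x" by (simp add: mult.commute)
      qed
    next
      case 2
      have "(\<integral>\<^sup>+x. (\<integral>\<^sup>+y. G t x y \<partial>lborel) \<partial>lborel) = (\<integral>\<^sup>+y. (\<integral>\<^sup>+x. G t x y \<partial>lborel) \<partial>lborel)"
        unfolding G_def by (rule lborel_pair.Fubini') measurable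
      also have "\<dots> \<le> (\<integral>\<^sup>+x. Q * indicator B x \<partial>lborel)"
      proof (rule nn_integral_mono)
        fix y
        have "(\<integral>\<^sup>+x. G t x y \<partial>lborel) \<le> (\<integral>\<^sup>+x. indicator B y * F (t *\<^sub>R y + (1 - t) *\<^sub>R x) \<partial>lborel)"
          by (intro nn_integral_mono) (auto simp: G_def indicator_def algebra_simps)
        also have "\<dots> = indicator B y * (\<integral>\<^sup>+x. F (t *\<^sub>R y + (1 - t) *\<^sub>R x) \<partial>lborel)"
          by (rule nn_integral_cmult) measurable
        also have "\<dots> \<le> indicator B y * Q" unfolding Q_def
          using nn_integral_affine_le[OF Fm 2, of "t *\<^sub>R y"] by (intro mult_left_mono) auto
        finally show "(\<integral>\<^sup>+x. G t x y \<partial>lborel) \<le> Q * indicator B y" by (simp add: mult.commute)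
      qed
      finally show ?thesis .
    qed
    also have "\<dots> = Q * emeasure lborel B" by (simp add: nn_integral_cmult_indicator)
    finally show ?thesis using True by (simp add: Q_def mult_ac)
  qed (simp add: G_def)
  have "(\<integral>\<^sup>+x. (\<integral>\<^sup>+y. indicator B x * indicator B y * ennreal ((\<phi> y - \<phi> x)\<^sup>2) \<partial>lborel) \<partial>lborel)
    \<le> (\<integral>\<^sup>+x. (\<integral>\<^sup>+y. (\<integral>\<^sup>+t. ennreal ((2 * r)\<^sup>2) * G t x y \<partial>lborel) \<partial>lborel) \<partial>lborel)"
  proof (intro nn_integral_mono)
    fix x y
    show "indicator B x * indicator B y * ennreal ((\<phi> y - \<phi> x)\<^sup>2) \<le> (\<integral>\<^sup>+t. ennreal ((2 * r)\<^sup>2) * G t x y \<partial>lborel)"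
    proof (cases "x \<in> B \<and> y \<in> B")
      case True
      have "dist x y \<le> 2 * r" using True dist_triangle2[of x y w] by (auto simp: B_def dist_commute)
      then have d: "ennreal ((dist x y)\<^sup>2) \<le> ennreal ((2 * r)\<^sup>2)" by (intro ennreal_leI power_mono) auto
      have "ennreal ((\<phi> y - \<phi> x)\<^sup>2) \<le> ennreal ((dist x y)\<^sup>2) *
         (\<integral>\<^sup>+t. indicator {0..1} t * ennreal ((norm (grad \<phi> (x + t *\<^sub>R (y - x))))\<^sup>2) \<partial>lborel)"
        by (rule segment_square_bound[OF assms])
      also have "\<dots> \<le> ennreal ((2 * r)\<^sup>2) * (\<integral>\<^sup>+t. G t x y \<partial>lborel)"
      proof (intro mult_mono d nn_integral_mono)
        fix t :: real
        have "x + t *\<^sub>R (y - x) \<in> B" if "t \<in> {0..1}"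
        proof -
          have "(1 - t) *\<^sub>R x + t *\<^sub>R y \<in> B" using True that unfolding B_def by (intro convexD_alt) auto
          then show ?thesis by (simp add: algebra_simps)
        qed
        then show "indicator {0..1} t * ennreal ((norm (grad \<phi> (x + t *\<^sub>R (y - x))))\<^sup>2) \<le> G t x y"
          using True by (auto simp: G_def F_def indicator_def)
      qed auto
      also have "\<dots> = (\<integral>\<^sup>+t. ennreal ((2 * r)\<^sup>2) * G t x y \<partial>lborel)"
        unfolding G_def by (rule nn_integral_cmult[symmetric]) measurable
      finally show ?thesis using True by simp
    qed auto
  qed
  also have "\<dots> = (\<integral>\<^sup>+x. (\<integral>\<^sup>+t. (\<integral>\<^sup>+y. ennreal ((2 * r)\<^sup>2) * G t x y \<partial>lborel) \<partial>lborel) \<partial>lborel)"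
    unfolding G_def by (intro nn_integral_cong lborel_pair.Fubini') measurable
  also have "\<dots> = (\<integral>\<^sup>+t. (\<integral>\<^sup>+x. (\<integral>\<^sup>+y. ennreal ((2 * r)\<^sup>2) * G t x y \<partial>lborel) \<partial>lborel) \<partial>lborel)"
    unfolding G_def by (intro lborel_pair.Fubini') measurable
  also have "\<dots> = (\<integral>\<^sup>+t. ennreal ((2 * r)\<^sup>2) * (\<integral>\<^sup>+x. (\<integral>\<^sup>+y. G t x y \<partial>lborel) \<partial>lborel) \<partial>lborel)"
    unfolding G_def by (simp add: nn_integral_cmult)
  also have "\<dots> \<le> (\<integral>\<^sup>+t. ennreal ((2 * r)\<^sup>2) * (ennreal (2 ^ CARD('n)) * emeasure lborel B * (\<integral>\<^sup>+z. F z \<partial>lborel) * indicator {0..1::real} t) \<partial>lborel)"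
    by (rule nn_integral_mono) (rule mult_left_mono[OF I2], simp)
  also have "\<dots> = ennreal ((2 * r)\<^sup>2) * (ennreal (2 ^ CARD('n)) * emeasure lborel B * (\<integral>\<^sup>+z. F z \<partial>lborel))"
    unfolding mult.assoc[symmetric] by (subst nn_integral_cmult_indicator) auto
  also have "\<dots> = ennreal ((2 * r)\<^sup>2 * 2 ^ CARD('n)) * emeasure lborel B * (\<integral>\<^sup>+z. F z \<partial>lborel)"
    by (simp add: ennreal_mult mult_ac)
  finally show ?thesis by (simp add: B_def F_def)
qed

section \<open>Square integrals and means\<close>

definition sqint :: "(real^'n) set \<Rightarrow> (real^'n \<Rightarrow> 'b::real_normed_vector) \<Rightarrow> ennreal" where
  "sqint S v = (\<integral>\<^sup>+x. ennreal ((norm (v x))\<^sup>2) \<partial>lebesgue_on S)"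

definition mean_on :: "(real^'n) set \<Rightarrow> (real^'n \<Rightarrow> real) \<Rightarrow> real" where
  "mean_on S u = (\<integral>x. u x \<partial>lebesgue_on S) / measure lebesgue S"

text \<open>
  Approximation by smooth functions comes with the definition of the trace, so no density theorem
  for Sobolev functions is needed.
\<close>

definition w12 :: "(real^'n) set \<Rightarrow> (real^'n \<Rightarrow> real) \<Rightarrow> (real^'n \<Rightarrow> real^'n) \<Rightarrow> bool" where
  "w12 \<Omega> u Du \<longleftrightarrow>
     u \<in> borel_measurable (lebesgue_on \<Omega>) \<and> Du \<in> borel_measurable (lebesgue_on \<Omega>) \<and> sqint \<Omega> Du < \<infinity> \<and>
     (\<exists>\<phi>. (\<forall>k. C1_fun (\<phi> k)) \<and> (\<lambda>k::nat. sqint \<Omega> (\<lambda>x. \<phi> k x - u x)) \<longlonglongrightarrow> 0 \<and>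
        (\<lambda>k. sqint \<Omega> (\<lambda>x. grad (\<phi> k) x - Du x)) \<longlonglongrightarrow> 0)"

text \<open>A real-valued form of the averages under the supremum in \<open>nt_max\<close>, as
  \<open>hop_potential\<close> requires. Because \<open>enn2real\<close> sends infinity to 0, it is
  the quadratic mean only where the square integral is finite.\<close>

definition davg :: "(real^'n) set \<Rightarrow> (real^'n \<Rightarrow> 'b::real_normed_vector) \<Rightarrow> real^'n \<Rightarrow> real" where
  "davg \<Omega> v w = sqrt (enn2real (sqint (wball \<Omega> w) v) / measure lebesgue (wball \<Omega> w))"

definition bmean :: "(real^'n) set \<Rightarrow> (real^'n \<Rightarrow> real) \<Rightarrow> real^'n \<Rightarrow> real" where
  "bmean \<Omega> u w = mean_on (wball \<Omega> w) u"

lemma sqint_set_integral: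
  assumes "S \<in> sets lebesgue"
  shows "sqint S v = (\<integral>\<^sup>+x\<in>S. ennreal ((norm (v x))\<^sup>2) \<partial>lebesgue)"
  unfolding sqint_def using assms by (subst nn_integral_restrict_space) auto

lemma sqint_mono_set:
  assumes "S \<subseteq> T" "S \<in> sets lebesgue" "T \<in> sets lebesgue"
  shows "sqint S v \<le> sqint T v"
  unfolding sqint_set_integral[OF assms(2)] sqint_set_integral[OF assms(3)]
  using assms(1) by (intro nn_integral_mono) (auto simp: indicator_def)

lemma sqint_triangle:
  fixes f g h :: "real^'n \<Rightarrow> 'b::euclidean_space"
  assumes [measurable]: "f \<in> borel_measurable (lebesgue_on S)" "g \<in> borel_measurable (lebesgue_on S)"
    "h \<in> borel_measurable (lebesgue_on S)"
  shows "sqint S (\<lambda>x. f x - h x) \<le> 2 * sqint S (\<lambda>x. f x - g x) + 2 * sqint S (\<lambda>x. g x - h x)"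
proof -
  have "sqint S (\<lambda>x. f x - h x) \<le> (\<integral>\<^sup>+x. 2 * ennreal ((norm (f x - g x))\<^sup>2) + 2 * ennreal ((norm (g x - h x))\<^sup>2) \<partial>lebesgue_on S)"
    unfolding sqint_def
  proof (rule nn_integral_mono)
    fix x
    have "norm (f x - h x) \<le> norm (f x - g x) + norm (g x - h x)"
      using norm_triangle_ineq[of "f x - g x" "g x - h x"] by simp
    then have "(norm (f x - h x))\<^sup>2 \<le> (norm (f x - g x) + norm (g x - h x))\<^sup>2"
      by (intro power_mono) auto
    also have "\<dots> \<le> 2 * (norm (f x - g x))\<^sup>2 + 2 * (norm (g x - h x))\<^sup>2"
      using sum_squares_bound[of "norm (f x - g x)" "norm (g x - h x)"] by (simp add: power2_sum)
    finally have "ennreal ((norm (f x - h x))\<^sup>2) \<le> ennreal (2 * (norm (f x - g x))\<^sup>2 + 2 * (norm (g x - h x))\<^sup>2)"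
      by (rule ennreal_leI)
    then show "ennreal ((norm (f x - h x))\<^sup>2) \<le> 2 * ennreal ((norm (f x - g x))\<^sup>2) + 2 * ennreal ((norm (g x - h x))\<^sup>2)"
      by (simp add: ennreal_plus ennreal_mult)
  qed
  also have "\<dots> = 2 * sqint S (\<lambda>x. f x - g x) + 2 * sqint S (\<lambda>x. g x - h x)"
    unfolding sqint_def by (subst nn_integral_add) (auto simp: nn_integral_cmult)
  finally show ?thesis .
qed

lemma sqint_commute: "sqint S (\<lambda>x. f x - g x) = sqint S (\<lambda>x. g x - f x)"
  by (simp add: sqint_def norm_minus_commute)

lemma sqint_const:
  assumes "S \<in> sets lebesgue"
  shows "sqint S (\<lambda>x. a) = ennreal ((norm a)\<^sup>2) * emeasure lebesgue S"
  unfolding sqint_set_integral[OF assms] using assms by (simp add: nn_integral_cmult_indicator)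

lemma measurable_lebesgue_on_subset:
  assumes "f \<in> borel_measurable (lebesgue_on T)" "S \<subseteq> T"
  shows "f \<in> borel_measurable (lebesgue_on S)"
  using measurable_restrict_mono[OF assms] .

lemma borel_lebesgue_on:
  assumes "f \<in> borel_measurable borel"
  shows "f \<in> borel_measurable (lebesgue_on S)"
  using assms by (intro measurable_restrict_space1) (simp add: measurable_completion)

text \<open>Jensen's inequality for the square, derived from Cauchy-Schwarz. If the right side is
  finite, a - u is square integrable on a finite measure space and hence integrable, so that the
  mean is not a default value.\<close>

lemma (in finite_measure) square_mean_le:
  fixes u :: "'a \<Rightarrow> real"
  assumes [measurable]: "u \<in> borel_measurable M" and m: "measure M (space M) > 0"
  shows "ennreal ((a - (\<integral>x. u x \<partial>M) / measure M (space M))\<^sup>2) * emeasure M (space M)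
     \<le> (\<integral>\<^sup>+x. ennreal ((a - u x)\<^sup>2) \<partial>M)"
proof (cases "(\<integral>\<^sup>+x. ennreal ((a - u x)\<^sup>2) \<partial>M) = \<infinity>")
  case False
  define \<mu> where "\<mu> = measure M (space M)"
  have e: "emeasure M (space M) = ennreal \<mu>" by (simp add: \<mu>_def emeasure_eq_measure)
  have \<mu>: "0 < \<mu>" using m by (simp add: \<mu>_def)
  have "integrable M (\<lambda>x. (a - u x)\<^sup>2)"
    unfolding integrable_iff_bounded using False by (simp add: less_top)
  then have int: "integrable M (\<lambda>x. a - u x)"
    by (rule square_integrable_imp_integrable[rotated]) measurable
  from Bochner_Integration.integrable_diff[OF integrable_const[of a] int]
  have "integrable M u" by simp
  then have eq: "(\<integral>x. a - u x \<partial>M) = (a - (\<integral>x. u x \<partial>M) / \<mu>) * \<mu>"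
    using \<mu> by (simp add: \<mu>_def left_diff_distrib)
  define d where "d = a - (\<integral>x. u x \<partial>M) / \<mu>"
  have "ennreal \<bar>d * \<mu>\<bar> \<le> (\<integral>\<^sup>+x. ennreal \<bar>a - u x\<bar> * 1 \<partial>M)"
    using integral_norm_bound_ennreal[OF int] unfolding eq d_def by simp
  then have "ennreal \<bar>d * \<mu>\<bar> ^ 2 \<le> (\<integral>\<^sup>+x. ennreal \<bar>a - u x\<bar> * 1 \<partial>M) ^ 2" by (rule power_mono) simp
  also have "\<dots> \<le> (\<integral>\<^sup>+x. ennreal \<bar>a - u x\<bar> ^ 2 \<partial>M) * (\<integral>\<^sup>+x. 1 ^ 2 \<partial>M)"
    by (rule Cauchy_Schwarz_nn_integral) measurable
  also have "\<dots> = (\<integral>\<^sup>+x. ennreal ((a - u x)\<^sup>2) \<partial>M) * ennreal \<mu>"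
    by (simp add: ennreal_abs_square e)
  finally have "ennreal \<mu> * (ennreal (d\<^sup>2) * ennreal \<mu>) \<le> ennreal \<mu> * (\<integral>\<^sup>+x. ennreal ((a - u x)\<^sup>2) \<partial>M)"
    using \<mu> by (simp add: ennreal_abs_square ennreal_mult[symmetric] power_mult_distrib power2_eq_square[of \<mu>] mult_ac)
  then have "ennreal (d\<^sup>2) * ennreal \<mu> \<le> (\<integral>\<^sup>+x. ennreal ((a - u x)\<^sup>2) \<partial>M)"
    using \<mu> by (subst (asm) ennreal_mult_le_mult_iff) auto
  then show ?thesis by (simp add: d_def e flip: \<mu>_def)
qed simp

lemma mean_on_square_le:
  assumes u: "u \<in> borel_measurable (lebesgue_on (ball w r))" and r: "0 < r"
  shows "ennreal ((a - mean_on (ball w r) u)\<^sup>2) * emeasure lebesgue (ball w r) \<le> sqint (ball w r) (\<lambda>x. a - u x)"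
proof -
  have "finite_measure (lebesgue_on (ball w r))"
    by (intro finite_measure_lebesgue_on) simp
  moreover have "space (lebesgue_on (ball w r)) = ball w r" by simp
  moreover have "measure (lebesgue_on (ball w r)) (ball w r) = measure lebesgue (ball w r)"
    by (simp add: measure_restrict_space)
  moreover have "emeasure (lebesgue_on (ball w r)) (ball w r) = emeasure lebesgue (ball w r)"
    by (simp add: emeasure_restrict_space)
  moreover have "0 < measure lebesgue (ball w r)" using content_ball_pos[OF r, of w] by simp
  ultimately show ?thesis
    using finite_measure.square_mean_le[OF _ u, of a] by (simp add: mean_on_def sqint_def)
qed

lemma mean_on_diff:
  assumes "integrable (lebesgue_on S) u" "integrable (lebesgue_on S) v"
  shows "mean_on S (\<lambda>x. u x - v x) = mean_on S u - mean_on S v"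
  using assms by (simp add: mean_on_def diff_divide_distrib)

text \<open>By Jensen's inequality the squared deviation of \<phi>(x) from the mean is at most the
  average over y of the squared differences \<phi>(x) - \<phi>(y). Integrating in x leads to the
  double integral.\<close>

lemma poincare_C1:
  fixes \<phi> :: "real^'n \<Rightarrow> real"
  assumes "C1_fun \<phi>" "0 < r"
  shows "sqint (ball w r) (\<lambda>x. \<phi> x - mean_on (ball w r) \<phi>) \<le> ennreal ((2 * r)\<^sup>2 * 2 ^ CARD('n)) * sqint (ball w r) (grad \<phi>)"
proof -
  define B where "B = ball w r"
  define m where "m = mean_on B \<phi>"
  have [measurable]: "\<phi> \<in> borel_measurable borel" using C1_fun_borel assms by blast
  have leb: "(\<integral>\<^sup>+x. f x \<partial>lebesgue_on B) = (\<integral>\<^sup>+x. indicator B x * f x \<partial>lborel)" for f :: "real^'n \<Rightarrow> ennreal"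
    unfolding B_def by (subst nn_integral_restrict_space) (simp_all add: nn_integral_completion mult.commute)
  have pos: "0 < emeasure lborel B" "emeasure lborel B < \<infinity>"
  proof -
    show f: "emeasure lborel B < \<infinity>" unfolding B_def by (rule emeasure_lborel_ball_finite)
    have "0 < measure lborel B" unfolding B_def by (rule content_ball_pos[OF assms(2)])
    then show "0 < emeasure lborel B" by (simp add: measure_def enn2real_positive_iff)
  qed
  have "emeasure lborel B * sqint B (\<lambda>x. \<phi> x - m) = (\<integral>\<^sup>+x. emeasure lborel B * ennreal ((\<phi> x - m)\<^sup>2) \<partial>lebesgue_on B)"
    unfolding sqint_def by (subst nn_integral_cmult[symmetric]) (auto intro!: borel_lebesgue_on)
  also have "\<dots> \<le> (\<integral>\<^sup>+x. (\<integral>\<^sup>+y. ennreal ((\<phi> x - \<phi> y)\<^sup>2) \<partial>lebesgue_on B) \<partial>lebesgue_on B)"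
  proof (rule nn_integral_mono)
    fix x
    have "ennreal ((\<phi> x - m)\<^sup>2) * emeasure lebesgue B \<le> sqint B (\<lambda>y. \<phi> x - \<phi> y)"
      unfolding B_def m_def by (rule mean_on_square_le[OF borel_lebesgue_on assms(2)]) measurable
    then show "emeasure lborel B * ennreal ((\<phi> x - m)\<^sup>2) \<le> (\<integral>\<^sup>+y. ennreal ((\<phi> x - \<phi> y)\<^sup>2) \<partial>lebesgue_on B)"
      by (simp add: sqint_def mult.commute B_def)
  qed
  also have "\<dots> = (\<integral>\<^sup>+x. (\<integral>\<^sup>+y. ennreal ((\<phi> y - \<phi> x)\<^sup>2) \<partial>lebesgue_on B) \<partial>lebesgue_on B)"
    by (intro nn_integral_cong) (subst power2_commute, rule refl)
  also have "\<dots> = (\<integral>\<^sup>+x. (\<integral>\<^sup>+y. indicator B x * indicator B y * ennreal ((\<phi> y - \<phi> x)\<^sup>2) \<partial>lborel) \<partial>lborel)"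
    unfolding leb by (intro nn_integral_cong) (simp add: indicator_def)
  also have "\<dots> \<le> ennreal ((2 * r)\<^sup>2 * 2 ^ CARD('n)) * emeasure lborel B * sqint B (grad \<phi>)"
    using double_integral_ball_bound[OF assms(1), of w r] unfolding sqint_def leb by (simp add: B_def)
  finally have "emeasure lborel B * sqint B (\<lambda>x. \<phi> x - m) \<le> emeasure lborel B * (ennreal ((2 * r)\<^sup>2 * 2 ^ CARD('n)) * sqint B (grad \<phi>))"
    by (simp add: mult_ac)
  then show ?thesis using pos by (subst (asm) ennreal_mult_le_mult_iff) (auto simp: m_def B_def)
qed

lemma wball_subset:
  fixes \<Omega> :: "'a::euclidean_space set"
  assumes "w \<in> \<Omega>"
  shows "wball \<Omega> w \<subseteq> \<Omega>"
  using ball_bdist_subset[OF assms] bdist_nonneg[of \<Omega> w] by force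

text \<open>The inequality for \<phi>_k passes to the limit. The mean of \<phi>_k is the
  intermediate constant; by Jensen's inequality, replacing it by the mean of u costs no more than
  the deviation of u from it. The factor 16 collects three applications of the triangle inequality
  for squares.\<close>

lemma poincare_w12:
  fixes u :: "real^'n \<Rightarrow> real"
  assumes w: "w12 \<Omega> u Du" and "open \<Omega>" and B: "ball y r \<subseteq> \<Omega>" "0 < r"
  shows "sqint (ball y r) (\<lambda>x. u x - mean_on (ball y r) u) \<le> ennreal (16 * ((2 * r)\<^sup>2 * 2 ^ CARD('n))) * sqint (ball y r) Du"
proof -
  from w obtain \<phi> where \<phi>: "\<And>k. C1_fun (\<phi> k)" "(\<lambda>k::nat. sqint \<Omega> (\<lambda>x. \<phi> k x - u x)) \<longlonglongrightarrow> 0"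
     "(\<lambda>k. sqint \<Omega> (\<lambda>x. grad (\<phi> k) x - Du x)) \<longlonglongrightarrow> 0"
    unfolding w12_def by blast
  define S where "S = ball y r"
  define P where "P = (2 * r)\<^sup>2 * 2 ^ CARD('n)"
  have P0: "0 \<le> P" by (simp add: P_def)
  define m where "m k = mean_on S (\<phi> k)" for k
  have Sm: "S \<in> sets lebesgue" "\<Omega> \<in> sets lebesgue" using assms(2) by (auto simp: S_def)
  have u[measurable]: "u \<in> borel_measurable (lebesgue_on S)" "Du \<in> borel_measurable (lebesgue_on S)"
    using w B measurable_lebesgue_on_subset unfolding w12_def S_def by blast+
  have [measurable]: "\<phi> k \<in> borel_measurable (lebesgue_on S)" "grad (\<phi> k) \<in> borel_measurable (lebesgue_on S)" for k
    using C1_fun_borel[OF \<phi>(1)] borel_lebesgue_on by blast+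
  have bound: "sqint S (\<lambda>x. u x - mean_on S u) \<le> 8 * sqint \<Omega> (\<lambda>x. \<phi> k x - u x) +
      8 * (ennreal P * (2 * sqint \<Omega> (\<lambda>x. grad (\<phi> k) x - Du x) + 2 * sqint S Du))" for k
  proof -
    have a: "sqint S (\<lambda>x. u x - m k) \<le> 2 * sqint S (\<lambda>x. u x - \<phi> k x) + 2 * sqint S (\<lambda>x. \<phi> k x - m k)"
      by (rule sqint_triangle) measurable
    have b: "sqint S (\<lambda>x. m k - mean_on S u) \<le> sqint S (\<lambda>x. u x - m k)"
      unfolding sqint_const[OF Sm(1)] sqint_commute[of S u]
      using mean_on_square_le[of u y r "m k"] u(1) B by (simp add: S_def)
    have "sqint S (\<lambda>x. u x - mean_on S u) \<le> 2 * sqint S (\<lambda>x. u x - m k) + 2 * sqint S (\<lambda>x. m k - mean_on S u)"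
      by (rule sqint_triangle) measurable
    also have "\<dots> \<le> 2 * sqint S (\<lambda>x. u x - m k) + 2 * sqint S (\<lambda>x. u x - m k)"
      by (intro add_left_mono mult_left_mono b) auto
    also have "\<dots> = 4 * sqint S (\<lambda>x. u x - m k)" by (simp add: distrib_right[symmetric])
    also have "\<dots> \<le> 4 * (2 * sqint S (\<lambda>x. u x - \<phi> k x) + 2 * sqint S (\<lambda>x. \<phi> k x - m k))"
      by (intro mult_left_mono a) auto
    also have "\<dots> = 8 * sqint S (\<lambda>x. \<phi> k x - u x) + 8 * sqint S (\<lambda>x. \<phi> k x - m k)"
      by (simp add: distrib_left mult.assoc[symmetric] sqint_commute[of S u])
    also have "\<dots> \<le> 8 * sqint \<Omega> (\<lambda>x. \<phi> k x - u x) +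
      8 * (ennreal P * (2 * sqint \<Omega> (\<lambda>x. grad (\<phi> k) x - Du x) + 2 * sqint S Du))"
    proof (intro add_mono mult_left_mono)
      show "sqint S (\<lambda>x. \<phi> k x - u x) \<le> sqint \<Omega> (\<lambda>x. \<phi> k x - u x)"
        using B Sm by (intro sqint_mono_set) (auto simp: S_def)
      have "sqint S (\<lambda>x. \<phi> k x - m k) \<le> ennreal P * sqint S (grad (\<phi> k))"
        unfolding S_def m_def P_def by (rule poincare_C1[OF \<phi>(1) B(2)])
      also have "\<dots> \<le> ennreal P * (2 * sqint S (\<lambda>x. grad (\<phi> k) x - Du x) + 2 * sqint S Du)"
        using sqint_triangle[of "grad (\<phi> k)" S Du "\<lambda>x. 0"] by (intro mult_left_mono) auto
      also have "\<dots> \<le> ennreal P * (2 * sqint \<Omega> (\<lambda>x. grad (\<phi> k) x - Du x) + 2 * sqint S Du)"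
        using B Sm by (intro mult_left_mono add_right_mono sqint_mono_set) (auto simp: S_def)
      finally show "sqint S (\<lambda>x. \<phi> k x - m k) \<le> ennreal P * (2 * sqint \<Omega> (\<lambda>x. grad (\<phi> k) x - Du x) + 2 * sqint S Du)" .
    qed auto
    finally show ?thesis .
  qed
  have "(\<lambda>k. 8 * sqint \<Omega> (\<lambda>x. \<phi> k x - u x) + 8 * (ennreal P * (2 * sqint \<Omega> (\<lambda>x. grad (\<phi> k) x - Du x) + 2 * sqint S Du)))
     \<longlonglongrightarrow> 8 * 0 + 8 * (ennreal P * (2 * 0 + 2 * sqint S Du))"
    by (intro tendsto_add ennreal_tendsto_cmult tendsto_const \<phi>(2,3)) auto
  then have "sqint S (\<lambda>x. u x - mean_on S u) \<le> 8 * 0 + 8 * (ennreal P * (2 * 0 + 2 * sqint S Du))"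
    by (rule LIMSEQ_le_const) (use bound in blast)
  also have "\<dots> = ennreal (16 * P) * sqint S Du"
  proof -
    have "ennreal (16 * P) = 8 * 2 * ennreal P" using P0 by (simp add: ennreal_mult)
    then show ?thesis by (simp only: mult_zero_right mult_zero_left add_0 mult_ac)
  qed
  finally show ?thesis by (simp add: S_def P_def)
qed

lemma davg_nonneg: "0 \<le> davg \<Omega> v w"
  by (simp add: davg_def)

lemma davg_square:
  fixes \<Omega> :: "(real^'n) set"
  assumes "open \<Omega>" "bounded \<Omega>" "w \<in> \<Omega>" "sqint \<Omega> v < \<infinity>"
  shows "sqint (wball \<Omega> w) v = ennreal ((davg \<Omega> v w)\<^sup>2 * measure lebesgue (wball \<Omega> w))"
proof -
  have "sqint (wball \<Omega> w) v \<le> sqint \<Omega> v"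
    using assms wball_subset by (intro sqint_mono_set) auto
  then have fin: "sqint (wball \<Omega> w) v < top" using assms(4) by (simp add: order_le_less_trans)
  have "0 < measure lebesgue (wball \<Omega> w)"
    using content_ball_pos[of "bdist \<Omega> w / 4" w] bdist_pos[OF assms(1-3)] by simp
  then show ?thesis using fin by (simp add: davg_def less_imp_le)
qed

text \<open>The two means are compared with u on a small ball contained in both
  \<open>wball\<close>s. Enlarging the domain of integration to either of them lets Poincare's
  inequality apply there. One constant \<kappa> is shared with the Poincare inequality in terms of
  \<open>davg\<close>, the last claim.\<close>

lemma hop_potential_w12:
  fixes \<Omega> :: "(real^'n) set"
  assumes "open \<Omega>" "bounded \<Omega>"
  obtains \<kappa> where "0 < \<kappa>" "\<And>u Du. w12 \<Omega> u Du \<Longrightarrow> hop_potential \<Omega> (bmean \<Omega> u) (\<lambda>w. \<kappa> * davg \<Omega> Du w)"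
    "\<And>u Du w. w12 \<Omega> u Du \<Longrightarrow> w \<in> \<Omega> \<Longrightarrow>
        sqint (wball \<Omega> w) (\<lambda>x. u x - bmean \<Omega> u w)
          \<le> ennreal ((\<kappa> * bdist \<Omega> w * davg \<Omega> Du w)\<^sup>2 * measure lebesgue (wball \<Omega> w))"
proof -
  define n where "n = CARD('n)"
  define P :: real where "P = 4 * 2 ^ n"
  \<comment> \<open>\<open>P\<close> is Poincare's constant for the radius \<delta>/4. The 2 comes
    from the triangle inequality for squares, two factors 9/8 from \<delta>(b)^2 and
    \<open>n\<close> of them from the volume of the ball at b, and \<open>(8/3)^n\<close> from the
    volume of the common ball.\<close>
  define \<kappa>2 :: real where "\<kappa>2 = 2 * P * (9/8)^(n + 2) * (8/3)^n"
  have P0: "0 < P" by (simp add: P_def)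
  have k2: "0 < \<kappa>2" by (simp add: \<kappa>2_def P0)
  define \<kappa> where "\<kappa> = sqrt \<kappa>2"
  have Pk: "P \<le> \<kappa>\<^sup>2"
  proof -
    have a: "1 \<le> (9/8::real)^(n + 2)" by (rule one_le_power) simp
    have b: "1 \<le> (8/3::real)^n" by (rule one_le_power) simp
    have "1 * 1 \<le> (9/8::real)^(n + 2) * (8/3)^n" by (intro mult_mono a b) auto
    then have "2 * P * 1 \<le> 2 * P * ((9/8)^(n + 2) * (8/3)^n)" using P0 by (intro mult_left_mono) auto
    moreover have "\<kappa>\<^sup>2 = 2 * P * ((9/8)^(n + 2) * (8/3)^n)"
      using k2 unfolding \<kappa>_def by (simp only: real_sqrt_pow2 less_imp_le) (simp only: \<kappa>2_def mult.assoc)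
    ultimately show ?thesis using P0 by linarith
  qed
  define B where "B w = wball \<Omega> w" for w
  define V where "V w = measure lebesgue (B w)" for w
  have pos: "0 < bdist \<Omega> w" if "w \<in> \<Omega>" for w using bdist_pos assms that by blast
  have poin: "sqint (B w) (\<lambda>x. u x - bmean \<Omega> u w) \<le> ennreal (P * (bdist \<Omega> w * davg \<Omega> Du w)\<^sup>2 * V w)"
    if "w12 \<Omega> u Du" "w \<in> \<Omega>" for u Du w
  proof -
    have fin: "sqint \<Omega> Du < \<infinity>" using that by (simp add: w12_def)
    have "sqint (B w) (\<lambda>x. u x - bmean \<Omega> u w) \<le> ennreal (16 * ((2 * (bdist \<Omega> w / 4))\<^sup>2 * 2 ^ CARD('n))) * sqint (B w) Du"
      unfolding B_def bmean_def by (rule poincare_w12[OF that(1) assms(1) wball_subset[OF that(2)]]) (use pos that in simp)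
    also have "\<dots> = ennreal (P * (bdist \<Omega> w)\<^sup>2) * sqint (B w) Du"
      by (simp add: P_def n_def power_divide mult_ac)
    also have "sqint (B w) Du = ennreal ((davg \<Omega> Du w)\<^sup>2 * V w)"
      unfolding B_def V_def by (rule davg_square[OF assms that(2) fin])
    finally show ?thesis using P0 by (simp add: ennreal_mult[symmetric] power_mult_distrib mult_ac V_def)
  qed
  have vol: "measure lebesgue (ball w r) = r ^ n * measure lebesgue (ball (0::real^'n) 1)" if "0 \<le> r" for w :: "real^'n" and r
    using content_ball_conv_unit_ball[OF that, of w] by (simp add: n_def)
  define v1 where "v1 = measure lebesgue (ball (0::real^'n) 1)"
  have v1: "0 < v1" using content_ball_pos[of 1 "0::real^'n"] by (simp add: v1_def)
  have hop: "\<bar>bmean \<Omega> u a - bmean \<Omega> u b\<bar> \<le> bdist \<Omega> a * (\<kappa> * davg \<Omega> Du a + \<kappa> * davg \<Omega> Du b)"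
    if w: "w12 \<Omega> u Du" and ab: "(a, b) \<in> hop \<Omega>" for u Du a b
  proof -
    have in\<Omega>: "a \<in> \<Omega>" "b \<in> \<Omega>" using ab by (auto simp: hop_def)
    define d where "d = bdist \<Omega> a"
    define da where "da = davg \<Omega> Du a"
    define db where "db = davg \<Omega> Du b"
    have d0: "0 < d" using pos in\<Omega> by (simp add: d_def)
    have dd: "0 \<le> da" "0 \<le> db" by (simp_all add: da_def db_def davg_nonneg)
    have bb: "bdist \<Omega> b \<le> 9/8 * d" using hop_bdist[OF ab] by (simp add: d_def)
    \<comment> \<open>Since \<delta>(b) is at least 7/8 d, the ball at b has radius at least 7/32 d;
      its centre is at most 4/32 d away from a, which leaves 3/32 d.\<close>
    define E where "E = ball a (3/32 * d)"
    have Ea: "E \<subseteq> B a" using d0 by (auto simp: E_def B_def d_def)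
    have Eb: "E \<subseteq> B b"
    proof
      fix z assume "z \<in> E"
      then have "dist a z < 3/32 * d" by (simp add: E_def)
      moreover have "dist b a \<le> d / 8" using ab by (auto simp: hop_def d_def dist_commute)
      moreover have "d \<le> bdist \<Omega> b + dist b a" using bdist_le_add[of \<Omega> a b] by (simp add: d_def dist_commute)
      moreover have "dist b z \<le> dist b a + dist a z" by (rule dist_triangle)
      ultimately have "dist b z < bdist \<Omega> b / 4" by linarith
      then show "z \<in> B b" by (simp add: B_def)
    qed
    have Em: "E \<in> sets lebesgue" "B a \<in> sets lebesgue" "B b \<in> sets lebesgue" by (auto simp: E_def B_def)
    have "E \<subseteq> \<Omega>" using Ea wball_subset[OF in\<Omega>(1)] by (auto simp: B_def)
    then have [measurable]: "u \<in> borel_measurable (lebesgue_on E)"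
      using w measurable_lebesgue_on_subset unfolding w12_def by blast
    have vE: "measure lebesgue E = (3/8)^n * V a" "V b \<le> (9/8)^n * V a" "V a = (d/4)^n * v1"
    proof -
      show va: "V a = (d/4)^n * v1" unfolding V_def B_def d_def v1_def using pos[OF in\<Omega>(1)] by (intro vol) simp
      show "measure lebesgue E = (3/8)^n * V a"
        unfolding va E_def using d0 by (subst vol) (simp_all add: v1_def power_mult_distrib[symmetric] mult.assoc[symmetric])
      have "V b = (bdist \<Omega> b/4)^n * v1" unfolding V_def B_def v1_def using pos[OF in\<Omega>(2)] by (intro vol) simp
      also have "\<dots> \<le> (9/8 * (d/4))^n * v1" using bb v1 pos[OF in\<Omega>(2)] by (intro mult_right_mono power_mono) auto
      finally show "V b \<le> (9/8)^n * V a" unfolding va power_mult_distrib by simp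
    qed
    have Vpos: "0 < V a" using vE(3) d0 v1 by simp
    define X where "X = (bmean \<Omega> u a - bmean \<Omega> u b)\<^sup>2"
    have "ennreal (X * ((3/8)^n * V a)) = sqint E (\<lambda>x. bmean \<Omega> u a - bmean \<Omega> u b)"
    proof -
      have "emeasure lebesgue E = ennreal (measure lebesgue E)"
        unfolding E_def by (intro emeasure_eq_ennreal_measure) (simp add: less_imp_neq[OF emeasure_lborel_ball_finite[unfolded infinity_ennreal_def]])
      then show ?thesis unfolding sqint_const[OF Em(1)] using Vpos by (simp add: vE X_def ennreal_mult)
    qed
    also have "\<dots> \<le> 2 * sqint E (\<lambda>x. bmean \<Omega> u a - u x) + 2 * sqint E (\<lambda>x. u x - bmean \<Omega> u b)"
      by (rule sqint_triangle) measurable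
    also have "\<dots> \<le> 2 * sqint (B a) (\<lambda>x. u x - bmean \<Omega> u a) + 2 * sqint (B b) (\<lambda>x. u x - bmean \<Omega> u b)"
      unfolding sqint_commute[of E "\<lambda>x. bmean \<Omega> u a"]
      by (intro add_mono mult_left_mono sqint_mono_set Ea Eb Em) auto
    also have "\<dots> \<le> 2 * ennreal (P * (d * da)\<^sup>2 * V a) + 2 * ennreal (P * (bdist \<Omega> b * db)\<^sup>2 * V b)"
      unfolding d_def da_def db_def by (intro add_mono mult_left_mono poin[OF w] in\<Omega>) auto
    also have "\<dots> = ennreal (2 * (P * (d * da)\<^sup>2 * V a) + 2 * (P * (bdist \<Omega> b * db)\<^sup>2 * V b))"
      using P0 by (simp add: ennreal_mult ennreal_plus V_def)
    finally have "X * ((3/8)^n * V a) \<le> 2 * (P * (d * da)\<^sup>2 * V a) + 2 * (P * (bdist \<Omega> b * db)\<^sup>2 * V b)"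
      using P0 by (subst (asm) ennreal_le_iff) (auto simp: V_def)
    also have "\<dots> \<le> 2 * (P * ((9/8) * d * da)\<^sup>2 * ((9/8)^n * V a)) + 2 * (P * ((9/8) * d * db)\<^sup>2 * ((9/8)^n * V a))"
    proof (intro add_mono mult_left_mono mult_mono power_mono)
      have "1 * V a \<le> (9/8)^n * V a" using Vpos by (intro mult_right_mono one_le_power) auto
      then show "V a \<le> (9/8)^n * V a" by simp
    qed (use P0 d0 dd bb pos[OF in\<Omega>(2)] vE(2) in \<open>auto simp: V_def\<close>)
    also have "\<dots> = 2 * P * (9/8)^(n + 2) * (d\<^sup>2 * (da\<^sup>2 + db\<^sup>2)) * V a"
      by (simp add: power_mult_distrib power_add power2_eq_square algebra_simps)
    finally have "X * (3/8)^n \<le> 2 * P * (9/8)^(n + 2) * (d\<^sup>2 * (da\<^sup>2 + db\<^sup>2))"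
      using Vpos by (simp add: mult.assoc[symmetric])
    then have "X * (3/8)^n * (8/3)^n \<le> 2 * P * (9/8)^(n + 2) * (d\<^sup>2 * (da\<^sup>2 + db\<^sup>2)) * (8/3)^n"
      by (rule mult_right_mono) simp
    then have "X \<le> \<kappa>2 * (d\<^sup>2 * (da\<^sup>2 + db\<^sup>2))"
      unfolding mult.assoc[of X] power_mult_distrib[symmetric] by (simp add: \<kappa>2_def mult_ac)
    also have "\<dots> \<le> \<kappa>2 * (d\<^sup>2 * (da + db)\<^sup>2)"
      using k2 dd by (intro mult_left_mono) (auto simp: power2_sum)
    also have "\<dots> = (d * (\<kappa> * da + \<kappa> * db))\<^sup>2"
      unfolding distrib_left[symmetric] power_mult_distrib using k2 by (simp add: \<kappa>_def mult_ac)
    finally have "(bmean \<Omega> u a - bmean \<Omega> u b)\<^sup>2 \<le> (d * (\<kappa> * da + \<kappa> * db))\<^sup>2" by (simp add: X_def)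
    then have "\<bar>bmean \<Omega> u a - bmean \<Omega> u b\<bar> \<le> \<bar>d * (\<kappa> * da + \<kappa> * db)\<bar>" by (simp add: abs_le_square_iff)
    also have "\<dots> = d * (\<kappa> * da + \<kappa> * db)" using d0 dd k2 by (simp add: \<kappa>_def)
    finally show ?thesis by (simp add: d_def da_def db_def)
  qed
  show ?thesis
  proof (rule that[of \<kappa>])
    show k0: "0 < \<kappa>" using k2 by (simp add: \<kappa>_def)
    fix u Du assume w: "w12 \<Omega> u Du"
    show "hop_potential \<Omega> (bmean \<Omega> u) (\<lambda>w. \<kappa> * davg \<Omega> Du w)"
      using hop[OF w] k0 davg_nonneg[of \<Omega> Du] by (simp add: hop_potential_def)
    fix w assume wi: "w \<in> \<Omega>"
    have "P * (bdist \<Omega> w * davg \<Omega> Du w)\<^sup>2 * V w \<le> \<kappa>\<^sup>2 * (bdist \<Omega> w * davg \<Omega> Du w)\<^sup>2 * V w"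
      using Pk by (intro mult_right_mono) (auto simp: V_def)
    with order_trans[OF poin[OF w wi] ennreal_leI]
    have "sqint (B w) (\<lambda>x. u x - bmean \<Omega> u w) \<le> ennreal (\<kappa>\<^sup>2 * (bdist \<Omega> w * davg \<Omega> Du w)\<^sup>2 * V w)" by blast
    then show "sqint (wball \<Omega> w) (\<lambda>x. u x - bmean \<Omega> u w)
          \<le> ennreal ((\<kappa> * bdist \<Omega> w * davg \<Omega> Du w)\<^sup>2 * measure lebesgue (wball \<Omega> w))"
      by (simp add: B_def V_def power_mult_distrib mult.assoc)
  qed
qed

section \<open>Surface measure\<close>

lemma space_surface_measure [simp]: "space (surface_measure \<Omega>) = frontier \<Omega>"
  by (simp add: surface_measure_def space_restrict_space hausdorff_measure_def space_measure_of_conv)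

text \<open>The Ahlfors condition speaks only of radii below the diameter of the boundary, so one
  must exist. If z were the only boundary point, the punctured space, connected in dimension at
  least 2, would meet \<Omega> and its complement without meeting the frontier.\<close>

lemma ediam_frontier_pos:
  fixes \<Omega> :: "'a::euclidean_space set"
  assumes "open \<Omega>" "bounded \<Omega>" "\<Omega> \<noteq> {}" "2 \<le> DIM('a)"
  obtains d where "0 < d" "ennreal d < ediam (frontier \<Omega>)"
proof -
  obtain z where z: "z \<in> frontier \<Omega>" using frontier_bounded_ne[OF assms(2,3)] by blast
  have "- {z} \<inter> frontier \<Omega> \<noteq> {}"
  proof (rule connected_Int_frontier)
    show "connected (- {z})" by (rule connected_punctured_universe[OF assms(4)])
    have "z \<notin> \<Omega>" using z assms(1) by (simp add: frontier_def interior_open)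
    moreover obtain p where "p \<in> \<Omega>" using assms(3) by (auto simp: ex_in_conv[symmetric])
    ultimately have "p \<in> - {z} \<inter> \<Omega>" by auto
    then show "- {z} \<inter> \<Omega> \<noteq> {}" by auto
    have b: "bounded (insert z \<Omega>)" using assms(2) by simp
    have "insert z \<Omega> \<noteq> UNIV"
    proof
      assume "insert z \<Omega> = UNIV"
      with b have "bounded (UNIV :: 'a set)" by (simp only:)
      then show False by (rule notE[OF not_bounded_UNIV])
    qed
    then show "- {z} - \<Omega> \<noteq> {}" by auto
  qed
  then obtain y where y: "y \<in> frontier \<Omega>" "y \<noteq> z" by auto
  have "ennreal (dist y z) \<le> ediam (frontier \<Omega>)"
    unfolding ediam_def using y z by (intro SUP_upper2[of "(y,z)"]) auto
  moreover have "ennreal (dist y z / 2) < ennreal (dist y z)" using y by (intro ennreal_lessI) auto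
  ultimately show ?thesis using y by (intro that[of "dist y z / 2"]) (auto simp: less_le_trans)
qed

section \<open>Measurability and size of surface balls\<close>

locale ahlfors_domain =
  fixes \<Omega> :: "(real^'n) set"
  assumes dim: "2 \<le> CARD('n)" and open_dom: "open \<Omega>" and bounded_dom: "bounded \<Omega>" and nonempty: "\<Omega> \<noteq> {}"
    and ahlfors: "ahlfors_regular_boundary \<Omega>"
begin

abbreviation "\<sigma> \<equiv> surface_measure \<Omega>"

lemma ahlfors_small:
  obtains C d where "0 < C" "0 < d" 
    "\<And>x r. x \<in> frontier \<Omega> \<Longrightarrow> 0 < r \<Longrightarrow> r \<le> d \<Longrightarrow> ennreal (inverse C * r ^ (CARD('n) - 1)) \<le> emeasure \<sigma> (ball x r \<inter> frontier \<Omega>)"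
    "\<And>x r. x \<in> frontier \<Omega> \<Longrightarrow> 0 < r \<Longrightarrow> r \<le> d \<Longrightarrow> emeasure \<sigma> (ball x r \<inter> frontier \<Omega>) \<le> ennreal (C * r ^ (CARD('n) - 1))"
proof -
  obtain d where d: "0 < d" "ennreal d < ediam (frontier \<Omega>)"
    using ediam_frontier_pos[OF open_dom bounded_dom nonempty] dim by (metis DIM_cart DIM_real mult.right_neutral)
  obtain C where C: "C > 0" "\<And>x r. x \<in> frontier \<Omega> \<Longrightarrow> 0 < r \<and> ennreal r < ediam (frontier \<Omega>) \<Longrightarrow>
        ennreal (inverse C * r ^ (CARD('n) - 1))
          \<le> emeasure \<sigma> (ball x r \<inter> frontier \<Omega>) \<and>
        emeasure \<sigma> (ball x r \<inter> frontier \<Omega>)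
          \<le> ennreal (C * r ^ (CARD('n) - 1))"
    using ahlfors unfolding ahlfors_regular_boundary_def by blast
  have "ennreal r < ediam (frontier \<Omega>)" if "r \<le> d" for r
    using d that ennreal_leI le_less_trans by blast
  then show ?thesis using that[OF C(1) d(1)] C(2) by blast
qed

text \<open>
  \<open>emeasure\<close> vanishes outside the sigma-algebra, so the lower Ahlfors bound makes small balls
  measurable; Caratheodory's criterion for the Hausdorff outer measure is not needed.
\<close>

lemma open_in_sets_surface:
  assumes "open U"
  shows "U \<inter> frontier \<Omega> \<in> sets \<sigma>"
proof -
  obtain C d where Cd: "0 < C" "0 < d"
    "\<And>x r. x \<in> frontier \<Omega> \<Longrightarrow> 0 < r \<Longrightarrow> r \<le> d \<Longrightarrow> ennreal (inverse C * r ^ (CARD('n) - 1)) \<le> emeasure \<sigma> (ball x r \<inter> frontier \<Omega>)"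
    by (rule ahlfors_small) blast
  have ball: "ball x r \<inter> frontier \<Omega> \<in> sets \<sigma>" if "x \<in> frontier \<Omega>" "0 < r" "r \<le> d" for x r
  proof (rule ccontr)
    assume "\<not> ?thesis"
    then have "emeasure \<sigma> (ball x r \<inter> frontier \<Omega>) = 0" by (rule emeasure_notin_sets)
    with Cd(3)[OF that] have "ennreal (inverse C * r ^ (CARD('n) - 1)) = 0" by simp
    moreover have "0 < inverse C * r ^ (CARD('n) - 1)" using Cd(1) that(2) by simp
    ultimately show False by (simp only: ennreal_eq_0_iff)
  qed
  define F where "F = {ball x r |x r. x \<in> frontier \<Omega> \<and> 0 < r \<and> r \<le> d \<and> ball x r \<subseteq> U}"
  obtain F' where F': "F' \<subseteq> F" "countable F'" "\<Union>F' = \<Union>F"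
    by (rule Lindelof[of F]) (auto simp: F_def)
  have "\<Union>F \<inter> frontier \<Omega> = U \<inter> frontier \<Omega>"
  proof
    show "U \<inter> frontier \<Omega> \<subseteq> \<Union>F \<inter> frontier \<Omega>"
    proof
      fix x assume x: "x \<in> U \<inter> frontier \<Omega>"
      then obtain e where e: "0 < e" "ball x e \<subseteq> U" using assms openE by blast
      then have "ball x (min e d) \<in> F" using x Cd(2) unfolding F_def by force
      moreover have "x \<in> ball x (min e d)" using e Cd(2) by simp
      ultimately show "x \<in> \<Union>F \<inter> frontier \<Omega>" using x by blast
    qed
  qed (auto simp: F_def)
  then have "U \<inter> frontier \<Omega> = (\<Union>B\<in>F'. B \<inter> frontier \<Omega>)" using F'(3) by blast
  moreover have "(\<Union>B\<in>F'. B \<inter> frontier \<Omega>) \<in> sets \<sigma>"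
    using F'(1,2) ball by (intro sets.countable_UN') (auto simp: F_def)
  ultimately show ?thesis by simp
qed

lemma id_borel_surface: "(\<lambda>x. x) \<in> borel_measurable \<sigma>"
  by (rule borel_measurableI) (simp add: open_in_sets_surface)

lemma borel_surface: "f \<in> borel_measurable borel \<Longrightarrow> f \<in> borel_measurable \<sigma>"
  by (rule measurable_compose[OF id_borel_surface])

lemma borel_sets_surface: "U \<in> sets borel \<Longrightarrow> U \<inter> frontier \<Omega> \<in> sets \<sigma>"
  using measurable_sets[OF id_borel_surface, of U] by simp

text \<open>The compact boundary is covered by finitely many balls of one admissible radius.\<close>

lemma surface_finite: "emeasure \<sigma> (frontier \<Omega>) < \<infinity>"
proof -
  obtain C d where Cd: "0 < C" "0 < d"
    "\<And>x r. x \<in> frontier \<Omega> \<Longrightarrow> 0 < r \<Longrightarrow> r \<le> d \<Longrightarrow> emeasure \<sigma> (ball x r \<inter> frontier \<Omega>) \<le> ennreal (C * r ^ (CARD('n) - 1))"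
    by (rule ahlfors_small) blast
  have "compact (frontier \<Omega>)" using bounded_dom by (rule compact_frontier_bounded)
  then obtain k where k: "finite k" "k \<subseteq> frontier \<Omega>" "frontier \<Omega> \<subseteq> (\<Union>x\<in>k. ball x d)"
  proof (rule compactE_image[of "frontier \<Omega>" "frontier \<Omega>" "\<lambda>x. ball x d"])
    show "frontier \<Omega> \<subseteq> (\<Union>x\<in>frontier \<Omega>. ball x d)" using Cd(2) by auto
  qed (auto intro: that)
  have "emeasure \<sigma> (frontier \<Omega>) \<le> emeasure \<sigma> (\<Union>x\<in>k. ball x d \<inter> frontier \<Omega>)"
    using k open_in_sets_surface by (intro emeasure_mono sets.finite_UN) auto
  also have "\<dots> \<le> (\<Sum>x\<in>k. emeasure \<sigma> (ball x d \<inter> frontier \<Omega>))"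
    using k open_in_sets_surface by (intro emeasure_subadditive_finite) auto
  also have "\<dots> \<le> (\<Sum>x\<in>k. ennreal (C * d ^ (CARD('n) - 1)))"
    using k Cd by (intro sum_mono Cd(3)) auto
  also have "\<dots> < \<infinity>" using k by (simp add: sum_ennreal less_top[symmetric] ennreal_mult_eq_top_iff)
  finally show ?thesis .
qed

lemma finite_measure_surface: "finite_measure \<sigma>"
  using surface_finite by (intro finite_measureI) auto

lemma sigma_finite_surface: "sigma_finite_measure \<sigma>"
  using finite_measure_surface by (simp add: finite_measure_def)

text \<open>Fubini's theorem will place balls at arbitrary centres z and with arbitrary radii. A
  ball that meets the boundary lies in one of twice the radius about a boundary point; if that
  radius is not admissible, the total mass is at most a multiple of the power of r.\<close>

lemma surface_ball_le:
  obtains C where "0 < C" "\<And>z r. 0 < r \<Longrightarrow> emeasure \<sigma> (ball z r \<inter> frontier \<Omega>) \<le> ennreal (C * r ^ (CARD('n) - 1))"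
proof -
  obtain C d where Cd: "0 < C" "0 < d"
    "\<And>x r. x \<in> frontier \<Omega> \<Longrightarrow> 0 < r \<Longrightarrow> r \<le> d \<Longrightarrow> emeasure \<sigma> (ball x r \<inter> frontier \<Omega>) \<le> ennreal (C * r ^ (CARD('n) - 1))"
    by (rule ahlfors_small) blast
  define s where "s = CARD('n) - 1"
  define m where "m = measure \<sigma> (frontier \<Omega>)"
  have m: "emeasure \<sigma> (frontier \<Omega>) = ennreal m" "0 \<le> m"
    using surface_finite by (auto simp: m_def emeasure_eq_ennreal_measure)
  define C' where "C' = C * 2 ^ s + m * (2 / d) ^ s"
  have pos: "0 < C * 2 ^ s" "0 \<le> m * (2 / d) ^ s" using Cd m by auto
  have "emeasure \<sigma> (ball z r \<inter> frontier \<Omega>) \<le> ennreal (C' * r ^ s)" if r: "0 < r" for z r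
  proof (cases "ball z r \<inter> frontier \<Omega> = {}")
    case False
    then obtain x where x: "x \<in> frontier \<Omega>" "dist z x < r" by auto
    show ?thesis
    proof (cases "2 * r \<le> d")
      case True
      have "ball z r \<subseteq> ball x (2 * r)"
      proof
        fix w assume "w \<in> ball z r"
        then show "w \<in> ball x (2 * r)" using x dist_triangle3[of x w z] by auto
      qed
      then have "emeasure \<sigma> (ball z r \<inter> frontier \<Omega>) \<le> emeasure \<sigma> (ball x (2 * r) \<inter> frontier \<Omega>)"
        using open_in_sets_surface by (intro emeasure_mono) auto
      also have "\<dots> \<le> ennreal (C * (2 * r) ^ s)" unfolding s_def using True r x by (intro Cd(3)) auto
      also have "\<dots> \<le> ennreal (C' * r ^ s)"
      proof (rule ennreal_leI)
        have "C * (2 * r) ^ s = C * 2 ^ s * r ^ s" by (simp add: power_mult_distrib)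
        also have "\<dots> \<le> C' * r ^ s" using pos r by (intro mult_right_mono) (auto simp: C'_def)
        finally show "C * (2 * r) ^ s \<le> C' * r ^ s" .
      qed
      finally show ?thesis .
    next
      case False
      have "emeasure \<sigma> (ball z r \<inter> frontier \<Omega>) \<le> ennreal m"
        unfolding m(1)[symmetric] using borel_sets_surface[of UNIV] by (intro emeasure_mono) auto
      also have "\<dots> \<le> ennreal (C' * r ^ s)"
      proof (rule ennreal_leI)
        have "1 \<le> (2 / d * r) ^ s" using False Cd(2) by (intro one_le_power) (simp add: field_simps)
        then have "m * 1 \<le> m * (2 / d * r) ^ s" by (rule mult_left_mono) (rule m)
        also have "\<dots> = m * (2 / d) ^ s * r ^ s" unfolding power_mult_distrib by simp
        also have "\<dots> \<le> C' * r ^ s" using pos r by (intro mult_right_mono) (auto simp: C'_def)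
        finally show "m \<le> C' * r ^ s" by simp
      qed
      finally show ?thesis .
    qed
  qed simp
  then show ?thesis using pos by (intro that[of C']) (auto simp: C'_def s_def)
qed

text \<open>Shrinking every radius by the fixed factor \<theta> makes it admissible, and the loss
  goes into the constant.\<close>

lemma surface_ball_ge:
  assumes "0 < L"
  obtains c where "0 < c" "\<And>x r. x \<in> frontier \<Omega> \<Longrightarrow> 0 < r \<Longrightarrow> r \<le> L \<Longrightarrow> ennreal (c * r ^ (CARD('n) - 1)) \<le> emeasure \<sigma> (ball x r \<inter> frontier \<Omega>)"
proof -
  obtain C d where Cd: "0 < C" "0 < d"
    "\<And>x r. x \<in> frontier \<Omega> \<Longrightarrow> 0 < r \<Longrightarrow> r \<le> d \<Longrightarrow> ennreal (inverse C * r ^ (CARD('n) - 1)) \<le> emeasure \<sigma> (ball x r \<inter> frontier \<Omega>)"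
    by (rule ahlfors_small) blast
  define \<theta> where "\<theta> = d / (L + d)"
  have \<theta>: "0 < \<theta>" "\<theta> \<le> 1" using Cd assms by (auto simp: \<theta>_def)
  show ?thesis
  proof (rule that[of "inverse C * \<theta> ^ (CARD('n) - 1)"])
    show "0 < inverse C * \<theta> ^ (CARD('n) - 1)" using Cd \<theta> by simp
    fix x r assume x: "x \<in> frontier \<Omega>" and r: "0 < r" "r \<le> L"
    have "\<theta> * r \<le> d / (L + d) * L" unfolding \<theta>_def using Cd assms r by (intro mult_left_mono) auto
    also have "\<dots> \<le> d" using Cd assms by (simp add: field_simps)
    finally have "ennreal (inverse C * (\<theta> * r) ^ (CARD('n) - 1)) \<le> emeasure \<sigma> (ball x (\<theta> * r) \<inter> frontier \<Omega>)"
      using x r \<theta> by (intro Cd(3)) auto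
    also have "\<dots> \<le> emeasure \<sigma> (ball x r \<inter> frontier \<Omega>)"
    proof (intro emeasure_mono Int_mono subset_ball order_refl open_in_sets_surface)
      show "\<theta> * r \<le> r" using \<theta> r by (simp add: mult_left_le_one_le)
    qed simp
    finally show "ennreal (inverse C * \<theta> ^ (CARD('n) - 1) * r ^ (CARD('n) - 1)) \<le> emeasure \<sigma> (ball x r \<inter> frontier \<Omega>)"
      by (simp add: power_mult_distrib mult.assoc)
  qed
qed

section \<open>Majorants by summation over scales\<close>

text \<open>After exchanging the integrals, a point z is counted only for x in a surface ball of
  radius R about z. The measure \<open>M\<close> is kept general because both surface measure and
  Lebesgue measure are inserted.\<close>

lemma nn_integral_surface_ball:
  fixes M :: "(real^'n) measure"
  assumes "0 < R" and M: "sigma_finite_measure M" and idM[measurable]: "(\<lambda>x. x) \<in> borel_measurable M"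
    and h[measurable]: "h \<in> borel_measurable M"
    and C: "0 < C" "\<And>z r. 0 < r \<Longrightarrow> emeasure \<sigma> (ball z r \<inter> frontier \<Omega>) \<le> ennreal (C * r ^ (CARD('n) - 1))"
  shows "(\<lambda>x. \<integral>\<^sup>+z. h z * indicator (ball x R) z \<partial>M) \<in> borel_measurable \<sigma>"
    and "(\<integral>\<^sup>+x. (\<integral>\<^sup>+z. h z * indicator (ball x R) z \<partial>M) \<partial>\<sigma>) \<le> ennreal (C * R ^ (CARD('n) - 1)) * (\<integral>\<^sup>+z. h z \<partial>M)"
proof -
  interpret M: sigma_finite_measure M by (rule M)
  interpret S: sigma_finite_measure \<sigma> by (rule sigma_finite_surface)
  interpret P: pair_sigma_finite \<sigma> M ..
  have e: "indicator (ball x R) z = (if dist x z < R then 1 else 0 :: ennreal)" for x z :: "real^'n"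
    by (simp add: indicator_def)
  have [measurable]: "(\<lambda>p. dist (fst p) (snd p)) \<in> borel_measurable (\<sigma> \<Otimes>\<^sub>M M)"
    using measurable_compose[OF measurable_fst id_borel_surface] measurable_compose[OF measurable_snd idM]
    by (intro borel_measurable_dist) auto
  have meas[measurable]: "case_prod (\<lambda>x z. h z * indicator (ball x R) z) \<in> borel_measurable (\<sigma> \<Otimes>\<^sub>M M)"
    unfolding e case_prod_beta by measurable
  show "(\<lambda>x. \<integral>\<^sup>+z. h z * indicator (ball x R) z \<partial>M) \<in> borel_measurable \<sigma>"
    by (rule M.borel_measurable_nn_integral[OF meas])
  have "(\<integral>\<^sup>+x. (\<integral>\<^sup>+z. h z * indicator (ball x R) z \<partial>M) \<partial>\<sigma>) = (\<integral>\<^sup>+z. (\<integral>\<^sup>+x. h z * indicator (ball x R) z \<partial>\<sigma>) \<partial>M)"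
    by (rule P.Fubini'[OF meas, symmetric])
  also have "\<dots> \<le> (\<integral>\<^sup>+z. ennreal (C * R ^ (CARD('n) - 1)) * h z \<partial>M)"
  proof (rule nn_integral_mono)
    fix z
    have "(\<integral>\<^sup>+x. h z * indicator (ball x R) z \<partial>\<sigma>) = (\<integral>\<^sup>+x. h z * indicator (ball z R \<inter> frontier \<Omega>) x \<partial>\<sigma>)"
      by (intro nn_integral_cong) (auto simp: indicator_def dist_commute)
    also have "\<dots> = h z * emeasure \<sigma> (ball z R \<inter> frontier \<Omega>)"
      by (intro nn_integral_cmult_indicator open_in_sets_surface) simp
    also have "\<dots> \<le> h z * ennreal (C * R ^ (CARD('n) - 1))"
      by (intro mult_left_mono C(2) assms(1)) simp
    finally show "(\<integral>\<^sup>+x. h z * indicator (ball x R) z \<partial>\<sigma>) \<le> ennreal (C * R ^ (CARD('n) - 1)) * h z" by (simp add: mult.commute)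
  qed
  also have "\<dots> = ennreal (C * R ^ (CARD('n) - 1)) * (\<integral>\<^sup>+z. h z \<partial>M)" by (rule nn_integral_cmult) measurable
  finally show "(\<integral>\<^sup>+x. (\<integral>\<^sup>+z. h z * indicator (ball x R) z \<partial>M) \<partial>\<sigma>) \<le> ennreal (C * R ^ (CARD('n) - 1)) * (\<integral>\<^sup>+z. h z \<partial>M)" .
qed

text \<open>This replaces a maximal theorem: the supremum over the radii is bounded by the sum over
  dyadic radii. Scale r contributes r^(a-s) r^s = r^a times the integral of h, with s the boundary
  dimension, and a > 0 makes the series geometric with total \<tau>^a. The constant is fixed before
  the measure, the function and the scale.\<close>

lemma dyadic_majorant:
  assumes "0 < a" "0 < K"
  obtains C where "0 < C"
    "\<And>(M :: (real^'n) measure) h \<tau>. sigma_finite_measure M \<Longrightarrow> (\<lambda>x. x) \<in> borel_measurable M \<Longrightarrow>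
       h \<in> borel_measurable M \<Longrightarrow> 0 < \<tau> \<Longrightarrow>
       \<exists>H \<in> borel_measurable \<sigma>.
         (\<forall>x t. 0 < t \<longrightarrow> t \<le> \<tau> \<longrightarrow>
            ennreal (t powr (a - real (CARD('n) - 1))) * (\<integral>\<^sup>+z. h z * indicator (ball x (K * t)) z \<partial>M) \<le> H x) \<and>
         (\<integral>\<^sup>+x. H x \<partial>\<sigma>) \<le> ennreal (C * \<tau> powr a) * (\<integral>\<^sup>+z. h z \<partial>M)"
proof -
  define s where "s = CARD('n) - 1"
  define b where "b = a - real s"
  \<comment> \<open>Moving from t to the next dyadic radius, at most 2t, changes the power with
    exponent b by a factor of at most 1 if b \<ge> 0 and 2^(-b) otherwise.\<close>
  define A where "A = 1 + 2 powr (- b)"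
  have A: "1 \<le> A" "2 powr (-b) \<le> A" by (auto simp: A_def)
  obtain Cu where Cu: "0 < Cu" "\<And>z r. 0 < r \<Longrightarrow> emeasure \<sigma> (ball z r \<inter> frontier \<Omega>) \<le> ennreal (Cu * r ^ (CARD('n) - 1))"
    by (rule surface_ball_le) blast
  define q :: real where "q = (1/2) powr a"
  have q: "0 < q" "q < 1" using powr_less_mono2[of a "1/2" 1] assms by (auto simp: q_def)
  define C where "C = A * Cu * K ^ s / (1 - q)"
  have C0: "0 < C" using A Cu q assms by (auto simp: C_def)
  show ?thesis
  proof (rule that[OF C0])
    fix M :: "(real^'n) measure" and h :: "real^'n \<Rightarrow> ennreal" and \<tau> :: real
    assume M: "sigma_finite_measure M" "(\<lambda>x. x) \<in> borel_measurable M" "h \<in> borel_measurable M" "0 < \<tau>"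
    define r where "r i = \<tau> / 2 ^ i" for i :: nat
    have r0: "0 < r i" for i using M(4) by (simp add: r_def)
    define G where "G i x = (\<integral>\<^sup>+z. h z * indicator (ball x (K * r i)) z \<partial>M)" for i x
    define H where "H x = (\<Sum>i. ennreal (A * r i powr b) * G i x)" for x
    have Kr: "0 < K * r i" for i using assms r0 by simp
    have Gm[measurable]: "G i \<in> borel_measurable \<sigma>" for i
      unfolding G_def by (rule nn_integral_surface_ball(1)[OF Kr M(1-3) Cu])
    have Gi: "(\<integral>\<^sup>+x. G i x \<partial>\<sigma>) \<le> ennreal (Cu * (K * r i) ^ s) * (\<integral>\<^sup>+z. h z \<partial>M)" for i
      unfolding G_def s_def by (rule nn_integral_surface_ball(2)[OF Kr M(1-3) Cu])
    have Hm: "H \<in> borel_measurable \<sigma>" unfolding H_def by measurable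
    moreover have "ennreal (t powr b) * (\<integral>\<^sup>+z. h z * indicator (ball x (K * t)) z \<partial>M) \<le> H x"
      if t: "0 < t" "t \<le> \<tau>" for x t
    proof -
      obtain i where i: "t \<le> r i" "r i \<le> 2 * t" unfolding r_def by (rule dyadic_scale[OF t])
      have "t powr b \<le> A * r i powr b"
      proof (cases "0 \<le> b")
        case True
        then have "t powr b \<le> 1 * r i powr b" using t i by (simp add: powr_mono2)
        also have "\<dots> \<le> A * r i powr b" using A by (intro mult_right_mono) auto
        finally show ?thesis .
      next
        case False
        then have "t powr b \<le> (r i / 2) powr b" using t i r0[of i] by (intro powr_mono2') auto
        also have "\<dots> = 2 powr (-b) * r i powr b" 
        proof -
          have "(r i / 2) powr b = r i powr b / 2 powr b" by (rule powr_divide)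
          then show ?thesis by (simp add: powr_minus_divide)
        qed
        also have "\<dots> \<le> A * r i powr b" using A by (intro mult_right_mono) auto
        finally show ?thesis .
      qed
      then have "ennreal (t powr b) * (\<integral>\<^sup>+z. h z * indicator (ball x (K * t)) z \<partial>M) \<le> ennreal (A * r i powr b) * G i x"
      proof (rule mult_mono[OF ennreal_leI])
        have "ball x (K * t) \<subseteq> ball x (K * r i)" using i(1) assms by (intro subset_ball mult_left_mono) auto
        then show "(\<integral>\<^sup>+z. h z * indicator (ball x (K * t)) z \<partial>M) \<le> G i x"
          unfolding G_def by (intro nn_integral_mono) (auto simp: indicator_def)
      qed auto
      also have "\<dots> \<le> H x" unfolding H_def
        using sum_le_suminf[of "\<lambda>i. ennreal (A * r i powr b) * G i x" "{i}"] by simp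
      finally show ?thesis .
    qed
    moreover have "(\<integral>\<^sup>+x. H x \<partial>\<sigma>) \<le> ennreal (C * \<tau> powr a) * (\<integral>\<^sup>+z. h z \<partial>M)"
    proof -
      have "(\<integral>\<^sup>+x. H x \<partial>\<sigma>) = (\<Sum>i. ennreal (A * r i powr b) * (\<integral>\<^sup>+x. G i x \<partial>\<sigma>))"
        unfolding H_def by (subst nn_integral_suminf) (auto simp: nn_integral_cmult)
      also have "\<dots> \<le> (\<Sum>i. ennreal (A * Cu * K ^ s * \<tau> powr a * q ^ i) * (\<integral>\<^sup>+z. h z \<partial>M))"
      proof (intro suminf_le allI)
        fix i
        have rp: "r i powr b * r i ^ s = \<tau> powr a * q ^ i"
        proof -
          have "r i powr b * r i ^ s = r i powr a"
            using r0[of i] by (simp add: powr_realpow[symmetric] powr_add[symmetric] b_def)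
          also have "\<dots> = \<tau> powr a * ((1/2) ^ i) powr a"
            using M(4) by (simp add: r_def powr_mult[symmetric] power_one_over)
          also have "((1/2::real) ^ i) powr a = q ^ i"
            by (simp add: q_def powr_powr powr_realpow[symmetric] mult.commute del: powr_realpow)
          finally show ?thesis .
        qed
        have "ennreal (A * r i powr b) * (\<integral>\<^sup>+x. G i x \<partial>\<sigma>)
            \<le> ennreal (A * r i powr b) * (ennreal (Cu * (K * r i) ^ s) * (\<integral>\<^sup>+z. h z \<partial>M))"
          by (intro mult_left_mono Gi) simp
        also have "\<dots> = ennreal ((A * r i powr b) * (Cu * (K * r i) ^ s)) * (\<integral>\<^sup>+z. h z \<partial>M)"
          using A Cu assms r0[of i] by (simp add: ennreal_mult mult.assoc)
        also have "(A * r i powr b) * (Cu * (K * r i) ^ s) = A * Cu * K ^ s * (r i powr b * r i ^ s)"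
          by (simp add: power_mult_distrib mult_ac)
        finally show "ennreal (A * r i powr b) * (\<integral>\<^sup>+x. G i x \<partial>\<sigma>) \<le> ennreal (A * Cu * K ^ s * \<tau> powr a * q ^ i) * (\<integral>\<^sup>+z. h z \<partial>M)"
          by (simp add: rp mult.assoc)
      qed auto
      also have "\<dots> = (\<Sum>i. ennreal (A * Cu * K ^ s * \<tau> powr a * q ^ i)) * (\<integral>\<^sup>+z. h z \<partial>M)"
        by (rule ennreal_suminf_multc)
      also have "(\<Sum>i. ennreal (A * Cu * K ^ s * \<tau> powr a * q ^ i)) = ennreal (\<Sum>i. A * Cu * K ^ s * \<tau> powr a * q ^ i)"
        using A Cu assms q by (intro suminf_ennreal2 summable_mult summable_geometric) auto
      also have "(\<Sum>i. A * Cu * K ^ s * \<tau> powr a * q ^ i) = C * \<tau> powr a"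
        using q by (subst suminf_mult) (auto simp: suminf_geometric C_def summable_geometric)
      finally show ?thesis .
    qed
    ultimately show "\<exists>H \<in> borel_measurable \<sigma>.
         (\<forall>x t. 0 < t \<longrightarrow> t \<le> \<tau> \<longrightarrow>
            ennreal (t powr (a - real (CARD('n) - 1))) * (\<integral>\<^sup>+z. h z * indicator (ball x (K * t)) z \<partial>M) \<le> H x) \<and>
         (\<integral>\<^sup>+x. H x \<partial>\<sigma>) \<le> ennreal (C * \<tau> powr a) * (\<integral>\<^sup>+z. h z \<partial>M)"
      unfolding b_def s_def by blast
  qed
qed

end

section \<open>Nontangential oscillation\<close>

lemma epowr_ennreal [simp]: "0 \<le> a \<Longrightarrow> epowr (ennreal a) p = ennreal (a powr p)"
  by (simp add: epowr_def)

lemma epowr_top [simp]: "epowr top p = top"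
  by (simp add: epowr_def)

lemma epowr_mono: "0 < p \<Longrightarrow> s \<le> t \<Longrightarrow> epowr s p \<le> epowr t p"
  by (cases s; cases t) (auto intro!: ennreal_leI powr_mono2 simp: top_unique)

lemma epowr_epowr: "0 < p \<Longrightarrow> 0 < q \<Longrightarrow> epowr (epowr t p) q = epowr t (p * q)"
  by (cases t) (auto simp: powr_powr)

lemma epowr_one [simp]: "epowr t 1 = t"
  by (cases t) auto

lemma epowr_measurable [measurable]: "(\<lambda>t. epowr t p) \<in> borel_measurable borel"
  unfolding epowr_def by measurable

context ahlfors_domain
begin

definition nt_avg :: "(real^'n \<Rightarrow> 'b::real_normed_vector) \<Rightarrow> real^'n \<Rightarrow> ennreal" where
  "nt_avg v y = epowr (sqint (wball \<Omega> y) v / emeasure lebesgue (wball \<Omega> y)) (1/2)"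

lemma nt_max_eq: "nt_max \<Omega> v x = (SUP y \<in> nt_cone \<Omega> x. nt_avg v y)"
  unfolding nt_max_def nt_avg_def by (simp add: sqint_set_integral)

lemma wball_measure:
  assumes "y \<in> \<Omega>"
  shows "emeasure lebesgue (wball \<Omega> y) = ennreal (measure lebesgue (wball \<Omega> y))"
    and "0 < measure lebesgue (wball \<Omega> y)"
proof -
  show "emeasure lebesgue (wball \<Omega> y) = ennreal (measure lebesgue (wball \<Omega> y))"
    by (intro emeasure_eq_ennreal_measure) (simp add: less_imp_neq[OF emeasure_lborel_ball_finite[unfolded infinity_ennreal_def]])
  show "0 < measure lebesgue (wball \<Omega> y)"
    using content_ball_pos[of "bdist \<Omega> y / 4" y] bdist_pos[OF open_dom bounded_dom assms] by simp
qed

lemma nt_avg_le: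
  assumes "y \<in> \<Omega>" "0 \<le> X" "sqint (wball \<Omega> y) v \<le> ennreal (X\<^sup>2 * measure lebesgue (wball \<Omega> y))"
  shows "nt_avg v y \<le> ennreal X"
proof -
  note V = wball_measure[OF assms(1)]
  have "sqint (wball \<Omega> y) v / emeasure lebesgue (wball \<Omega> y)
     \<le> ennreal (X\<^sup>2 * measure lebesgue (wball \<Omega> y)) / emeasure lebesgue (wball \<Omega> y)"
    by (rule divide_right_mono_ennreal[OF assms(3)])
  also have "\<dots> = ennreal (X\<^sup>2)" unfolding V(1) using V(2) by (simp add: divide_ennreal)
  finally have "nt_avg v y \<le> epowr (ennreal (X\<^sup>2)) (1/2)" unfolding nt_avg_def by (rule epowr_mono[rotated]) simp
  also have "\<dots> = ennreal X" using assms(2) by (simp add: powr_half_sqrt)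
  finally show ?thesis .
qed

lemma nt_avg_eq_davg:
  assumes "y \<in> \<Omega>" "sqint \<Omega> v < \<infinity>"
  shows "nt_avg v y = ennreal (davg \<Omega> v y)"
proof -
  note V = wball_measure[OF assms(1)]
  have "sqint (wball \<Omega> y) v / emeasure lebesgue (wball \<Omega> y) = ennreal ((davg \<Omega> v y)\<^sup>2)"
    unfolding davg_square[OF open_dom bounded_dom assms] V(1) using V(2) by (simp add: divide_ennreal)
  then show ?thesis unfolding nt_avg_def by (simp add: powr_half_sqrt davg_nonneg)
qed

text \<open>A boundary point x lies in the open ball \<open>ball y (2 * bdist \<Omega> y)\<close>
  exactly when y belongs to the cone at x, so superlevel sets are relatively open.\<close>

lemma nt_max_measurable [measurable]: "nt_max \<Omega> v \<in> borel_measurable \<sigma>"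
proof (rule borel_measurableI_greater)
  fix t
  have "{x \<in> space \<sigma>. t < nt_max \<Omega> v x} = (\<Union>y\<in>{y \<in> \<Omega>. t < nt_avg v y}. ball y (2 * bdist \<Omega> y)) \<inter> frontier \<Omega>"
    unfolding nt_max_eq less_SUP_iff by (auto simp: nt_cone_def)
  also have "\<dots> \<in> sets \<sigma>" by (intro open_in_sets_surface open_UN) auto
  finally show "{x \<in> space \<sigma>. t < nt_max \<Omega> v x} \<in> sets \<sigma>" .
qed

end

locale robin_domain = ahlfors_domain \<Omega> + corkscrew_family \<Omega> c D0 Y
  for \<Omega> :: "(real^'n) set" and c D0 Y +
  fixes ystar :: "real^'n"
  assumes ystar: "ystar \<in> \<Omega>"
begin

lemma bdist_bound:
  obtains L where "0 < L" "\<And>y. y \<in> \<Omega> \<Longrightarrow> bdist \<Omega> y \<le> L"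
proof -
  obtain z where z: "z \<in> frontier \<Omega>" using frontier_bounded_ne[OF bounded_dom nonempty] by blast
  obtain e where e: "\<And>y. y \<in> \<Omega> \<Longrightarrow> dist z y \<le> e" using bounded_dom bounded_any_center by metis
  show ?thesis
  proof (rule that[of "\<bar>e\<bar> + 1"])
    fix y assume "y \<in> \<Omega>"
    then show "bdist \<Omega> y \<le> \<bar>e\<bar> + 1" using bdist_le_dist[OF z, of y] e[of y] by (simp add: dist_commute)
  qed simp
qed

text \<open>The aperture 2 of \<open>nt_cone\<close> puts w in the cone of every boundary point
  closer than \<delta>(w) to its nearest one. On that surface ball the maximal function is at least
  the average at w, and the lower Ahlfors bound divides by its measure. The ball is contained in the
  one of radius (K+2) \<delta>(w) about x.\<close>

lemma davg_le_surface_average: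
  assumes "0 < q" "0 \<le> K"
  obtains A where "0 < A"
    "\<And>(v :: real^'n \<Rightarrow> real^'n) w x. sqint \<Omega> v < \<infinity> \<Longrightarrow> w \<in> wide_cone K \<Omega> x \<Longrightarrow>
      ennreal ((bdist \<Omega> w powr (3/4) * davg \<Omega> v w) powr q) \<le>
      ennreal A * (ennreal (bdist \<Omega> w powr (3 * q / 4 - real (CARD('n) - 1))) *
         (\<integral>\<^sup>+z. epowr (nt_max \<Omega> v z) q * indicator (ball x ((K + 2) * bdist \<Omega> w)) z \<partial>\<sigma>))"
proof -
  obtain L where L: "0 < L" "\<And>y. y \<in> \<Omega> \<Longrightarrow> bdist \<Omega> y \<le> L" by (rule bdist_bound) blast
  obtain cl where cl: "0 < cl"
    "\<And>x r. x \<in> frontier \<Omega> \<Longrightarrow> 0 < r \<Longrightarrow> r \<le> L \<Longrightarrow> ennreal (cl * r ^ (CARD('n) - 1)) \<le> emeasure \<sigma> (ball x r \<inter> frontier \<Omega>)"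
    by (rule surface_ball_ge[OF L(1)]) blast
  define s where "s = CARD('n) - 1"
  show ?thesis
  proof (rule that[of "1 / cl"])
    show "0 < 1 / cl" using cl by simp
    fix v :: "real^'n \<Rightarrow> real^'n" and w x
    assume v: "sqint \<Omega> v < \<infinity>" and wc: "w \<in> wide_cone K \<Omega> x"
    define t where "t = bdist \<Omega> w"
    define D where "D = davg \<Omega> v w"
    have w: "w \<in> \<Omega>" "dist w x \<le> K * t" using wc by (auto simp: wide_cone_def t_def)
    have t: "0 < t" "t \<le> L" using bdist_pos[OF ahlfors_domain.open_dom[OF ahlfors_domain_axioms] bounded_dom w(1)] L w by (auto simp: t_def)
    have D0: "0 \<le> D" by (simp add: D_def davg_nonneg)
    obtain z0 where z0: "z0 \<in> frontier \<Omega>" "dist w z0 = t"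
      using nearest_frontier_point[OF bounded_dom nonempty, of w] unfolding t_def by blast
    define \<Delta> where "\<Delta> = ball z0 t \<inter> frontier \<Omega>"
    have \<Delta>s: "\<Delta> \<in> sets \<sigma>" unfolding \<Delta>_def by (rule open_in_sets_surface) simp
    define I where "I = (\<integral>\<^sup>+z. epowr (nt_max \<Omega> v z) q * indicator (ball x ((K + 2) * t)) z \<partial>\<sigma>)"
    have "ennreal (D powr q) * ennreal (cl * t ^ s) \<le> ennreal (D powr q) * emeasure \<sigma> \<Delta>"
      unfolding \<Delta>_def s_def by (intro mult_left_mono cl(2) z0 t) simp
    also have "\<dots> = (\<integral>\<^sup>+z. ennreal (D powr q) * indicator \<Delta> z \<partial>\<sigma>)"
      using \<Delta>s by (simp add: nn_integral_cmult_indicator)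
    also have "\<dots> \<le> I" unfolding I_def
    proof (rule nn_integral_mono)
      fix z
      show "ennreal (D powr q) * indicator \<Delta> z \<le> epowr (nt_max \<Omega> v z) q * indicator (ball x ((K + 2) * t)) z"
      proof (cases "z \<in> \<Delta>")
        case True
        then have z: "z \<in> frontier \<Omega>" "dist z0 z < t" by (auto simp: \<Delta>_def)
        have d: "dist w z < 2 * t" using z z0 dist_triangle[of w z z0] by simp
        then have "w \<in> nt_cone \<Omega> z" using w by (simp add: nt_cone_def t_def)
        then have "ennreal D \<le> nt_max \<Omega> v z"
          unfolding nt_max_eq D_def nt_avg_eq_davg[OF w(1) v, symmetric] by (rule SUP_upper)
        then have "epowr (ennreal D) q \<le> epowr (nt_max \<Omega> v z) q" by (rule epowr_mono[OF assms(1)])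
        moreover have "dist x z < (K + 2) * t"
          using d w(2) dist_triangle3[of x z w] by (simp add: distrib_right)
        ultimately show ?thesis using D0 True by simp
      qed simp
    qed
    finally have b: "ennreal (D powr q) * ennreal (cl * t ^ s) \<le> I" .
    have "(t powr (3/4) * D) powr q = 1 / cl * t powr (3 * q / 4 - s) * (D powr q * (cl * t ^ s))"
    proof -
      have "(t powr (3/4) * D) powr q = t powr (3 * q / 4) * D powr q"
        using t D0 by (simp add: powr_mult powr_powr)
      also have "t powr (3 * q / 4) = t powr (3 * q / 4 - s) * t ^ s"
        using t by (simp add: powr_realpow[symmetric] powr_add[symmetric])
      finally show ?thesis using cl by simp
    qed
    then have "ennreal ((t powr (3/4) * D) powr q) = ennreal (1 / cl) * (ennreal (t powr (3 * q / 4 - s)) * (ennreal (D powr q) * ennreal (cl * t ^ s)))"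
      using cl t by (simp only: ennreal_mult[symmetric] mult.assoc) (simp add: ennreal_mult[symmetric])
    also have "\<dots> \<le> ennreal (1 / cl) * (ennreal (t powr (3 * q / 4 - s)) * I)"
      by (intro mult_left_mono b) auto
    finally show "ennreal ((bdist \<Omega> w powr (3/4) * davg \<Omega> v w) powr q) \<le>
      ennreal (1 / cl) * (ennreal (bdist \<Omega> w powr (3 * q / 4 - real (CARD('n) - 1))) *
         (\<integral>\<^sup>+z. epowr (nt_max \<Omega> v z) q * indicator (ball x ((K + 2) * bdist \<Omega> w)) z \<partial>\<sigma>))"
      by (simp add: I_def t_def D_def s_def)
  qed
qed

text \<open>The majorant of \<open>dyadic_majorant\<close> with exponent 3q/4 bounds the weighted
  averages throughout the wide cone at x by a single number, and this is the \<open>T\<close> of the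
  chain estimate. Since \<delta> is bounded, the same number controls \<delta> D, which Poincare's
  inequality needs at the cone point itself.\<close>

lemma oscillation_nt_max:
  assumes q: "0 < q" and K0: "0 \<le> K0"
  obtains C where "0 < C"
    "\<And>u Du. w12 \<Omega> u Du \<Longrightarrow> \<exists>H \<in> borel_measurable \<sigma>.
       (\<integral>\<^sup>+x. H x \<partial>\<sigma>) \<le> ennreal C * (\<integral>\<^sup>+x. epowr (nt_max \<Omega> Du x) q \<partial>\<sigma>) \<and>
       (\<forall>x\<in>frontier \<Omega>. \<forall>y\<in>wide_cone K0 \<Omega> x.
          ennreal (\<bar>bmean \<Omega> u y - bmean \<Omega> u ystar\<bar> powr q) \<le> H x \<and>
          ennreal ((bdist \<Omega> y * davg \<Omega> Du y) powr q) \<le> H x)"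
proof -
  note dom = ahlfors_domain.open_dom[OF ahlfors_domain_axioms] bounded_dom
  obtain L where L: "0 < L" "\<And>y. y \<in> \<Omega> \<Longrightarrow> bdist \<Omega> y \<le> L" by (rule bdist_bound) blast
  obtain \<kappa> where \<kappa>: "0 < \<kappa>" "\<And>u Du. w12 \<Omega> u Du \<Longrightarrow> hop_potential \<Omega> (bmean \<Omega> u) (\<lambda>w. \<kappa> * davg \<Omega> Du w)"
    by (rule hop_potential_w12[OF dom]) blast
  obtain K1 C1 where KC: "0 < K1" "0 < C1"
    "\<And>\<rho> D T x y. hop_potential \<Omega> \<rho> D \<Longrightarrow> 0 \<le> T \<Longrightarrow> x \<in> frontier \<Omega> \<Longrightarrow>
       (\<And>w. w \<in> wide_cone K1 \<Omega> x \<Longrightarrow> bdist \<Omega> w powr (3/4) * D w \<le> T) \<Longrightarrow>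
       y \<in> wide_cone K0 \<Omega> x \<Longrightarrow> \<bar>\<rho> y - \<rho> ystar\<bar> \<le> C1 * T"
    by (rule oscillation_in_wide_cone[OF ystar K0]) blast
  define K where "K = max K0 K1"
  have K: "0 \<le> K" "0 < K + 2" "wide_cone K0 \<Omega> x \<subseteq> wide_cone K \<Omega> x" "wide_cone K1 \<Omega> x \<subseteq> wide_cone K \<Omega> x" for x
    using K0 wide_cone_mono[of _ K \<Omega> x] by (auto simp: K_def)
  obtain A where A: "0 < A"
    "\<And>(v::real^'n \<Rightarrow> real^'n) w x. sqint \<Omega> v < \<infinity> \<Longrightarrow> w \<in> wide_cone K \<Omega> x \<Longrightarrow>
      ennreal ((bdist \<Omega> w powr (3/4) * davg \<Omega> v w) powr q) \<le>
      ennreal A * (ennreal (bdist \<Omega> w powr (3 * q / 4 - real (CARD('n) - 1))) *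
         (\<integral>\<^sup>+z. epowr (nt_max \<Omega> v z) q * indicator (ball x ((K + 2) * bdist \<Omega> w)) z \<partial>\<sigma>))"
    by (rule davg_le_surface_average[OF q K(1)]) blast
  have a: "0 < 3 * q / 4" using q by simp
  obtain Cm where Cm: "0 < Cm"
    "\<And>(M :: (real^'n) measure) h \<tau>. sigma_finite_measure M \<Longrightarrow> (\<lambda>x. x) \<in> borel_measurable M \<Longrightarrow>
       h \<in> borel_measurable M \<Longrightarrow> 0 < \<tau> \<Longrightarrow>
       \<exists>H \<in> borel_measurable \<sigma>.
         (\<forall>x t. 0 < t \<longrightarrow> t \<le> \<tau> \<longrightarrow>
            ennreal (t powr (3 * q / 4 - real (CARD('n) - 1))) * (\<integral>\<^sup>+z. h z * indicator (ball x ((K + 2) * t)) z \<partial>M) \<le> H x) \<and>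
         (\<integral>\<^sup>+x. H x \<partial>\<sigma>) \<le> ennreal (Cm * \<tau> powr (3 * q / 4)) * (\<integral>\<^sup>+z. h z \<partial>M)"
    by (rule dyadic_majorant[OF a K(2)]) blast
  define B where "B = ((C1 * \<kappa>) powr q + L powr (q / 4)) * A"
  have parts: "0 < (C1 * \<kappa>) powr q" "0 < L powr (q / 4)" using KC \<kappa> L by auto
  have B0: "0 < B" unfolding B_def by (intro mult_pos_pos add_pos_pos parts A(1))
  show ?thesis
  proof (rule that[of "B * (Cm * L powr (3 * q / 4))"])
    show "0 < B * (Cm * L powr (3 * q / 4))" using B0 Cm L by simp
    fix u Du assume w12: "w12 \<Omega> u Du"
    then have fin: "sqint \<Omega> Du < \<infinity>" by (simp add: w12_def)
    have hm: "(\<lambda>x. epowr (nt_max \<Omega> Du x) q) \<in> borel_measurable \<sigma>" by measurable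
    obtain H0 where H0[measurable]: "H0 \<in> borel_measurable \<sigma>"
      and H0b: "\<And>x t. 0 < t \<Longrightarrow> t \<le> L \<Longrightarrow>
            ennreal (t powr (3 * q / 4 - real (CARD('n) - 1))) * (\<integral>\<^sup>+z. epowr (nt_max \<Omega> Du z) q * indicator (ball x ((K + 2) * t)) z \<partial>\<sigma>) \<le> H0 x"
      and H0i: "(\<integral>\<^sup>+x. H0 x \<partial>\<sigma>) \<le> ennreal (Cm * L powr (3 * q / 4)) * (\<integral>\<^sup>+x. epowr (nt_max \<Omega> Du x) q \<partial>\<sigma>)"
      using Cm(2)[OF sigma_finite_surface id_borel_surface hm L(1)] by blast
    have key: "ennreal ((bdist \<Omega> w powr (3/4) * davg \<Omega> Du w) powr q) \<le> ennreal A * H0 x" if "w \<in> wide_cone K \<Omega> x" for w x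
    proof -
      have "w \<in> \<Omega>" using that by (simp add: wide_cone_def)
      then show ?thesis
        using bdist_pos[OF dom] L(2) by (intro order_trans[OF A(2)[OF fin that] mult_left_mono[OF H0b]]) auto
    qed
    have main: "ennreal (\<bar>bmean \<Omega> u y - bmean \<Omega> u ystar\<bar> powr q) \<le> ennreal B * H0 x \<and>
          ennreal ((bdist \<Omega> y * davg \<Omega> Du y) powr q) \<le> ennreal B * H0 x"
      if x: "x \<in> frontier \<Omega>" and y: "y \<in> wide_cone K0 \<Omega> x" for x y
    proof (cases "H0 x")
      case (real h)
      \<comment> \<open>Chosen so that \<open>T powr q\<close> is the majorant at x up to the factor
        \<open>A\<close>; an infinite majorant makes both bounds trivial.\<close>
      define T where "T = (A * h) powr (1 / q)"
      have T: "0 \<le> T" "T powr q = A * h" using q A real by (auto simp: T_def powr_powr)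
      have bT: "bdist \<Omega> w powr (3/4) * davg \<Omega> Du w \<le> T" if "w \<in> wide_cone K \<Omega> x" for w
      proof -
        have "ennreal ((bdist \<Omega> w powr (3/4) * davg \<Omega> Du w) powr q) \<le> ennreal (A * h)"
          using key[OF that] real A by (simp add: ennreal_mult)
        then have "(bdist \<Omega> w powr (3/4) * davg \<Omega> Du w) powr q \<le> T powr q"
          using A real by (subst (asm) ennreal_le_iff) (simp_all add: T)
        then show ?thesis using q T(1) davg_nonneg[of \<Omega> Du w]
          by (meson linorder_not_le powr_less_mono2)
      qed
      have "\<bar>bmean \<Omega> u y - bmean \<Omega> u ystar\<bar> \<le> C1 * (\<kappa> * T)"
      proof (rule KC(3)[OF \<kappa>(2)[OF w12] _ x _ y])
        show "0 \<le> \<kappa> * T" using \<kappa> T by simp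
        fix w assume "w \<in> wide_cone K1 \<Omega> x"
        then have "bdist \<Omega> w powr (3/4) * davg \<Omega> Du w \<le> T" using bT K(4) by blast
        then show "bdist \<Omega> w powr (3/4) * (\<kappa> * davg \<Omega> Du w) \<le> \<kappa> * T"
          using \<kappa>(1) by (simp add: mult.left_commute)
      qed
      then have "\<bar>bmean \<Omega> u y - bmean \<Omega> u ystar\<bar> powr q \<le> (C1 * (\<kappa> * T)) powr q"
        using q by (intro powr_mono2) auto
      also have "\<dots> = (C1 * \<kappa>) powr q * (A * h)"
        using KC \<kappa> T by (simp add: powr_mult mult.assoc)
      also have "\<dots> \<le> B * h"
        unfolding B_def mult.assoc using parts A real by (intro mult_right_mono) auto
      finally have e1: "\<bar>bmean \<Omega> u y - bmean \<Omega> u ystar\<bar> powr q \<le> B * h" .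
      have yin: "y \<in> \<Omega>" using y by (simp add: wide_cone_def)
      have "bdist \<Omega> y * davg \<Omega> Du y = bdist \<Omega> y powr (1/4) * (bdist \<Omega> y powr (3/4) * davg \<Omega> Du y)"
        by (rule powr_quarter_split[OF bdist_pos[OF dom yin], symmetric])
      also have "\<dots> \<le> L powr (1/4) * T"
        using bT[of y] y K(3) L(2)[OF yin] T bdist_nonneg[of \<Omega> y] davg_nonneg[of \<Omega> Du y]
        by (intro mult_mono powr_mono2) auto
      finally have "(bdist \<Omega> y * davg \<Omega> Du y) powr q \<le> (L powr (1/4) * T) powr q"
        using q bdist_nonneg[of \<Omega> y] davg_nonneg[of \<Omega> Du y] by (intro powr_mono2) auto
      also have "\<dots> = L powr (q / 4) * (A * h)" using T L by (simp add: powr_mult powr_powr)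
      also have "\<dots> \<le> B * h"
        unfolding B_def mult.assoc using parts A real by (intro mult_right_mono) auto
      finally have e2: "(bdist \<Omega> y * davg \<Omega> Du y) powr q \<le> B * h" .
      have "ennreal B * H0 x = ennreal (B * h)" using real B0 by (simp add: ennreal_mult)
      then show ?thesis using e1 e2 by (simp add: ennreal_leI)
    next
      case top
      then show ?thesis using B0 by (simp add: ennreal_mult_top)
    qed
    show "\<exists>H \<in> borel_measurable \<sigma>.
       (\<integral>\<^sup>+x. H x \<partial>\<sigma>) \<le> ennreal (B * (Cm * L powr (3 * q / 4))) * (\<integral>\<^sup>+x. epowr (nt_max \<Omega> Du x) q \<partial>\<sigma>) \<and>
       (\<forall>x\<in>frontier \<Omega>. \<forall>y\<in>wide_cone K0 \<Omega> x.
          ennreal (\<bar>bmean \<Omega> u y - bmean \<Omega> u ystar\<bar> powr q) \<le> H x \<and>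
          ennreal ((bdist \<Omega> y * davg \<Omega> Du y) powr q) \<le> H x)"
    proof (intro bexI conjI)
      have "(\<integral>\<^sup>+x. ennreal B * H0 x \<partial>\<sigma>) = ennreal B * (\<integral>\<^sup>+x. H0 x \<partial>\<sigma>)" by (rule nn_integral_cmult) measurable
      also have "\<dots> \<le> ennreal B * (ennreal (Cm * L powr (3 * q / 4)) * (\<integral>\<^sup>+x. epowr (nt_max \<Omega> Du x) q \<partial>\<sigma>))"
        by (intro mult_left_mono H0i) simp
      also have "\<dots> = ennreal (B * (Cm * L powr (3 * q / 4))) * (\<integral>\<^sup>+x. epowr (nt_max \<Omega> Du x) q \<partial>\<sigma>)"
        using B0 Cm by (simp add: ennreal_mult mult.assoc)
      finally show "(\<integral>\<^sup>+x. ennreal B * H0 x \<partial>\<sigma>) \<le> ennreal (B * (Cm * L powr (3 * q / 4))) * (\<integral>\<^sup>+x. epowr (nt_max \<Omega> Du x) q \<partial>\<sigma>)" .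
      show "\<forall>x\<in>frontier \<Omega>. \<forall>y\<in>wide_cone K0 \<Omega> x.
          ennreal (\<bar>bmean \<Omega> u y - bmean \<Omega> u ystar\<bar> powr q) \<le> ennreal B * H0 x \<and>
          ennreal ((bdist \<Omega> y * davg \<Omega> Du y) powr q) \<le> ennreal B * H0 x"
        using main by blast
    qed measurable
  qed
qed

end

section \<open>Traces\<close>

lemma C1_fun_bounded:
  assumes "C1_fun \<phi>" "bounded S"
  obtains B where "\<And>x. x \<in> S \<Longrightarrow> \<bar>\<phi> x\<bar> \<le> B" "\<And>x. x \<in> S \<Longrightarrow> norm (grad \<phi> x) \<le> B"
proof -
  have cl: "compact (closure S)" using assms(2) by simp
  have "bounded (\<phi> ` closure S)" "bounded (grad \<phi> ` closure S)"
    using C1_fun_continuous[OF assms(1)] assms(1) unfolding C1_fun_def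
    by (auto intro!: compact_imp_bounded compact_continuous_image cl intro: continuous_on_subset)
  then obtain B1 B2 where B: "\<And>x. x \<in> closure S \<Longrightarrow> norm (\<phi> x) \<le> B1" "\<And>x. x \<in> closure S \<Longrightarrow> norm (grad \<phi> x) \<le> B2"
    unfolding bounded_iff by auto
  show ?thesis
  proof (rule that[of "max B1 B2"])
    fix x assume "x \<in> S"
    then have "x \<in> closure S" using closure_subset by auto
    from B(1)[OF this] B(2)[OF this] show "\<bar>\<phi> x\<bar> \<le> max B1 B2" "norm (grad \<phi> x) \<le> max B1 B2" by auto
  qed
qed

lemma sqint_grad_finite:
  assumes "C1_fun \<phi>" "bounded \<Omega>" "open \<Omega>"
  shows "sqint \<Omega> (grad \<phi>) < \<infinity>"
proof -
  obtain B where B: "\<And>x. x \<in> \<Omega> \<Longrightarrow> norm (grad \<phi> x) \<le> B" by (rule C1_fun_bounded[OF assms(1,2)]) blast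
  have Om: "\<Omega> \<in> sets lebesgue" using assms(3) by auto
  have "sqint \<Omega> (grad \<phi>) \<le> (\<integral>\<^sup>+x. ennreal (B\<^sup>2) * indicator \<Omega> x \<partial>lebesgue)"
    unfolding sqint_set_integral[OF Om]
    using B by (intro nn_integral_mono) (auto simp: indicator_def intro!: ennreal_leI power_mono)
  also have "\<dots> = ennreal (B\<^sup>2) * emeasure lebesgue \<Omega>" using Om by (simp add: nn_integral_cmult_indicator)
  also have "\<dots> < \<infinity>" using emeasure_bounded_finite[OF assms(2)] assms(3) by (simp add: ennreal_mult_less_top)
  finally show ?thesis .
qed

lemma w12_C1_fun:
  assumes "C1_fun \<phi>" "bounded \<Omega>" "open \<Omega>"
  shows "w12 \<Omega> \<phi> (grad \<phi>)"
  unfolding w12_def using assms sqint_grad_finite[OF assms] C1_fun_borel[OF assms(1)]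
  by (auto intro!: borel_lebesgue_on exI[of _ "\<lambda>k. \<phi>"] simp: sqint_def)

context ahlfors_domain
begin

text \<open>The mean is additive only on integrable functions. On the ball \<phi> is bounded and
  \<phi> - u is square integrable, so u is integrable and the difference of the means is the mean of
  the difference.\<close>

lemma bmean_diff_le:
  assumes "C1_fun \<phi>" and u[measurable]: "u \<in> borel_measurable (lebesgue_on \<Omega>)" and fin: "sqint \<Omega> (\<lambda>x. \<phi> x - u x) < \<infinity>" and w: "w \<in> \<Omega>"
  shows "ennreal ((bmean \<Omega> \<phi> w - bmean \<Omega> u w)\<^sup>2 * measure lebesgue (wball \<Omega> w)) \<le> sqint \<Omega> (\<lambda>x. \<phi> x - u x)"
proof -
  define B where "B = wball \<Omega> w"
  have Bs: "B \<subseteq> \<Omega>" unfolding B_def by (rule wball_subset[OF w])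
  have Bm: "B \<in> sets lebesgue" by (simp add: B_def)
  have um[measurable]: "u \<in> borel_measurable (lebesgue_on B)" by (rule measurable_lebesgue_on_subset[OF u Bs])
  have pm[measurable]: "\<phi> \<in> borel_measurable (lebesgue_on B)" using C1_fun_borel[OF assms(1)] by (intro borel_lebesgue_on) auto
  interpret M: finite_measure "lebesgue_on B" unfolding B_def by (intro finite_measure_lebesgue_on) simp
  obtain b where b: "\<And>x. x \<in> B \<Longrightarrow> \<bar>\<phi> x\<bar> \<le> b" by (rule C1_fun_bounded[OF assms(1), of B]) (auto simp: B_def)
  have ip: "integrable (lebesgue_on B) \<phi>" using b by (intro M.integrable_const_bound[of _ b]) (use pm in auto)
  have sB: "sqint B (\<lambda>x. \<phi> x - u x) \<le> sqint \<Omega> (\<lambda>x. \<phi> x - u x)"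
    using Bs Bm open_dom by (intro sqint_mono_set) auto
  have "integrable (lebesgue_on B) (\<lambda>x. (\<phi> x - u x)\<^sup>2)"
    unfolding integrable_iff_bounded using sB fin by (auto simp: sqint_def intro: le_less_trans)
  then have id: "integrable (lebesgue_on B) (\<lambda>x. \<phi> x - u x)"
    by (rule M.square_integrable_imp_integrable[rotated]) measurable
  from Bochner_Integration.integrable_diff[OF ip id] have iu: "integrable (lebesgue_on B) u" by simp
  have "ennreal ((0 - mean_on B (\<lambda>x. \<phi> x - u x))\<^sup>2) * emeasure lebesgue B \<le> sqint B (\<lambda>x. 0 - (\<phi> x - u x))"
    unfolding B_def using bdist_pos[OF open_dom bounded_dom w]
    by (intro mean_on_square_le) (use um pm in \<open>auto simp: B_def\<close>)
  also have "sqint B (\<lambda>x. 0 - (\<phi> x - u x)) = sqint B (\<lambda>x. \<phi> x - u x)" by (simp add: sqint_commute[of B u])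
  also have "mean_on B (\<lambda>x. \<phi> x - u x) = bmean \<Omega> \<phi> w - bmean \<Omega> u w"
    using mean_on_diff[OF ip iu] by (simp add: bmean_def B_def)
  also have "ennreal ((0 - (bmean \<Omega> \<phi> w - bmean \<Omega> u w))\<^sup>2) * emeasure lebesgue B
     = ennreal ((bmean \<Omega> \<phi> w - bmean \<Omega> u w)\<^sup>2 * measure lebesgue B)"
    unfolding B_def wball_measure(1)[OF w] by (simp add: ennreal_mult power2_commute)
  finally show ?thesis using sB by (simp add: B_def)
qed

end

context robin_domain
begin

text \<open>The ball at \<open>Y j x\<close> shrinks to x with the scale, so continuity of \<phi> at
  x carries over to the means.\<close>

lemma bmean_tendsto:
  assumes "C1_fun \<phi>" "x \<in> frontier \<Omega>"
  shows "(\<lambda>j. bmean \<Omega> \<phi> (Y j x)) \<longlonglongrightarrow> \<phi> x"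
proof (rule metric_LIMSEQ_I)
  fix e :: real assume e: "0 < e"
  have "isCont \<phi> x" using C1_fun_continuous[OF assms(1)] by (simp add: continuous_on_eq_continuous_at)
  then obtain d where d: "0 < d" "\<And>z. dist z x < d \<Longrightarrow> dist (\<phi> z) (\<phi> x) < e / 2"
    unfolding continuous_at_eps_delta using e by (meson half_gt_zero)
  have "\<exists>N. (1/2::real) ^ N < d / (2 * D0)" using d(1) D0_pos by (intro real_arch_pow_inv) auto
  then obtain N where N: "2 * (D0 / 2 ^ N) < d" using D0_pos by (auto simp: field_simps power_one_over)
  show "\<exists>N. \<forall>j\<ge>N. dist (bmean \<Omega> \<phi> (Y j x)) (\<phi> x) < e"
  proof (intro exI allI impI)
    fix j assume j: "N \<le> j"
    have rj: "D0 / 2 ^ j \<le> D0 / 2 ^ N" using D0_pos j by (intro divide_left_mono) auto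
    define w where "w = Y j x"
    have w: "w \<in> \<Omega>" using Y_in[OF assms(2)] by (simp add: w_def)
    define B where "B = wball \<Omega> w"
    have near: "dist z x < d" if "z \<in> B" for z
    proof -
      have "dist z x \<le> dist w z + dist w x" by (metis dist_commute dist_triangle)
      also have "\<dots> \<le> bdist \<Omega> w / 4 + dist w x" using that by (simp add: B_def)
      finally show ?thesis
        using Y_bdist_le[OF assms(2), of j] Y_dist[OF assms(2), of j] N rj bdist_nonneg[of \<Omega> w] by (simp add: w_def)
    qed
    have V: "0 < measure lebesgue B" "emeasure lebesgue B = ennreal (measure lebesgue B)"
      using wball_measure[OF w] by (auto simp: B_def)
    have "ennreal ((\<phi> x - mean_on B \<phi>)\<^sup>2) * emeasure lebesgue B \<le> sqint B (\<lambda>z. \<phi> x - \<phi> z)"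
      unfolding B_def using C1_fun_borel[OF assms(1)] bdist_pos[OF ahlfors_domain.open_dom[OF ahlfors_domain_axioms] bounded_dom w]
      by (intro mean_on_square_le borel_lebesgue_on) auto
    also have "\<dots> \<le> (\<integral>\<^sup>+z. ennreal ((e/2)\<^sup>2) * indicator B z \<partial>lebesgue)"
    proof -
      have "(\<phi> x - \<phi> z)\<^sup>2 \<le> (e/2)\<^sup>2" if "z \<in> B" for z
        using d(2)[OF near[OF that]] e by (simp add: dist_real_def abs_le_square_iff[symmetric] abs_minus_commute)
      then show ?thesis
        by (subst sqint_set_integral) (auto simp: B_def indicator_def intro!: nn_integral_mono ennreal_leI)
    qed
    also have "\<dots> = ennreal ((e/2)\<^sup>2) * emeasure lebesgue B" by (simp add: nn_integral_cmult_indicator B_def)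
    finally have "ennreal ((\<phi> x - mean_on B \<phi>)\<^sup>2) \<le> ennreal ((e/2)\<^sup>2)"
      unfolding V(2) mult.commute[of _ "ennreal (measure lebesgue B)"] using V(1) by (subst (asm) ennreal_mult_le_mult_iff) auto
    then have "(\<phi> x - mean_on B \<phi>)\<^sup>2 \<le> (e/2)\<^sup>2" by (subst (asm) ennreal_le_iff) auto
    then have "\<bar>\<phi> x - mean_on B \<phi>\<bar> \<le> \<bar>e/2\<bar>" by (rule abs_le_square_iff[THEN iffD2])
    then show "dist (bmean \<Omega> \<phi> (Y j x)) (\<phi> x) < e" using e
      by (subst dist_commute) (simp add: dist_real_def bmean_def B_def w_def)
  qed
qed

text \<open>Letting j grow in the local chain estimate replaces the mean at \<open>Y j x\<close> by
  \<phi>(x). The squared weight is \<delta>^(3/2); divided by the volume \<delta>^n it is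
  \<delta>^(1/2 - (n-1)), so the majorant is taken with Lebesgue measure and a = 1/2. Only heights
  up to a multiple of \<open>D0 / 2 ^ J\<close> enter, which gives the decaying factor.\<close>

lemma boundary_value_C1:
  obtains C where "0 < C"
    "\<And>\<phi> J. C1_fun \<phi> \<Longrightarrow> \<exists>H \<in> borel_measurable \<sigma>.
       (\<integral>\<^sup>+x. H x \<partial>\<sigma>) \<le> ennreal (C * (D0 / 2 ^ J) powr (1/2)) * sqint \<Omega> (grad \<phi>) \<and>
       (\<forall>x\<in>frontier \<Omega>. ennreal ((\<phi> x - bmean \<Omega> \<phi> (Y J x))\<^sup>2) \<le> H x)"
proof -
  note dom = ahlfors_domain.open_dom[OF ahlfors_domain_axioms] bounded_dom
  obtain \<kappa> where \<kappa>: "0 < \<kappa>" "\<And>u Du. w12 \<Omega> u Du \<Longrightarrow> hop_potential \<Omega> (bmean \<Omega> u) (\<lambda>w. \<kappa> * davg \<Omega> Du w)"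
    by (rule hop_potential_w12[OF dom]) blast
  obtain K C1 where KC: "0 < K" "0 < C1"
    "\<And>\<rho> D T x J j. hop_potential \<Omega> \<rho> D \<Longrightarrow> 0 \<le> T \<Longrightarrow> x \<in> frontier \<Omega> \<Longrightarrow> J \<le> j \<Longrightarrow>
       (\<And>w. w \<in> wide_cone K \<Omega> x \<Longrightarrow> bdist \<Omega> w \<le> K * (D0 / 2 ^ J) \<Longrightarrow> bdist \<Omega> w powr (3/4) * D w \<le> T) \<Longrightarrow>
       \<bar>\<rho> (Y J x) - \<rho> (Y j x)\<bar> \<le> C1 * T"
    by (rule oscillation_in_wide_cone[OF ystar order_refl]) blast
  obtain Cm where Cm: "0 < Cm"
    "\<And>(M :: (real^'n) measure) h \<tau>. sigma_finite_measure M \<Longrightarrow> (\<lambda>x. x) \<in> borel_measurable M \<Longrightarrow>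
       h \<in> borel_measurable M \<Longrightarrow> 0 < \<tau> \<Longrightarrow>
       \<exists>H \<in> borel_measurable \<sigma>.
         (\<forall>x t. 0 < t \<longrightarrow> t \<le> \<tau> \<longrightarrow>
            ennreal (t powr (1/2 - real (CARD('n) - 1))) * (\<integral>\<^sup>+z. h z * indicator (ball x ((K + 1) * t)) z \<partial>M) \<le> H x) \<and>
         (\<integral>\<^sup>+x. H x \<partial>\<sigma>) \<le> ennreal (Cm * \<tau> powr (1/2)) * (\<integral>\<^sup>+z. h z \<partial>M)"
    by (rule dyadic_majorant[of "1/2" "K + 1"]) (use KC(1) in auto)
  define n where "n = CARD('n)"
  define v1 where "v1 = measure lebesgue (ball (0::real^'n) 1)"
  have v1: "0 < v1" using content_ball_pos[of 1 "0::real^'n"] by (simp add: v1_def)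
  \<comment> \<open>The reciprocal of the volume of a ball of radius 1/4, since \<open>davg\<close>
    averages over balls of radius \<delta>/4.\<close>
  define A where "A = 4 ^ n / v1"
  have A0: "0 < A" using v1 by (simp add: A_def)
  define E where "E = (C1 * \<kappa>)\<^sup>2 * A"
  have E0: "0 < E" using KC \<kappa> A0 by (simp add: E_def)
  show ?thesis
  proof (rule that[of "E * (Cm * K powr (1/2))"])
    show "0 < E * (Cm * K powr (1/2))" using E0 Cm KC by simp
    fix \<phi> :: "real^'n \<Rightarrow> real" and J :: nat
    assume \<phi>: "C1_fun \<phi>"
    have w12: "w12 \<Omega> \<phi> (grad \<phi>)" by (rule w12_C1_fun[OF \<phi> dom(2,1)])
    have fin: "sqint \<Omega> (grad \<phi>) < \<infinity>" by (rule sqint_grad_finite[OF \<phi> dom(2,1)])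
    define r where "r = D0 / 2 ^ J"
    have r0: "0 < r" "0 < K * r" using D0_pos KC by (auto simp: r_def)
    define h where "h z = ennreal ((norm (grad \<phi> z))\<^sup>2) * indicator \<Omega> z" for z
    have [measurable]: "grad \<phi> \<in> borel_measurable borel" "\<Omega> \<in> sets borel" using C1_fun_borel[OF \<phi>] dom by auto
    have hm: "h \<in> borel_measurable lborel" unfolding h_def by measurable
    have leb: "(\<integral>\<^sup>+z. f z \<partial>lebesgue) = (\<integral>\<^sup>+z. f z \<partial>lborel)" for f :: "real^'n \<Rightarrow> ennreal"
      by (rule nn_integral_completion)
    have hi: "(\<integral>\<^sup>+z. h z \<partial>lborel) = sqint \<Omega> (grad \<phi>)"
      using dom(1) by (subst sqint_set_integral) (auto simp: h_def[abs_def] leb)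
    have idl: "(\<lambda>x. x) \<in> borel_measurable (lborel :: (real^'n) measure)" by simp
    obtain H0 where H0[measurable]: "H0 \<in> borel_measurable \<sigma>"
      and H0b: "\<And>x t. 0 < t \<Longrightarrow> t \<le> K * r \<Longrightarrow>
            ennreal (t powr (1/2 - real (CARD('n) - 1))) * (\<integral>\<^sup>+z. h z * indicator (ball x ((K + 1) * t)) z \<partial>lborel) \<le> H0 x"
      and H0i: "(\<integral>\<^sup>+x. H0 x \<partial>\<sigma>) \<le> ennreal (Cm * (K * r) powr (1/2)) * (\<integral>\<^sup>+z. h z \<partial>lborel)"
      using Cm(2)[OF sigma_finite_lborel idl hm r0(2)] by blast
    have key: "ennreal ((bdist \<Omega> w powr (3/4) * davg \<Omega> (grad \<phi>) w)\<^sup>2) \<le> ennreal A * H0 x"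
      if wc: "w \<in> wide_cone K \<Omega> x" and wr: "bdist \<Omega> w \<le> K * r" for w x
    proof -
      define t where "t = bdist \<Omega> w"
      define D where "D = davg \<Omega> (grad \<phi>) w"
      have w: "w \<in> \<Omega>" "dist w x \<le> K * t" using wc by (auto simp: wide_cone_def t_def)
      have t: "0 < t" "t \<le> K * r" using bdist_pos[OF dom w(1)] wr by (auto simp: t_def)
      define B where "B = ball w (t / 4)"
      have VB: "measure lebesgue B = (t / 4) ^ n * v1"
        unfolding B_def v1_def n_def using content_ball_conv_unit_ball[of "t / 4" w] t(1) by simp
      define I where "I = (\<integral>\<^sup>+z. h z * indicator (ball x ((K + 1) * t)) z \<partial>lborel)"
      have "ennreal (D\<^sup>2 * measure lebesgue B) = sqint B (grad \<phi>)"
        unfolding B_def D_def t_def by (rule davg_square[OF dom w(1) fin, symmetric])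
      also have "\<dots> = (\<integral>\<^sup>+z. ennreal ((norm (grad \<phi> z))\<^sup>2) * indicator B z \<partial>lborel)"
        by (subst sqint_set_integral) (auto simp: B_def leb)
      also have "\<dots> \<le> I" unfolding I_def
      proof (rule nn_integral_mono)
        fix z
        have "z \<in> \<Omega> \<and> z \<in> ball x ((K + 1) * t)" if "z \<in> B"
        proof
          show "z \<in> \<Omega>" using that wball_subset[OF w(1)] by (auto simp: B_def t_def)
          have "dist x z \<le> dist w x + dist w z" by (metis dist_commute dist_triangle)
          also have "\<dots> < K * t + t" using that w(2) t(1) by (simp add: B_def)
          finally show "z \<in> ball x ((K + 1) * t)" by (simp add: distrib_right)
        qed
        then show "ennreal ((norm (grad \<phi> z))\<^sup>2) * indicator B z \<le> h z * indicator (ball x ((K + 1) * t)) z"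
          by (auto simp: h_def indicator_def)
      qed
      finally have b: "ennreal (D\<^sup>2 * ((t / 4) ^ n * v1)) \<le> I" by (simp only: VB)
      have "(t powr (3/4) * D)\<^sup>2 = A * (t powr (1/2 - real (n - 1)) * (D\<^sup>2 * ((t / 4) ^ n * v1)))"
      proof -
        have n1: "1 \<le> n" using dim by (simp add: n_def)
        have "(t powr (3/4))\<^sup>2 = t powr (3/2)" using t by (simp add: powr_realpow[symmetric] powr_powr del: powr_realpow)
        also have "\<dots> = t powr (1/2 - real (n - 1)) * t ^ n"
          using t n1 by (simp add: powr_realpow[symmetric] powr_add[symmetric] of_nat_diff del: powr_realpow)
        finally show ?thesis using v1 by (simp add: power_mult_distrib A_def power_divide)
      qed
      then have "ennreal ((t powr (3/4) * D)\<^sup>2) = ennreal A * (ennreal (t powr (1/2 - real (n - 1))) * ennreal (D\<^sup>2 * ((t / 4) ^ n * v1)))"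
        using A0 v1 t by (simp only:) (simp add: ennreal_mult)
      also have "\<dots> \<le> ennreal A * (ennreal (t powr (1/2 - real (n - 1))) * I)" by (intro mult_left_mono b) auto
      also have "\<dots> \<le> ennreal A * H0 x"
        unfolding I_def n_def by (intro mult_left_mono H0b t) auto
      finally show ?thesis by (simp add: t_def D_def)
    qed
    have main: "ennreal ((\<phi> x - bmean \<Omega> \<phi> (Y J x))\<^sup>2) \<le> ennreal E * H0 x" if x: "x \<in> frontier \<Omega>" for x
    proof (cases "H0 x")
      case (real h)
      define T where "T = sqrt (A * h)"
      have T: "0 \<le> T" "T\<^sup>2 = A * h" using real A0 by (auto simp: T_def)
      have bT: "bdist \<Omega> w powr (3/4) * davg \<Omega> (grad \<phi>) w \<le> T" if "w \<in> wide_cone K \<Omega> x" "bdist \<Omega> w \<le> K * r" for w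
      proof -
        have "ennreal ((bdist \<Omega> w powr (3/4) * davg \<Omega> (grad \<phi>) w)\<^sup>2) \<le> ennreal (A * h)"
          using key[OF that] real A0 by (simp add: ennreal_mult)
        then have "(bdist \<Omega> w powr (3/4) * davg \<Omega> (grad \<phi>) w)\<^sup>2 \<le> T\<^sup>2"
          using A0 real by (subst (asm) ennreal_le_iff) (simp_all add: T)
        then show ?thesis using T(1) by (rule power2_le_imp_le)
      qed
      have "\<bar>bmean \<Omega> \<phi> (Y J x) - bmean \<Omega> \<phi> (Y j x)\<bar> \<le> C1 * (\<kappa> * T)" if "J \<le> j" for j
      proof (rule KC(3)[OF \<kappa>(2)[OF w12] _ x that])
        show "0 \<le> \<kappa> * T" using \<kappa> T by simp
        fix w assume "w \<in> wide_cone K \<Omega> x" "bdist \<Omega> w \<le> K * (D0 / 2 ^ J)"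
        then have "bdist \<Omega> w powr (3/4) * davg \<Omega> (grad \<phi>) w \<le> T" by (intro bT) (auto simp: r_def)
        then show "bdist \<Omega> w powr (3/4) * (\<kappa> * davg \<Omega> (grad \<phi>) w) \<le> \<kappa> * T"
          using \<kappa>(1) by (simp add: mult.left_commute)
      qed
      moreover have "(\<lambda>j. \<bar>bmean \<Omega> \<phi> (Y J x) - bmean \<Omega> \<phi> (Y j x)\<bar>) \<longlonglongrightarrow> \<bar>bmean \<Omega> \<phi> (Y J x) - \<phi> x\<bar>"
        by (intro tendsto_intros bmean_tendsto \<phi> x)
      ultimately have "\<bar>bmean \<Omega> \<phi> (Y J x) - \<phi> x\<bar> \<le> C1 * (\<kappa> * T)"
        by (intro LIMSEQ_le_const2) auto
      then have "\<bar>\<phi> x - bmean \<Omega> \<phi> (Y J x)\<bar> ^ 2 \<le> (C1 * (\<kappa> * T))\<^sup>2"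
        by (intro power_mono) (auto simp: abs_minus_commute)
      also have "\<dots> = E * h" by (simp add: E_def power_mult_distrib T)
      finally show ?thesis using real E0 by (simp add: ennreal_mult[symmetric] ennreal_leI)
    next
      case top
      then show ?thesis using E0 by (simp add: ennreal_mult_top)
    qed
    show "\<exists>H \<in> borel_measurable \<sigma>.
       (\<integral>\<^sup>+x. H x \<partial>\<sigma>) \<le> ennreal (E * (Cm * K powr (1/2)) * (D0 / 2 ^ J) powr (1/2)) * sqint \<Omega> (grad \<phi>) \<and>
       (\<forall>x\<in>frontier \<Omega>. ennreal ((\<phi> x - bmean \<Omega> \<phi> (Y J x))\<^sup>2) \<le> H x)"
    proof (intro bexI conjI ballI)
      have "(\<integral>\<^sup>+x. ennreal E * H0 x \<partial>\<sigma>) = ennreal E * (\<integral>\<^sup>+x. H0 x \<partial>\<sigma>)" by (rule nn_integral_cmult) measurable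
      also have "\<dots> \<le> ennreal E * (ennreal (Cm * (K * r) powr (1/2)) * (\<integral>\<^sup>+z. h z \<partial>lborel))"
        by (intro mult_left_mono H0i) simp
      also have "\<dots> = ennreal (E * (Cm * (K * r) powr (1/2))) * sqint \<Omega> (grad \<phi>)"
        using E0 Cm by (simp add: ennreal_mult mult.assoc hi)
      also have "E * (Cm * (K * r) powr (1/2)) = E * (Cm * K powr (1/2)) * (D0 / 2 ^ J) powr (1/2)"
        using KC r0 unfolding r_def[symmetric] by (simp add: powr_mult mult.assoc)
      finally show "(\<integral>\<^sup>+x. ennreal E * H0 x \<partial>\<sigma>) \<le> ennreal (E * (Cm * K powr (1/2)) * (D0 / 2 ^ J) powr (1/2)) * sqint \<Omega> (grad \<phi>)" .
    qed (use main in measurable)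
  qed
qed

end

text \<open>Turns smallness in mean square into smallness of an integral over a finite measure: the
  constant e is small, and for fixed e the other term is controlled by the integral of the
  square.\<close>

lemma le_add_square_div:
  fixes a e :: real
  assumes "0 < e" "0 \<le> a"
  shows "a \<le> e + a\<^sup>2 / e"
proof (cases "a \<le> e")
  case True
  then show ?thesis using assms by (simp add: add_increasing2)
next
  case False
  then have "a * e \<le> a * a" using assms by (intro mult_left_mono) auto
  then have "a \<le> a\<^sup>2 / e" using assms by (simp add: field_simps power2_eq_square)
  then show ?thesis using assms by simp
qed

lemma ennreal_tendsto_multc:
  fixes f :: "'a \<Rightarrow> ennreal"
  assumes "c < top" "(f \<longlongrightarrow> x) F"
  shows "((\<lambda>k. f k * c) \<longlongrightarrow> x * c) F"
  using ennreal_tendsto_cmult[OF assms] by (simp add: mult.commute)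

context robin_domain
begin

text \<open>The difference of g and the mean at \<open>ystar\<close> is split through \<phi>_k(x)
  and the means of \<phi>_k and of u at \<open>Y J x\<close>. The limits have a forced order: the
  third difference is divided by the ball volume \<open>m J\<close>, which shrinks with the scale,
  so k grows first with J fixed, then J grows, and the parameter d goes to 0 last.\<close>

lemma trace_oscillation:
  obtains C where "0 < C"
    "\<And>u Du g \<phi>. w12 \<Omega> u Du \<Longrightarrow> (\<And>k. C1_fun (\<phi> k)) \<Longrightarrow> (\<lambda>k::nat. sqint \<Omega> (\<lambda>x. \<phi> k x - u x)) \<longlonglongrightarrow> 0 \<Longrightarrow>
       (\<lambda>k. sqint \<Omega> (\<lambda>x. grad (\<phi> k) x - Du x)) \<longlonglongrightarrow> 0 \<Longrightarrow> g \<in> borel_measurable \<sigma> \<Longrightarrow>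
       (\<lambda>k. \<integral>\<^sup>+x. ennreal ((\<phi> k x - g x)\<^sup>2) \<partial>\<sigma>) \<longlonglongrightarrow> 0 \<Longrightarrow>
       (\<integral>\<^sup>+x. ennreal \<bar>g x - bmean \<Omega> u ystar\<bar> \<partial>\<sigma>) \<le> ennreal C * (\<integral>\<^sup>+x. nt_max \<Omega> Du x \<partial>\<sigma>)"
proof -
  note dom = ahlfors_domain.open_dom[OF ahlfors_domain_axioms] bounded_dom
  have c1: "0 \<le> 1 / c" using c_pos by simp
  obtain C where C: "0 < C"
    "\<And>u Du. w12 \<Omega> u Du \<Longrightarrow> \<exists>H \<in> borel_measurable \<sigma>.
       (\<integral>\<^sup>+x. H x \<partial>\<sigma>) \<le> ennreal C * (\<integral>\<^sup>+x. epowr (nt_max \<Omega> Du x) 1 \<partial>\<sigma>) \<and>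
       (\<forall>x\<in>frontier \<Omega>. \<forall>y\<in>wide_cone (1 / c) \<Omega> x.
          ennreal (\<bar>bmean \<Omega> u y - bmean \<Omega> u ystar\<bar> powr 1) \<le> H x \<and>
          ennreal ((bdist \<Omega> y * davg \<Omega> Du y) powr 1) \<le> H x)"
    by (rule oscillation_nt_max[OF zero_less_one c1]) blast
  obtain C7 where C7: "0 < C7"
    "\<And>\<phi> J. C1_fun \<phi> \<Longrightarrow> \<exists>H \<in> borel_measurable \<sigma>.
       (\<integral>\<^sup>+x. H x \<partial>\<sigma>) \<le> ennreal (C7 * (D0 / 2 ^ J) powr (1/2)) * sqint \<Omega> (grad \<phi>) \<and>
       (\<forall>x\<in>frontier \<Omega>. ennreal ((\<phi> x - bmean \<Omega> \<phi> (Y J x))\<^sup>2) \<le> H x)"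
    by (rule boundary_value_C1) blast
  define v1 where "v1 = measure lebesgue (ball (0::real^'n) 1)"
  have v1: "0 < v1" using content_ball_pos[of 1 "0::real^'n"] by (simp add: v1_def)
  \<comment> \<open>A lower bound for the volume of the ball at \<open>Y J x\<close>, uniform in
    x.\<close>
  define m where "m J = (c * (D0 / 2 ^ J) / 4) ^ CARD('n) * v1" for J :: nat
  have m0: "0 < m J" for J using c_pos D0_pos v1 by (simp add: m_def)
  have mV: "m J \<le> measure lebesgue (wball \<Omega> (Y J x))" if "x \<in> frontier \<Omega>" for J x
  proof -
    have "m J \<le> (bdist \<Omega> (Y J x) / 4) ^ CARD('n) * v1"
      unfolding m_def using Y_bdist[OF that, of J] c_pos D0_pos v1 by (intro mult_right_mono power_mono) auto
    also have "\<dots> = measure lebesgue (wball \<Omega> (Y J x))"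
      using content_ball_conv_unit_ball[of "bdist \<Omega> (Y J x) / 4" "Y J x"] bdist_nonneg[of \<Omega> "Y J x"] by (simp add: v1_def)
    finally show ?thesis .
  qed
  define S where "S = emeasure \<sigma> (frontier \<Omega>)"
  have S: "S < \<infinity>" unfolding S_def by (rule surface_finite)
  show ?thesis
  proof (rule that[OF C(1)])
    fix u Du g and \<phi> :: "nat \<Rightarrow> real^'n \<Rightarrow> real"
    assume w12: "w12 \<Omega> u Du" and \<phi>: "\<And>k. C1_fun (\<phi> k)" and l1: "(\<lambda>k. sqint \<Omega> (\<lambda>x. \<phi> k x - u x)) \<longlonglongrightarrow> 0"
      and l2: "(\<lambda>k. sqint \<Omega> (\<lambda>x. grad (\<phi> k) x - Du x)) \<longlonglongrightarrow> 0" and g[measurable]: "g \<in> borel_measurable \<sigma>"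
      and l3: "(\<lambda>k. \<integral>\<^sup>+x. ennreal ((\<phi> k x - g x)\<^sup>2) \<partial>\<sigma>) \<longlonglongrightarrow> 0"
    define \<rho> where "\<rho> = bmean \<Omega> u ystar"
    define X where "X = (\<integral>\<^sup>+x. ennreal \<bar>g x - \<rho>\<bar> \<partial>\<sigma>)"
    define NN where "NN = ennreal C * (\<integral>\<^sup>+x. nt_max \<Omega> Du x \<partial>\<sigma>)"
    define e where "e k = sqint \<Omega> (\<lambda>x. \<phi> k x - u x)" for k
    define e' where "e' k = sqint \<Omega> (\<lambda>x. grad (\<phi> k) x - Du x)" for k
    define E where "E k = (\<integral>\<^sup>+x. ennreal ((\<phi> k x - g x)\<^sup>2) \<partial>\<sigma>)" for k
    define G where "G = sqint \<Omega> Du"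
    have G: "G < \<infinity>" using w12 by (simp add: w12_def G_def)
    have um: "u \<in> borel_measurable (lebesgue_on \<Omega>)" "Du \<in> borel_measurable (lebesgue_on \<Omega>)" using w12 by (auto simp: w12_def)
    have [measurable]: "\<phi> k \<in> borel_measurable \<sigma>" for k using C1_fun_borel[OF \<phi>] borel_surface by blast
    obtain H where H[measurable]: "H \<in> borel_measurable \<sigma>" and Hi: "(\<integral>\<^sup>+x. H x \<partial>\<sigma>) \<le> NN"
      and Hb: "\<And>x y. x \<in> frontier \<Omega> \<Longrightarrow> y \<in> wide_cone (1 / c) \<Omega> x \<Longrightarrow> ennreal \<bar>bmean \<Omega> u y - \<rho>\<bar> \<le> H x"
      using C(2)[OF w12] by (auto simp: NN_def \<rho>_def)
    define bound where "bound d J k = ennreal (3 * d) * S + ennreal (1 / d) *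
       (E k + ennreal (C7 * (D0 / 2 ^ J) powr (1/2)) * (2 * e' k + 2 * G) + ennreal (1 / m J) * e k * S) + NN" for d J k
    have step: "X \<le> bound d J k" if d: "0 < d" and ek: "e k < \<infinity>" for d J k
    proof -
      obtain H7 where H7[measurable]: "H7 \<in> borel_measurable \<sigma>"
        and H7i: "(\<integral>\<^sup>+x. H7 x \<partial>\<sigma>) \<le> ennreal (C7 * (D0 / 2 ^ J) powr (1/2)) * sqint \<Omega> (grad (\<phi> k))"
        and H7b: "\<And>x. x \<in> frontier \<Omega> \<Longrightarrow> ennreal ((\<phi> k x - bmean \<Omega> (\<phi> k) (Y J x))\<^sup>2) \<le> H7 x"
        using C7(2)[OF \<phi>, of J k] by blast
      have "X \<le> (\<integral>\<^sup>+x. ennreal (3 * d) + ennreal (1 / d) * (ennreal ((\<phi> k x - g x)\<^sup>2) + H7 x + ennreal (1 / m J) * e k) + H x \<partial>\<sigma>)"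
        unfolding X_def
      proof (rule nn_integral_mono)
        fix x assume "x \<in> space \<sigma>"
        then have x: "x \<in> frontier \<Omega>" by simp
        define w where "w = Y J x"
        have w: "w \<in> \<Omega>" "w \<in> wide_cone (1 / c) \<Omega> x"
          using Y_in[OF x] Y_wide_cone[OF x] by (auto simp: w_def wide_cone_def)
        define a1 where "a1 = \<bar>\<phi> k x - g x\<bar>"
        define a2 where "a2 = \<bar>\<phi> k x - bmean \<Omega> (\<phi> k) w\<bar>"
        define a3 where "a3 = \<bar>bmean \<Omega> (\<phi> k) w - bmean \<Omega> u w\<bar>"
        define a4 where "a4 = \<bar>bmean \<Omega> u w - \<rho>\<bar>"
        have a3: "ennreal (a3\<^sup>2) \<le> ennreal (1 / m J) * e k"
        proof -
          have "ennreal (m J * a3\<^sup>2) \<le> ennreal ((bmean \<Omega> (\<phi> k) w - bmean \<Omega> u w)\<^sup>2 * measure lebesgue (wball \<Omega> w))"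
            unfolding a3_def power2_abs mult.commute[of "m J"] w_def by (intro ennreal_leI mult_left_mono mV[OF x]) simp
          also have "\<dots> \<le> e k" unfolding e_def by (rule bmean_diff_le[OF \<phi> um(1) _ w(1)]) (use ek in \<open>simp add: e_def\<close>)
          finally have "ennreal (1 / m J) * ennreal (m J * a3\<^sup>2) \<le> ennreal (1 / m J) * e k" by (rule mult_left_mono) simp
          then show ?thesis using m0[of J] by (simp add: ennreal_mult[symmetric])
        qed
        have "\<bar>g x - \<rho>\<bar> \<le> a1 + a2 + a3 + a4" unfolding a1_def a2_def a3_def a4_def by linarith
        also have "\<dots> \<le> (d + a1\<^sup>2 / d) + (d + a2\<^sup>2 / d) + (d + a3\<^sup>2 / d) + a4"
          by (intro add_mono le_add_square_div d order_refl) (auto simp: a1_def a2_def a3_def)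
        also have "\<dots> = 3 * d + 1 / d * (a1\<^sup>2 + a2\<^sup>2 + a3\<^sup>2) + a4" by (simp add: add_divide_distrib)
        finally have "ennreal \<bar>g x - \<rho>\<bar> \<le> ennreal (3 * d + 1 / d * (a1\<^sup>2 + a2\<^sup>2 + a3\<^sup>2) + a4)" by (rule ennreal_leI)
        also have "\<dots> = ennreal (3 * d) + ennreal (1 / d) * (ennreal (a1\<^sup>2) + ennreal (a2\<^sup>2) + ennreal (a3\<^sup>2)) + ennreal a4"
          using d by (subst ennreal_plus ennreal_mult | simp add: a4_def)+
        also have "\<dots> \<le> ennreal (3 * d) + ennreal (1 / d) * (ennreal ((\<phi> k x - g x)\<^sup>2) + H7 x + ennreal (1 / m J) * e k) + H x"
          using H7b[OF x] Hb[OF x w(2)] a3 unfolding a1_def a2_def a4_def w_def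
          by (intro add_mono mult_left_mono order_refl) auto
        finally show "ennreal \<bar>g x - \<rho>\<bar> \<le> ennreal (3 * d) + ennreal (1 / d) * (ennreal ((\<phi> k x - g x)\<^sup>2) + H7 x + ennreal (1 / m J) * e k) + H x" .
      qed
      also have "\<dots> = ennreal (3 * d) * S + ennreal (1 / d) * (E k + (\<integral>\<^sup>+x. H7 x \<partial>\<sigma>) + ennreal (1 / m J) * e k * S) + (\<integral>\<^sup>+x. H x \<partial>\<sigma>)"
        unfolding E_def by (simp add: nn_integral_add nn_integral_cmult S_def)
      also have "\<dots> \<le> bound d J k" unfolding bound_def
      proof (intro add_mono mult_left_mono order_refl Hi order_trans[OF H7i])
        have "sqint \<Omega> (\<lambda>x. grad (\<phi> k) x - 0) \<le> 2 * sqint \<Omega> (\<lambda>x. grad (\<phi> k) x - Du x) + 2 * sqint \<Omega> (\<lambda>x. Du x - 0)"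
          using um C1_fun_borel[OF \<phi>] by (intro sqint_triangle) (auto intro: borel_lebesgue_on)
        then show "sqint \<Omega> (grad (\<phi> k)) \<le> 2 * e' k + 2 * G" by (simp add: e'_def G_def)
      qed auto
      finally show ?thesis .
    qed
    \<comment> \<open>Comparing the means of \<phi>_k and u requires a finite \<open>e k\<close>,
      which convergence to 0 guarantees for large k.\<close>
    have fin: "\<forall>\<^sub>F k in sequentially. e k < \<infinity>"
      using order_tendstoD(2)[OF l1, of "\<infinity>"] by (simp add: e_def)
    have stepJ: "X \<le> ennreal (3 * d) * S + ennreal (1 / d) * (ennreal (C7 * (D0 / 2 ^ J) powr (1/2)) * (2 * G)) + NN" if d: "0 < d" for d J
    proof -
      have "(\<lambda>k. bound d J k) \<longlonglongrightarrow> ennreal (3 * d) * S + ennreal (1 / d) *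
        (0 + ennreal (C7 * (D0 / 2 ^ J) powr (1/2)) * (2 * 0 + 2 * G) + ennreal (1 / m J) * 0 * S) + NN"
        unfolding bound_def using S
        by (intro tendsto_add ennreal_tendsto_cmult ennreal_tendsto_multc tendsto_const l1[folded e_def] l2[folded e'_def] l3[folded E_def]) auto
      then have "X \<le> ennreal (3 * d) * S + ennreal (1 / d) *
        (0 + ennreal (C7 * (D0 / 2 ^ J) powr (1/2)) * (2 * 0 + 2 * G) + ennreal (1 / m J) * 0 * S) + NN"
        by (rule tendsto_lowerbound[OF _ eventually_mono[OF fin step[OF d]]]) auto
      then show ?thesis by simp
    qed
    have stepd: "X \<le> ennreal (3 * d) * S + NN" if d: "0 < d" for d
    proof -
      have "(\<lambda>J. D0 * (1/2) ^ J) \<longlonglongrightarrow> D0 * 0" by (intro tendsto_intros LIMSEQ_realpow_zero) auto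
      then have "(\<lambda>J. D0 / 2 ^ J) \<longlonglongrightarrow> 0" by (simp add: power_one_over)
      from tendsto_powr2[OF this tendsto_const, of "1/2"]
      have "(\<lambda>J. (D0 / 2 ^ J) powr (1/2)) \<longlonglongrightarrow> 0" using D0_pos by (simp add: always_eventually)
      then have "(\<lambda>J. C7 * (D0 / 2 ^ J) powr (1/2)) \<longlonglongrightarrow> C7 * 0" by (intro tendsto_intros)
      then have "(\<lambda>J. ennreal (C7 * (D0 / 2 ^ J) powr (1/2))) \<longlonglongrightarrow> ennreal (C7 * 0)" by (rule tendsto_ennrealI)
      then have "(\<lambda>J. ennreal (3 * d) * S + ennreal (1 / d) * (ennreal (C7 * (D0 / 2 ^ J) powr (1/2)) * (2 * G)) + NN)
          \<longlonglongrightarrow> ennreal (3 * d) * S + ennreal (1 / d) * (ennreal (C7 * 0) * (2 * G)) + NN"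
        using G by (intro tendsto_add ennreal_tendsto_cmult ennreal_tendsto_multc tendsto_const) (auto simp: ennreal_mult_less_top)
      then have "X \<le> ennreal (3 * d) * S + ennreal (1 / d) * (ennreal (C7 * 0) * (2 * G)) + NN"
        by (rule LIMSEQ_le_const) (use stepJ[OF d] in auto)
      then show ?thesis by simp
    qed
    have "(\<lambda>i. 3 * (1 / real (Suc i))) \<longlonglongrightarrow> 3 * 0" by (intro tendsto_intros LIMSEQ_Suc[OF lim_1_over_n])
    then have "(\<lambda>i. ennreal (3 * (1 / real (Suc i)))) \<longlonglongrightarrow> ennreal (3 * 0)" by (rule tendsto_ennrealI)
    then have "(\<lambda>i. ennreal (3 * (1 / real (Suc i))) * S + NN) \<longlonglongrightarrow> ennreal (3 * 0) * S + NN"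
      using S by (intro tendsto_add ennreal_tendsto_multc tendsto_const) auto
    then have "X \<le> ennreal (3 * 0) * S + NN"
      by (rule LIMSEQ_le_const) (use stepd[of "1 / real (Suc _)"] in auto)
    then show "(\<integral>\<^sup>+x. ennreal \<bar>g x - bmean \<Omega> u ystar\<bar> \<partial>\<sigma>) \<le> ennreal C * (\<integral>\<^sup>+x. nt_max \<Omega> Du x \<partial>\<sigma>)"
      by (simp add: X_def NN_def \<rho>_def)
  qed
qed

end

section \<open>Smooth test functions\<close>

lemma Ck_Suc_imp: "Ck (Suc k) \<phi> \<Longrightarrow> Ck k \<phi>"
proof (induction k arbitrary: \<phi>)
  case 0
  then show ?case
    by (auto intro!: continuous_at_imp_continuous_on differentiable_imp_continuous_within)
next
  case (Suc k)
  have "(\<forall>x. \<phi> differentiable (at x)) \<and> (\<forall>i. Ck (Suc k) (\<lambda>x. grad \<phi> x $ i))"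
    using Suc.prems unfolding Ck.simps(2)[of "Suc k"] .
  then have d: "\<forall>x. \<phi> differentiable (at x)" "\<And>i. Ck (Suc k) (\<lambda>x. grad \<phi> x $ i)" by blast+
  have "\<forall>i. Ck k (\<lambda>x. grad \<phi> x $ i)" using Suc.IH[OF d(2)] by blast
  with d(1) show ?case by (simp only: Ck.simps(2) simp_thms)
qed

lemma Ck_SucI:
  assumes "\<And>x. (\<phi> has_derivative (\<lambda>h. v x \<bullet> h)) (at x)" "\<And>i. Ck k (\<lambda>x. v x $ i)"
  shows "Ck (Suc k) \<phi>"
proof -
  have "grad \<phi> = v" using grad_eqI[OF assms(1)] by blast
  then show ?thesis using assms by (auto simp: differentiable_def)
qed

lemma Ck_const: "Ck k (\<lambda>x :: real^'n. a)"
proof (induction k arbitrary: a)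
  case (Suc k)
  show ?case by (rule Ck_SucI[where v = "\<lambda>x. 0"]) (use Suc in auto)
qed simp

lemma Ck_SucD:
  assumes "Ck (Suc k) \<phi>"
  shows "(\<phi> has_derivative (\<lambda>h. grad \<phi> x \<bullet> h)) (at x)" "Ck k (\<lambda>x. grad \<phi> x $ i)" "Ck k \<phi>"
proof -
  show "(\<phi> has_derivative (\<lambda>h. grad \<phi> x \<bullet> h)) (at x)"
    by (rule grad_has_derivative) (use assms in simp)
  show "Ck k (\<lambda>x. grad \<phi> x $ i)" using assms by simp
  show "Ck k \<phi>" by (rule Ck_Suc_imp[OF assms])
qed

lemma Ck_add: "Ck k f \<Longrightarrow> Ck k g \<Longrightarrow> Ck k (\<lambda>x. f x + g x)"
proof (induction k arbitrary: f g)
  case (Suc k)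
  show ?case
  proof (rule Ck_SucI[where v = "\<lambda>x. grad f x + grad g x"])
    show "((\<lambda>x. f x + g x) has_derivative (\<lambda>h. (grad f x + grad g x) \<bullet> h)) (at x)" for x
      unfolding inner_add_left
      by (rule has_derivative_add[OF Ck_SucD(1)[OF Suc.prems(1)] Ck_SucD(1)[OF Suc.prems(2)]])
    show "Ck k (\<lambda>x. (grad f x + grad g x) $ i)" for i
      using Suc.IH[OF Ck_SucD(2)[OF Suc.prems(1)] Ck_SucD(2)[OF Suc.prems(2)]] by simp
  qed
qed (auto intro: continuous_intros)

lemma Ck_mult: "Ck k f \<Longrightarrow> Ck k g \<Longrightarrow> Ck k (\<lambda>x. f x * g x)"
proof (induction k arbitrary: f g)
  case (Suc k)
  show ?case
  proof (rule Ck_SucI[where v = "\<lambda>x. f x *\<^sub>R grad g x + g x *\<^sub>R grad f x"])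
    show "((\<lambda>x. f x * g x) has_derivative (\<lambda>h. (f x *\<^sub>R grad g x + g x *\<^sub>R grad f x) \<bullet> h)) (at x)" for x
      by (rule has_derivative_eq_rhs[OF has_derivative_mult[OF Ck_SucD(1)[OF Suc.prems(1)] Ck_SucD(1)[OF Suc.prems(2)]]])
         (simp add: inner_add_left fun_eq_iff)
    show "Ck k (\<lambda>x. (f x *\<^sub>R grad g x + g x *\<^sub>R grad f x) $ i)" for i
      using Ck_add[OF Suc.IH[OF Ck_SucD(3)[OF Suc.prems(1)] Ck_SucD(2)[OF Suc.prems(2)]]
          Suc.IH[OF Ck_SucD(3)[OF Suc.prems(2)] Ck_SucD(2)[OF Suc.prems(1)]]] by simp
  qed
qed (auto intro: continuous_intros)

lemma has_derivative_compose_real: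
  assumes "(F has_derivative (\<lambda>v. w \<bullet> v)) (at x)" "(h has_real_derivative h') (at (F x))"
  shows "((\<lambda>x. h (F x)) has_derivative (\<lambda>v. (h' *\<^sub>R w) \<bullet> v)) (at x)"
  using has_derivative_compose[OF assms(1) assms(2)[unfolded has_field_derivative_def]] by simp

text \<open>A function of one variable is smooth as soon as it lies in a class closed under
  differentiation; this avoids iterated derivatives.\<close>

lemma Ck_compose:
  fixes F :: "real^'n \<Rightarrow> real"
  assumes closed: "\<And>h. h \<in> H \<Longrightarrow> \<exists>h'\<in>H. \<forall>t. (h has_real_derivative h' t) (at t)"
  shows "h \<in> H \<Longrightarrow> Ck k F \<Longrightarrow> Ck k (\<lambda>x. h (F x))"
proof (induction k arbitrary: h)
  case 0
  from closed[OF 0(1)] have "continuous_on UNIV h"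
    by (auto intro!: continuous_at_imp_continuous_on DERIV_isCont)
  then show ?case using 0(2) by (auto intro: continuous_on_compose2)
next
  case (Suc k)
  obtain h' where h': "h' \<in> H" "\<And>t. (h has_real_derivative h' t) (at t)" using closed[OF Suc.prems(1)] by blast
  show ?case
  proof (rule Ck_SucI[where v = "\<lambda>x. h' (F x) *\<^sub>R grad F x"])
    show "((\<lambda>x. h (F x)) has_derivative (\<lambda>v. (h' (F x) *\<^sub>R grad F x) \<bullet> v)) (at x)" for x
      by (rule has_derivative_compose_real[OF Ck_SucD(1)[OF Suc.prems(2)] h'(2)])
    show "Ck k (\<lambda>x. (h' (F x) *\<^sub>R grad F x) $ i)" for i
      using Ck_mult[OF Suc.IH[OF h'(1) Ck_SucD(3)[OF Suc.prems(2)]] Ck_SucD(2)[OF Suc.prems(2), of i]] by simp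
  qed
qed

lemma test_functions_C1_fun:
  assumes "\<phi> \<in> test_functions U"
  shows "C1_fun \<phi>"
proof -
  have "Ck (Suc 0) \<phi>" using assms by (simp only: test_functions_def mem_Collect_eq)
  then have d: "\<forall>x. \<phi> differentiable (at x)" "\<And>i. continuous_on UNIV (\<lambda>x. grad \<phi> x $ i)" by auto
  have "continuous_on UNIV (\<lambda>x. \<chi> i. grad \<phi> x $ i)" by (intro continuous_on_vec_lambda d(2))
  then show ?thesis using d(1) by (simp add: C1_fun_def)
qed

text \<open>\<open>h 0 = 0\<close> keeps the support inside that of \<phi>, hence compact.\<close>

lemma test_functions_compose:
  fixes \<phi> :: "real^'n \<Rightarrow> real"
  assumes "\<And>h. h \<in> H \<Longrightarrow> \<exists>h'\<in>H. \<forall>t. (h has_real_derivative h' t) (at t)" "h \<in> H" "h 0 = 0"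
    and \<phi>: "\<phi> \<in> test_functions UNIV"
  shows "(\<lambda>x. h (\<phi> x)) \<in> test_functions UNIV"
proof -
  have "Ck k (\<lambda>x. h (\<phi> x))" for k
    by (rule Ck_compose[OF assms(1,2)]) (use \<phi> in \<open>auto simp: test_functions_def\<close>)
  moreover have "closure {x. h (\<phi> x) \<noteq> 0} \<subseteq> closure {x. \<phi> x \<noteq> 0}"
    using assms(3) by (intro closure_mono) auto
  then have "compact (closure {x. h (\<phi> x) \<noteq> 0})"
    using \<phi> compact_Int_closed[of "closure {x. \<phi> x \<noteq> 0}" "closure {x. h (\<phi> x) \<noteq> 0}"]
    by (simp add: test_functions_def Int_absorb1)
  ultimately show ?thesis by (simp add: test_functions_def)
qed

section \<open>The truncation\<close>

lemma tanh_scaled_derivative: "((\<lambda>t. tanh (m * t)) has_real_derivative m * (1 - (tanh (m * t))\<^sup>2)) (at (t::real))"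
  by (auto intro!: derivative_eq_intros)

text \<open>The derivative of tanh is 1 - tanh^2, so the polynomials in tanh(m t) form a class
  closed under differentiation.\<close>

lemma test_functions_tanh:
  fixes \<phi> :: "real^'n \<Rightarrow> real"
  assumes "\<phi> \<in> test_functions UNIV"
  shows "(\<lambda>x. tanh (m * \<phi> x)) \<in> test_functions UNIV"
proof -
  define H where "H = range (\<lambda>p t. poly p (tanh (m * t :: real)))"
  have "\<exists>h'\<in>H. \<forall>t. (h has_real_derivative h' t) (at t)" if "h \<in> H" for h
  proof -
    obtain p where p: "h = (\<lambda>t. poly p (tanh (m * t)))" using \<open>h \<in> H\<close> unfolding H_def by (rule rangeE)
    have "(h has_real_derivative poly (smult m (pderiv p * [:1, 0, -1:])) (tanh (m * t))) (at t)" for t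
      unfolding p by (rule DERIV_cong[OF DERIV_chain2[OF poly_DERIV tanh_scaled_derivative]])
        (simp add: algebra_simps power2_eq_square)
    moreover have "(\<lambda>t. poly (smult m (pderiv p * [:1, 0, -1:])) (tanh (m * t))) \<in> H" unfolding H_def by blast
    ultimately show ?thesis
      by (intro bexI[of _ "\<lambda>t. poly (smult m (pderiv p * [:1, 0, -1:])) (tanh (m * t))"] allI)
  qed
  moreover have "(\<lambda>t. tanh (m * t)) \<in> H" unfolding H_def by (rule image_eqI[of _ _ "[:0, 1:]"]) auto
  ultimately show ?thesis using test_functions_compose[of H "\<lambda>t. tanh (m * t)" \<phi>] assms by simp
qed

section \<open>A bump function\<close>

text \<open>For the constant polynomial 1 this is the classical smooth function exp(-1/t). The
  polynomial factors make the class closed under differentiation.\<close>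

definition exp_cutoff :: "real poly \<Rightarrow> real \<Rightarrow> real" where
  "exp_cutoff p t = (if 0 < t then poly p (1 / t) * exp (- (1 / t)) else 0)"

text \<open>The power of s is carried along for the induction: splitting off a coefficient of the
  polynomial raises it by one.\<close>

lemma poly_div_exp_tendsto_0:
  fixes p :: "real poly"
  shows "((\<lambda>s. s ^ k * poly p s / exp s) \<longlongrightarrow> 0) at_top"
proof (induction p arbitrary: k)
  case (pCons a p)
  have "((\<lambda>s. a * (s ^ k / exp s) + s ^ Suc k * poly p s / exp s) \<longlongrightarrow> a * 0 + 0) at_top"
    by (intro tendsto_intros tendsto_power_div_exp_0 pCons)
  then show ?case by (simp add: algebra_simps add_divide_distrib)
qed simp

text \<open>For t > 0 the factor X^2 comes from the derivative of 1/t. At 0 the right difference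
  quotient becomes s p(s) / exp s with s = 1/t and tends to 0.\<close>

lemma exp_cutoff_derivative:
  "(exp_cutoff p has_real_derivative exp_cutoff ([:0, 0, 1:] * (p - pderiv p)) t) (at t)"
proof -
  consider "t < 0" | "t = 0" | "0 < t" by linarith
  then show ?thesis
  proof cases
    case 1
    have "((\<lambda>t. 0) has_real_derivative 0) (at t)" by simp
    then have "(exp_cutoff p has_real_derivative 0) (at t)"
      by (rule has_field_derivative_transform_within_open[of _ _ _ "{..<0}"]) (use 1 in \<open>auto simp: exp_cutoff_def\<close>)
    then show ?thesis using 1 by (simp add: exp_cutoff_def)
  next
    case 2
    have "((\<lambda>y. exp_cutoff p y / y) \<longlongrightarrow> 0) (at_left 0)"
      by (rule tendsto_eventually) (auto simp: eventually_at_filter exp_cutoff_def intro!: always_eventually)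
    moreover have "((\<lambda>y. exp_cutoff p y / y) \<longlongrightarrow> 0) (at_right 0)"
      unfolding filterlim_at_right_to_top
    proof (rule Lim_transform_eventually[OF poly_div_exp_tendsto_0[of 1 p]])
      show "\<forall>\<^sub>F x in at_top. x ^ 1 * poly p x / exp x = exp_cutoff p (inverse x) / inverse x"
        using eventually_gt_at_top[of 0]
        by eventually_elim (simp add: exp_cutoff_def exp_minus field_simps)
    qed
    ultimately have "((\<lambda>y. exp_cutoff p y / y) \<longlongrightarrow> 0) (at 0)" by (rule filterlim_split_at)
    then show ?thesis using 2 by (simp add: has_field_derivative_iff exp_cutoff_def)
  next
    case 3
    have "((\<lambda>t. poly p (1 / t) * exp (- (1 / t))) has_real_derivative exp_cutoff ([:0, 0, 1:] * (p - pderiv p)) t) (at t)"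
      using 3 by (auto intro!: derivative_eq_intros DERIV_chain2[OF poly_DERIV] simp: exp_cutoff_def field_simps power2_eq_square)
    then show ?thesis
      by (rule has_field_derivative_transform_within_open[of _ _ _ "{0<..}"]) (use 3 in \<open>auto simp: exp_cutoff_def\<close>)
  qed
qed

text \<open>The polynomial r^2 + 1 - |x|^2 is negative far away and at least 1 on S, where the
  composition with exp(-1/t) is therefore at least exp(-1).\<close>

lemma bump_exists:
  fixes S :: "(real^'n) set"
  assumes "bounded S"
  obtains b where "b \<in> test_functions UNIV" "\<And>x. x \<in> S \<Longrightarrow> exp (- 1) \<le> b x"
proof -
  obtain r where r: "\<And>x. x \<in> S \<Longrightarrow> norm x \<le> r" using assms bounded_iff by metis
  define F where "F x = (r\<^sup>2 + 1) - x \<bullet> x" for x :: "real^'n"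
  have comp: "Ck k (\<lambda>x::real^'n. x $ i)" for k and i :: 'n
  proof (cases k)
    case (Suc k')
    show ?thesis unfolding Suc
    proof (rule Ck_SucI[where v = "\<lambda>x. axis i 1"])
      show "((\<lambda>x::real^'n. x $ i) has_derivative (\<lambda>h. axis i 1 \<bullet> h)) (at x)" for x
        by (simp add: inner_axis' bounded_linear_imp_has_derivative bounded_linear_vec_nth)
    qed (rule Ck_const)
  qed (simp add: continuous_on_component)
  have CF: "Ck k F" for k
  \<comment> \<open>Proving one order more makes the derivative rule applicable for every k,
    including 0.\<close>
  proof (rule Ck_Suc_imp, rule Ck_SucI[where v = "\<lambda>x::real^'n. (-2) *\<^sub>R x"])
    show "(F has_derivative (\<lambda>h. ((-2) *\<^sub>R x) \<bullet> h)) (at x)" for x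
      unfolding F_def by (auto intro!: derivative_eq_intros simp: fun_eq_iff inner_commute)
    show "Ck k (\<lambda>x. ((-2) *\<^sub>R x) $ i)" for i :: 'n using Ck_mult[OF Ck_const[of k "-2"] comp[of k i]] by simp
  qed
  define b where "b x = exp_cutoff 1 (F x)" for x
  have "Ck k b" for k
    unfolding b_def
  proof (rule Ck_compose[where H = "range exp_cutoff" and h = "exp_cutoff 1" and F = F])
    fix h assume "h \<in> range exp_cutoff"
    then obtain p where "h = exp_cutoff p" by auto
    then show "\<exists>h'\<in>range exp_cutoff. \<forall>t. (h has_real_derivative h' t) (at t)"
      using exp_cutoff_derivative[of p] by (intro bexI[of _ "exp_cutoff ([:0, 0, 1:] * (p - pderiv p))"]) auto
  qed (auto intro: CF)
  moreover have "compact (closure {x. b x \<noteq> 0})"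
  proof -
    have "norm x \<le> sqrt (r\<^sup>2 + 1)" if "b x \<noteq> 0" for x
    proof (rule real_le_rsqrt)
      have "0 < F x" using that by (rule contrapos_np) (simp add: b_def exp_cutoff_def)
      then show "(norm x)\<^sup>2 \<le> r\<^sup>2 + 1" by (simp add: F_def power2_norm_eq_inner)
    qed
    then have "bounded {x. b x \<noteq> 0}" unfolding bounded_iff by blast
    then show ?thesis by simp
  qed
  moreover have "exp (- 1) \<le> b x" if "x \<in> S" for x
  proof -
    have "x \<bullet> x \<le> r\<^sup>2" using power_mono[OF r[OF that], of 2] by (simp add: power2_norm_eq_inner)
    then have F1: "1 \<le> F x" by (simp add: F_def)
    then have "1 / F x \<le> 1" by simp
    then show ?thesis using F1 by (simp add: b_def exp_cutoff_def)
  qed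
  ultimately show ?thesis by (intro that[of b]) (auto simp: test_functions_def)
qed

section \<open>Testing with a bounded truncation\<close>

lemma epowr_two: "epowr t 2 = t\<^sup>2"
proof (cases t)
  case (real r)
  have "r powr 2 = r\<^sup>2" using real(1) by (cases "r = 0") (auto simp: powr_numeral)
  then show ?thesis using real by (simp add: ennreal_power)
qed (simp add: power2_eq_square ennreal_mult_top)

lemma Lp_norm_two:
  "Lp_norm M 2 (\<lambda>x. ennreal (norm (f x))) = epowr (\<integral>\<^sup>+x. ennreal ((norm (f x))\<^sup>2) \<partial>M) (1/2)"
  unfolding Lp_norm_def epowr_two by (simp add: ennreal_power)

lemma tendsto_epowr_half_zero:
  assumes "(\<lambda>k. epowr (s k) (1/2)) \<longlonglongrightarrow> 0"
  shows "s \<longlonglongrightarrow> 0"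
proof -
  have "s = (\<lambda>k. epowr (s k) (1/2) * epowr (s k) (1/2))"
    using epowr_epowr[of "1/2" 2] by (auto simp: fun_eq_iff epowr_two power2_eq_square)
  moreover have "(\<lambda>k. epowr (s k) (1/2) * epowr (s k) (1/2)) \<longlonglongrightarrow> 0 * 0"
    by (intro tendsto_mult_ennreal assms) auto
  ultimately show ?thesis by simp
qed

lemma Lp_norm_two_finite:
  assumes "Lp_norm M 2 (\<lambda>x. ennreal (norm (f x))) < \<infinity>"
  shows "(\<integral>\<^sup>+x. ennreal ((norm (f x))\<^sup>2) \<partial>M) < \<infinity>"
  using assms unfolding Lp_norm_two by (auto simp: less_top[symmetric])

text \<open>The squared differences converge to 0 in L^1, so along a subsequence they converge to 0
  almost everywhere.\<close>

lemma square_convergence_AE_subseq: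
  fixes f :: "nat \<Rightarrow> 'a \<Rightarrow> real"
  assumes [measurable]: "\<And>k. f k \<in> borel_measurable M" "g \<in> borel_measurable M"
    and l: "(\<lambda>k. \<integral>\<^sup>+x. ennreal ((f k x - g x)\<^sup>2) \<partial>M) \<longlonglongrightarrow> 0"
  obtains r where "strict_mono r" "AE x in M. (\<lambda>k. f (r k) x) \<longlonglongrightarrow> g x"
proof -
  have "\<forall>\<^sub>F k in sequentially. (\<integral>\<^sup>+x. ennreal ((f k x - g x)\<^sup>2) \<partial>M) < top"
    using order_tendstoD(2)[OF l, of top] by simp
  \<comment> \<open>Finitely many of the integrals may be infinite; the sequence is shifted past
    them to obtain integrable functions.\<close>
  then obtain N where N: "\<And>k. N \<le> k \<Longrightarrow> (\<integral>\<^sup>+x. ennreal ((f k x - g x)\<^sup>2) \<partial>M) < top"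
    unfolding eventually_sequentially by blast
  define h where "h k x = (f (k + N) x - g x)\<^sup>2" for k x
  have int: "integrable M (h k)" for k
    unfolding h_def integrable_iff_bounded using N[of "k + N"] by simp
  have "(\<lambda>k. \<integral>\<^sup>+x. ennreal (norm (h k x)) \<partial>M) \<longlonglongrightarrow> 0"
    using LIMSEQ_ignore_initial_segment[OF l, of N] by (simp add: h_def)
  then have "(\<lambda>k. enn2real (\<integral>\<^sup>+x. ennreal (norm (h k x)) \<partial>M)) \<longlonglongrightarrow> 0"
    by (intro tendsto_enn2real) simp_all
  then have "(\<lambda>k. \<integral>x. norm (h k x) \<partial>M) \<longlonglongrightarrow> 0"
    using int by (simp add: integral_eq_nn_integral)
  from tendsto_L1_AE_subseq[OF int this] obtain r
    where r: "strict_mono r" "AE x in M. (\<lambda>n. h (r n) x) \<longlonglongrightarrow> 0" by blast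
  show ?thesis
  proof (rule that[of "\<lambda>k. r k + N"])
    show "strict_mono (\<lambda>k. r k + N)" using r(1) by (simp add: strict_mono_def)
    show "AE x in M. (\<lambda>k. f (r k + N) x) \<longlonglongrightarrow> g x"
      using r(2)
    proof eventually_elim
      case (elim x)
      from tendsto_real_sqrt[OF this] have "(\<lambda>n. f (r n + N) x - g x) \<longlonglongrightarrow> 0"
        by (simp add: h_def tendsto_rabs_zero_iff)
      then show ?case by (simp add: LIM_zero_iff)
    qed
  qed
qed

lemma matrix_vector_norm_le:
  fixes A :: "real^'n^'n"
  shows "norm (A *v \<xi>) \<le> real (CARD('n))^2 * norm A * norm \<xi>"
proof -
  have "\<bar>(A *v \<xi>) $ i\<bar> \<le> real (CARD('n)) * (norm A * norm \<xi>)" for i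
  proof -
    have "\<bar>(A *v \<xi>) $ i\<bar> \<le> (\<Sum>j\<in>UNIV. \<bar>A $ i $ j * \<xi> $ j\<bar>)"
      unfolding matrix_vector_mult_def by (simp add: sum_abs)
    also have "\<dots> \<le> (\<Sum>j\<in>(UNIV::'n set). norm A * norm \<xi>)"
    proof (rule sum_mono)
      fix j
      have "\<bar>A $ i $ j\<bar> \<le> norm (A $ i)" by (rule component_le_norm_cart)
      also have "\<dots> \<le> norm A" by (rule Finite_Cartesian_Product.norm_nth_le)
      finally show "\<bar>A $ i $ j * \<xi> $ j\<bar> \<le> norm A * norm \<xi>"
        unfolding abs_mult by (intro mult_mono component_le_norm_cart) auto
    qed
    finally show ?thesis by simp
  qed
  then have "(\<Sum>i\<in>UNIV. \<bar>(A *v \<xi>) $ i\<bar>) \<le> (\<Sum>i\<in>(UNIV::'n set). real (CARD('n)) * (norm A * norm \<xi>))"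
    by (intro sum_mono)
  with norm_le_l1_cart[of "A *v \<xi>"] show ?thesis by (simp add: power2_eq_square mult.assoc)
qed

section \<open>Testing the equation\<close>

context ahlfors_domain
begin

lemma continuous_frontier_integrable:
  fixes f :: "real^'n \<Rightarrow> real"
  assumes "continuous_on (frontier \<Omega>) f"
  shows "integrable \<sigma> f"
proof -
  interpret S: finite_measure \<sigma> by (rule finite_measure_surface)
  have "f \<in> borel_measurable \<sigma>"
  proof (rule borel_measurableI)
    fix U :: "real set" assume "open U"
    then obtain V where "open V" "V \<inter> frontier \<Omega> = f -` U \<inter> frontier \<Omega>"
      using continuous_on_open_invariant[of "frontier \<Omega>" f] assms by blast
    then show "f -` U \<inter> space \<sigma> \<in> sets \<sigma>" using open_in_sets_surface[of V] by simp
  qed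
  moreover have "bounded (f ` frontier \<Omega>)"
    by (intro compact_imp_bounded compact_continuous_image assms compact_frontier_bounded bounded_dom)
  then obtain b where "\<And>x. x \<in> frontier \<Omega> \<Longrightarrow> norm (f x) \<le> b"
    unfolding bounded_iff by auto
  ultimately show ?thesis by (intro S.integrable_const_bound[of _ b]) auto
qed

lemma trace_mass_bound:
  fixes A :: "real^'n \<Rightarrow> real^'n^'n"
  assumes Du: "Du \<in> borel_measurable (lebesgue_on \<Omega>)" "sqint \<Omega> Du < \<infinity>"
    and ell: "uniformly_elliptic \<Omega> A"
    and \<phi>: "\<And>k. \<phi> k \<in> test_functions UNIV"
    and l2: "(\<lambda>k::nat. sqint \<Omega> (\<lambda>x. grad (\<phi> k) x - Du x)) \<longlonglongrightarrow> 0"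
    and g[measurable]: "g \<in> borel_measurable \<sigma>"
    and l3: "(\<lambda>k. \<integral>\<^sup>+x. ennreal ((\<phi> k x - g x)\<^sup>2) \<partial>\<sigma>) \<longlonglongrightarrow> 0"
    and \<alpha>[measurable]: "\<alpha> \<in> borel_measurable \<sigma>"
    and f: "continuous_on (frontier \<Omega>) f"
    and weak: "\<And>\<psi>. \<psi> \<in> test_functions UNIV \<Longrightarrow> integrable \<sigma> (\<lambda>x. \<alpha> x * g x * \<psi> x) \<and>
           integral\<^sup>L (lebesgue_on \<Omega>) (\<lambda>x. (A x *v Du x) \<bullet> grad \<psi> x)
             + integral\<^sup>L \<sigma> (\<lambda>x. \<alpha> x * g x * \<psi> x) = integral\<^sup>L \<sigma> (\<lambda>x. f x * \<psi> x)"
  shows "integrable \<sigma> (\<lambda>x. \<alpha> x * g x)" "(\<integral>x. \<alpha> x * \<bar>g x\<bar> \<partial>\<sigma>) \<le> (\<integral>x. \<bar>f x\<bar> \<partial>\<sigma>)"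
proof -
  have "bounded (frontier \<Omega>)" by (rule compact_imp_bounded[OF compact_frontier_bounded[OF bounded_dom]])
  \<comment> \<open>The weak formulation yields integrability of \<alpha> g only after
    multiplication by a test function; one that is at least exp(-1) on the boundary can be divided
    out.\<close>
  then obtain b where b: "b \<in> test_functions UNIV" "\<And>x. x \<in> frontier \<Omega> \<Longrightarrow> exp (- 1) \<le> b x" by (rule bump_exists) blast
  have test_meas: "\<psi> \<in> borel_measurable \<sigma>" if "\<psi> \<in> test_functions UNIV" for \<psi>
    using C1_fun_borel[OF test_functions_C1_fun[OF that]] borel_surface by blast
  show int: "integrable \<sigma> (\<lambda>x. \<alpha> x * g x)"
  proof (rule Bochner_Integration.integrable_bound)
    show "integrable \<sigma> (\<lambda>x. exp 1 * (\<alpha> x * g x * b x))" using weak[OF b(1)] by simp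
    show "AE x in \<sigma>. norm (\<alpha> x * g x) \<le> norm (exp 1 * (\<alpha> x * g x * b x))"
    proof (rule AE_I2)
      fix x assume "x \<in> space \<sigma>"
      then have "exp (- 1) \<le> b x" using b(2) by simp
      then have "exp 1 * exp (- 1) \<le> exp 1 * b x" by (intro mult_left_mono) auto
      then have "1 \<le> exp 1 * b x" by (simp add: exp_minus)
      then have "\<bar>\<alpha> x * g x\<bar> * 1 \<le> \<bar>\<alpha> x * g x\<bar> * \<bar>exp 1 * b x\<bar>" by (intro mult_left_mono) auto
      then show "norm (\<alpha> x * g x) \<le> norm (exp 1 * (\<alpha> x * g x * b x))" by (simp add: abs_mult mult_ac)
    qed
  qed measurable
  define F where "F = (\<integral>x. \<bar>f x\<bar> \<partial>\<sigma>)"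
  have fi: "integrable \<sigma> f" by (rule continuous_frontier_integrable[OF f])
  obtain \<mu> where \<mu>: "0 < \<mu>" "\<And>x \<xi>. x \<in> \<Omega> \<Longrightarrow> \<mu> * (norm \<xi>)\<^sup>2 \<le> (\<Sum>i\<in>UNIV. \<Sum>j\<in>UNIV. A x $ i $ j * \<xi> $ i * \<xi> $ j)"
    using ell unfolding uniformly_elliptic_def by blast
  have pos: "0 \<le> (A x *v \<xi>) \<bullet> \<xi>" if "x \<in> \<Omega>" for x \<xi>
  proof -
    have "(A x *v \<xi>) \<bullet> \<xi> = (\<Sum>i\<in>UNIV. \<Sum>j\<in>UNIV. A x $ i $ j * \<xi> $ i * \<xi> $ j)"
      by (simp add: inner_vec_def matrix_vector_mult_def sum_distrib_left sum_distrib_right mult_ac)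
    moreover have "0 \<le> \<mu> * (norm \<xi>)\<^sup>2" using \<mu>(1) by simp
    ultimately show ?thesis using \<mu>(2)[OF that, of \<xi>] by linarith
  qed
  obtain bA where bA: "\<And>x. x \<in> \<Omega> \<Longrightarrow> norm (A x) \<le> bA"
    using ell unfolding uniformly_elliptic_def bounded_iff by blast
  define a where "a = real (CARD('n))^2 * \<bar>bA\<bar>"
  have a0: "0 \<le> a" by (simp add: a_def)
  have aA: "norm (A x *v \<xi>) \<le> a * norm \<xi>" if "x \<in> \<Omega>" for x \<xi>
  proof -
    have "norm (A x *v \<xi>) \<le> real (CARD('n))^2 * norm (A x) * norm \<xi>" by (rule matrix_vector_norm_le)
    also have "\<dots> \<le> a * norm \<xi>" unfolding a_def
      using bA[OF that] by (intro mult_right_mono mult_left_mono) auto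
    finally show ?thesis .
  qed
  define G where "G = enn2real (sqint \<Omega> Du)"
  have iDu: "integrable (lebesgue_on \<Omega>) (\<lambda>x. (norm (Du x))\<^sup>2)" "(\<integral>x. (norm (Du x))\<^sup>2 \<partial>lebesgue_on \<Omega>) = G"
    using Du by (auto simp: integrable_iff_bounded sqint_def G_def integral_eq_nn_integral)
  define e' where "e' k = sqint \<Omega> (\<lambda>x. grad (\<phi> k) x - Du x)" for k
  \<comment> \<open>d is the parameter of Young's inequality: it separates the energy of u,
    multiplied by d, from the approximation error, divided by d.\<close>
  have step: "(\<integral>x. \<alpha> x * g x * tanh (m * \<phi> k x) \<partial>\<sigma>) \<le> F + m * (d * a\<^sup>2 * G + enn2real (e' k) / d)"
    if m: "0 \<le> m" and d: "0 < d" and ek: "e' k < \<infinity>" for m d k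
  proof -
    define \<psi> where "\<psi> x = tanh (m * \<phi> k x)" for x
    have \<psi>: "\<psi> \<in> test_functions UNIV" unfolding \<psi>_def by (rule test_functions_tanh[OF \<phi>])
    have gm: "grad (\<phi> k) \<in> borel_measurable (lebesgue_on \<Omega>)"
      using C1_fun_borel[OF test_functions_C1_fun[OF \<phi>]] borel_lebesgue_on by blast
    have ie: "integrable (lebesgue_on \<Omega>) (\<lambda>x. (norm (grad (\<phi> k) x - Du x))\<^sup>2)"
       "(\<integral>x. (norm (grad (\<phi> k) x - Du x))\<^sup>2 \<partial>lebesgue_on \<Omega>) = enn2real (e' k)"
      using Du gm ek by (auto simp: integrable_iff_bounded sqint_def e'_def integral_eq_nn_integral)
    define R where "R x = m * (d * a\<^sup>2 * (norm (Du x))\<^sup>2 + (norm (grad (\<phi> k) x - Du x))\<^sup>2 / d)" for x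
    have iR: "integrable (lebesgue_on \<Omega>) R" "(\<integral>x. R x \<partial>lebesgue_on \<Omega>) = m * (d * a\<^sup>2 * G + enn2real (e' k) / d)"
      unfolding R_def using iDu ie by simp_all
    have R0: "0 \<le> R x" for x unfolding R_def using m d by simp
    have pw: "- R x \<le> (A x *v Du x) \<bullet> grad \<psi> x" if x: "x \<in> \<Omega>" for x
    proof -
      define \<beta> where "\<beta> = m * (1 - (tanh (m * \<phi> k x))\<^sup>2)"
      have "(tanh (m * \<phi> k x))\<^sup>2 \<le> 1"
        using tanh_real_lt_1[of "m * \<phi> k x"] tanh_real_gt_neg1[of "m * \<phi> k x"] by (simp add: abs_square_le_1)
      then have \<beta>: "0 \<le> \<beta>" "\<beta> \<le> m" using m by (auto simp: \<beta>_def mult_left_le)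
      have "grad \<psi> x = \<beta> *\<^sub>R grad (\<phi> k) x"
      proof (rule grad_eqI)
        have "(\<phi> k has_derivative (\<lambda>v. grad (\<phi> k) x \<bullet> v)) (at x)"
          using test_functions_C1_fun[OF \<phi>, of k] by (intro grad_has_derivative) (simp add: C1_fun_def)
        from has_derivative_compose_real[OF this tanh_scaled_derivative]
        show "(\<psi> has_derivative (\<lambda>h. (\<beta> *\<^sub>R grad (\<phi> k) x) \<bullet> h)) (at x)"
          unfolding \<beta>_def \<psi>_def .
      qed
      then have eq: "(A x *v Du x) \<bullet> grad \<psi> x = \<beta> * ((A x *v Du x) \<bullet> Du x) + \<beta> * ((A x *v Du x) \<bullet> (grad (\<phi> k) x - Du x))"
        by (simp add: inner_diff_right algebra_simps)
      have "\<bar>(A x *v Du x) \<bullet> (grad (\<phi> k) x - Du x)\<bar> \<le> norm (A x *v Du x) * norm (grad (\<phi> k) x - Du x)"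
        by (rule Cauchy_Schwarz_ineq2)
      also have "\<dots> \<le> a * norm (Du x) * norm (grad (\<phi> k) x - Du x)"
        using aA[OF x] by (intro mult_right_mono) auto
      also have "\<dots> \<le> d * (a * norm (Du x))\<^sup>2 + (norm (grad (\<phi> k) x - Du x))\<^sup>2 / d"
      proof -
        define s where "s = a * norm (Du x)"
        define t where "t = norm (grad (\<phi> k) x - Du x)"
        have st: "0 \<le> s" "0 \<le> t" using a0 by (auto simp: s_def t_def)
        \<comment> \<open>Young's inequality in the form s t \<le> d s^2 + t^2/d, multiplied by
          d.\<close>
        have "0 \<le> (d * s - t)\<^sup>2" by simp
        then have "2 * (d * s * t) \<le> (d * s)\<^sup>2 + t\<^sup>2" by (simp add: power2_diff)
        moreover have "0 \<le> d * s * t" using d st by simp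
        ultimately have "d * (s * t) \<le> d * (d * s\<^sup>2 + t\<^sup>2 / d)"
          using d by (simp add: power_mult_distrib distrib_left power2_eq_square mult_ac)
        then show ?thesis using d unfolding s_def[symmetric] t_def[symmetric] by simp
      qed
      finally have "\<beta> * \<bar>(A x *v Du x) \<bullet> (grad (\<phi> k) x - Du x)\<bar> \<le> m * (d * (a * norm (Du x))\<^sup>2 + (norm (grad (\<phi> k) x - Du x))\<^sup>2 / d)"
        using \<beta> m by (intro mult_mono) auto
      then have "\<beta> * \<bar>(A x *v Du x) \<bullet> (grad (\<phi> k) x - Du x)\<bar> \<le> R x" by (simp add: R_def power_mult_distrib mult_ac)
      moreover have "0 \<le> \<beta> * ((A x *v Du x) \<bullet> Du x)" using \<beta> pos[OF x] by simp
      moreover have "- (\<beta> * \<bar>(A x *v Du x) \<bullet> (grad (\<phi> k) x - Du x)\<bar>) \<le> \<beta> * ((A x *v Du x) \<bullet> (grad (\<phi> k) x - Du x))"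
        using \<beta>(1) by (metis abs_ge_minus_self abs_mult abs_of_nonneg minus_le_iff)
      ultimately show ?thesis unfolding eq by linarith
    qed
    have "- (\<integral>x. R x \<partial>lebesgue_on \<Omega>) \<le> (\<integral>x. (A x *v Du x) \<bullet> grad \<psi> x \<partial>lebesgue_on \<Omega>)"
    proof (cases "integrable (lebesgue_on \<Omega>) (\<lambda>x. (A x *v Du x) \<bullet> grad \<psi> x)")
      case True
      have "(\<integral>x. - R x \<partial>lebesgue_on \<Omega>) \<le> (\<integral>x. (A x *v Du x) \<bullet> grad \<psi> x \<partial>lebesgue_on \<Omega>)"
        using iR(1) True pw by (intro integral_mono) auto
      then show ?thesis by simp
    next
      \<comment> \<open>The Bochner integral of a non-integrable function is 0, and this still lies
        above the nonpositive left side.\<close>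
      case False
      then show ?thesis using R0 by (simp add: not_integrable_integral_eq)
    qed
    moreover have "(\<integral>x. f x * \<psi> x \<partial>\<sigma>) \<le> F" unfolding F_def
    proof (rule integral_mono')
      show "integrable \<sigma> (\<lambda>x. \<bar>f x\<bar>)" using fi by simp
      fix x
      have "\<bar>\<psi> x\<bar> \<le> 1" using tanh_real_lt_1[of "m * \<phi> k x"] tanh_real_gt_neg1[of "m * \<phi> k x"] by (simp add: \<psi>_def)
      then have "\<bar>f x * \<psi> x\<bar> \<le> \<bar>f x\<bar>" by (simp add: abs_mult mult_left_le)
      then show "f x * \<psi> x \<le> \<bar>f x\<bar>" by linarith
    qed simp
    ultimately show ?thesis using weak[OF \<psi>] iR(2) unfolding \<psi>_def by linarith
  qed
  obtain r where r: "strict_mono r" "AE x in \<sigma>. (\<lambda>k. \<phi> (r k) x) \<longlonglongrightarrow> g x"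
    using square_convergence_AE_subseq[OF test_meas[OF \<phi>] g l3] by blast
  have lr: "(\<lambda>k. e' (r k)) \<longlonglongrightarrow> 0" using LIMSEQ_subseq_LIMSEQ[OF l2 r(1)] by (simp add: e'_def comp_def)
  have fin: "\<forall>\<^sub>F k in sequentially. e' (r k) < \<infinity>" using order_tendstoD(2)[OF lr, of "\<infinity>"] by simp
  have stepm: "(\<integral>x. \<alpha> x * g x * tanh (m * g x) \<partial>\<sigma>) \<le> F + d * (m * a\<^sup>2 * G)" if m: "0 \<le> m" and d: "0 < d" for m d
  proof -
    have l: "(\<lambda>k. \<integral>x. \<alpha> x * g x * tanh (m * \<phi> (r k) x) \<partial>\<sigma>) \<longlonglongrightarrow> (\<integral>x. \<alpha> x * g x * tanh (m * g x) \<partial>\<sigma>)"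
    \<comment> \<open>Since |tanh| \<le> 1, the integrable function |\<alpha> g| dominates; almost
      everywhere convergence is available because k runs through the subsequence
      \<open>r\<close>.\<close>
    proof (rule integral_dominated_convergence[where w = "\<lambda>x. \<bar>\<alpha> x * g x\<bar>"])
      show "AE x in \<sigma>. (\<lambda>k. \<alpha> x * g x * tanh (m * \<phi> (r k) x)) \<longlonglongrightarrow> \<alpha> x * g x * tanh (m * g x)"
        using r(2) by eventually_elim (auto intro!: tendsto_intros)
      show "AE x in \<sigma>. norm (\<alpha> x * g x * tanh (m * \<phi> (r k) x)) \<le> \<bar>\<alpha> x * g x\<bar>" for k
      proof (rule AE_I2)
        fix x
        have "\<bar>tanh (m * \<phi> (r k) x)\<bar> \<le> 1"
          using tanh_real_lt_1[of "m * \<phi> (r k) x"] tanh_real_gt_neg1[of "m * \<phi> (r k) x"] by simp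
        then show "norm (\<alpha> x * g x * tanh (m * \<phi> (r k) x)) \<le> \<bar>\<alpha> x * g x\<bar>"
          unfolding real_norm_def abs_mult[of "\<alpha> x * g x"] by (intro mult_left_le) auto
      qed
      show "(\<lambda>x. \<alpha> x * g x * tanh (m * \<phi> (r k) x)) \<in> borel_measurable \<sigma>" for k
        using test_meas[OF test_functions_tanh[OF \<phi>[of "r k"], of m]] by measurable
      show "(\<lambda>x. \<alpha> x * g x * tanh (m * g x)) \<in> borel_measurable \<sigma>"
      proof -
        have "(tanh :: real \<Rightarrow> real) \<in> borel_measurable borel"
          by (intro borel_measurable_continuous_onI continuous_intros) auto
        then show ?thesis by measurable
      qed
      show "integrable \<sigma> (\<lambda>x. \<bar>\<alpha> x * g x\<bar>)" using int by simp
    qed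
    have "(\<lambda>k. enn2real (e' (r k))) \<longlonglongrightarrow> 0" by (intro tendsto_enn2real) (use lr in simp_all)
    then have "(\<lambda>k. F + m * (d * a\<^sup>2 * G + enn2real (e' (r k)) / d)) \<longlonglongrightarrow> F + m * (d * a\<^sup>2 * G + 0 / d)"
      by (intro tendsto_add tendsto_mult tendsto_const tendsto_divide) (use d in auto)
    from tendsto_le[OF sequentially_bot this l eventually_mono[OF fin step[OF m d]]]
    show ?thesis by (simp add: mult_ac)
  qed
  have stepg: "(\<integral>x. \<alpha> x * g x * tanh (m * g x) \<partial>\<sigma>) \<le> F" if m: "0 \<le> m" for m
  proof -
    have "(\<lambda>i. F + 1 / real (Suc i) * (m * a\<^sup>2 * G)) \<longlonglongrightarrow> F + 0 * (m * a\<^sup>2 * G)"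
      by (intro tendsto_intros LIMSEQ_Suc[OF lim_1_over_n])
    then have "(\<integral>x. \<alpha> x * g x * tanh (m * g x) \<partial>\<sigma>) \<le> F + 0 * (m * a\<^sup>2 * G)"
    proof (rule LIMSEQ_le_const)
      have "(\<integral>x. \<alpha> x * g x * tanh (m * g x) \<partial>\<sigma>) \<le> F + 1 / real (Suc i) * (m * a\<^sup>2 * G)" for i
        by (rule stepm[OF m]) simp
      then show "\<exists>N. \<forall>i\<ge>N. (\<integral>x. \<alpha> x * g x * tanh (m * g x) \<partial>\<sigma>) \<le> F + 1 / real (Suc i) * (m * a\<^sup>2 * G)"
        by blast
    qed
    then show ?thesis by simp
  qed
  have "(\<lambda>j. \<integral>x. \<alpha> x * g x * tanh (real j * g x) \<partial>\<sigma>) \<longlonglongrightarrow> (\<integral>x. \<alpha> x * \<bar>g x\<bar> \<partial>\<sigma>)"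
  proof (rule integral_dominated_convergence[where w = "\<lambda>x. \<bar>\<alpha> x * g x\<bar>"])
    show "AE x in \<sigma>. (\<lambda>j. \<alpha> x * g x * tanh (real j * g x)) \<longlonglongrightarrow> \<alpha> x * \<bar>g x\<bar>"
    proof (rule AE_I2)
      fix x
      have "(\<lambda>j. g x * tanh (real j * g x)) \<longlonglongrightarrow> \<bar>g x\<bar>"
      proof -
        \<comment> \<open>tanh(j t) tends to 1 for t > 0; negative values of g are reduced to this
          by oddness of tanh.\<close>
        have pos: "(\<lambda>j. tanh (real j * t)) \<longlonglongrightarrow> 1" if "0 < t" for t :: real
          by (rule filterlim_compose[OF tanh_real_at_top])
             (use that in \<open>auto intro!: filterlim_at_top_mult_tendsto_pos[OF tendsto_const _ filterlim_real_sequentially]\<close>)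
        consider "0 < g x" | "g x = 0" | "0 < - g x" by linarith
        then show ?thesis
        proof cases
          case 1
          from tendsto_mult[OF tendsto_const[of "g x"] pos[OF 1]] show ?thesis using 1 by simp
        next
          case 3
          from tendsto_mult[OF tendsto_const[of "- g x"] pos[OF 3]] show ?thesis using 3 by simp
        qed simp
      qed
      from tendsto_mult[OF tendsto_const[of "\<alpha> x"] this]
      show "(\<lambda>j. \<alpha> x * g x * tanh (real j * g x)) \<longlonglongrightarrow> \<alpha> x * \<bar>g x\<bar>" by (simp add: mult.assoc)
    qed
    show "AE x in \<sigma>. norm (\<alpha> x * g x * tanh (real j * g x)) \<le> \<bar>\<alpha> x * g x\<bar>" for j
    proof (rule AE_I2)
      fix x
      have "\<bar>tanh (real j * g x)\<bar> \<le> 1"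
        using tanh_real_lt_1[of "real j * g x"] tanh_real_gt_neg1[of "real j * g x"] by simp
      then show "norm (\<alpha> x * g x * tanh (real j * g x)) \<le> \<bar>\<alpha> x * g x\<bar>"
        unfolding real_norm_def abs_mult[of "\<alpha> x * g x"] by (intro mult_left_le) auto
    qed
    show "(\<lambda>x. \<alpha> x * g x * tanh (real j * g x)) \<in> borel_measurable \<sigma>" for j
    proof -
      have "(tanh :: real \<Rightarrow> real) \<in> borel_measurable borel"
        by (intro borel_measurable_continuous_onI continuous_intros) auto
      then show ?thesis by measurable
    qed
    show "integrable \<sigma> (\<lambda>x. \<bar>\<alpha> x * g x\<bar>)" using int by simp
  qed measurable
  then show "(\<integral>x. \<alpha> x * \<bar>g x\<bar> \<partial>\<sigma>) \<le> (\<integral>x. \<bar>f x\<bar> \<partial>\<sigma>)"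
    by (rule LIMSEQ_le_const2) (use stepg in \<open>auto simp: F_def\<close>)
qed

end

section \<open>Bounds for the solution\<close>

text \<open>In place of Hoelder's inequality, F \<le> l + l^(1-p) F^p holds pointwise: either F
  \<le> l, or F^(1-p) \<le> l^(1-p). With l the norm itself, the last term integrates to l.\<close>

lemma nn_integral_le_Lp_norm:
  assumes [measurable]: "F \<in> borel_measurable M" and p: "1 \<le> p"
  shows "(\<integral>\<^sup>+x. F x \<partial>M) \<le> (1 + emeasure M (space M)) * Lp_norm M p F"
proof -
  define I where "I = (\<integral>\<^sup>+x. epowr (F x) p \<partial>M)"
  have L: "Lp_norm M p F = epowr I (1/p)" by (simp add: Lp_norm_def I_def)
  \<comment> \<open>The pointwise inequality needs a positive finite l, so norms 0 and infinity are
    treated apart.\<close>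
  consider (zero) "I = 0" | (top) "I = top" | (pos) i where "I = ennreal i" "0 < i"
    by (cases I) (auto simp: le_less)
  then show ?thesis
  proof cases
    case zero
    then have "AE x in M. epowr (F x) p = 0" unfolding I_def by (subst (asm) nn_integral_0_iff_AE) auto
    then have "AE x in M. F x = 0"
    proof eventually_elim
      case (elim x)
      then show ?case using p by (cases "F x") (auto split: if_splits)
    qed
    then have "(\<integral>\<^sup>+x. F x \<partial>M) = 0" by (subst nn_integral_0_iff_AE) auto
    then show ?thesis by simp
  next
    case top
    then show ?thesis by (simp add: L ennreal_mult_top)
  next
    case pos
    define l where "l = i powr (1/p)"
    have l: "0 < l" "l powr p = i" using pos p by (auto simp: l_def powr_powr)
    have pw: "F x \<le> ennreal l + ennreal (l powr (1 - p)) * epowr (F x) p" for x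
    proof (cases "F x")
      case (real t)
      have "t \<le> l + l powr (1 - p) * t powr p"
      proof (cases "t \<le> l")
        case True
        then show ?thesis by (simp add: add_increasing2)
      next
        case False
        then have t: "l \<le> t" "0 < t" using l by auto
        have "t = t powr (1 - p) * t powr p" using t by (simp add: powr_add[symmetric])
        also have "t powr (1 - p) \<le> l powr (1 - p)" using l t p by (intro powr_mono2') auto
        finally have "t \<le> l powr (1 - p) * t powr p" by (simp add: mult_right_mono)
        then show ?thesis using l by simp
      qed
      then have "ennreal t \<le> ennreal (l + l powr (1 - p) * t powr p)" by (rule ennreal_leI)
      then show ?thesis using real l by (simp add: ennreal_plus ennreal_mult)
    next
      case top
      then show ?thesis using l by (simp add: ennreal_mult_top)
    qed
    have "(\<integral>\<^sup>+x. F x \<partial>M) \<le> (\<integral>\<^sup>+x. ennreal l + ennreal (l powr (1 - p)) * epowr (F x) p \<partial>M)"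
      by (intro nn_integral_mono pw)
    also have "\<dots> = ennreal l * emeasure M (space M) + ennreal (l powr (1 - p)) * I"
      unfolding I_def by (simp add: nn_integral_add nn_integral_cmult)
    also have "ennreal (l powr (1 - p)) * I = ennreal l"
    proof -
      have "l powr (1 - p) * i = l" using l by (simp add: powr_add[symmetric] flip: l(2))
      then show ?thesis using pos by (simp add: ennreal_mult[symmetric])
    qed
    also have "ennreal l * emeasure M (space M) + ennreal l = (1 + emeasure M (space M)) * ennreal l"
      by (simp add: distrib_right mult.commute[of "ennreal l"] add.commute)
    finally show ?thesis using pos by (simp add: L l_def)
  qed
qed

lemma powr_sum3_le:
  fixes a b c :: real
  assumes "0 \<le> a" "0 \<le> b" "0 \<le> c" "0 < p"
  shows "(a + b + c) powr p \<le> 3 powr p * (a powr p + b powr p + c powr p)"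
proof -
  define m where "m = max a (max b c)"
  have "(a + b + c) powr p \<le> (3 * m) powr p" using assms by (intro powr_mono2) (auto simp: m_def)
  also have "\<dots> = 3 powr p * m powr p" using assms by (simp add: powr_mult m_def)
  also have "m powr p \<le> a powr p + b powr p + c powr p"
    unfolding m_def by (auto simp: max_def)
  finally show ?thesis by (simp add: mult_left_mono)
qed

lemma epowr_cmult: "0 < a \<Longrightarrow> epowr (ennreal a * t) p = ennreal (a powr p) * epowr t p"
  by (cases t) (auto simp: ennreal_mult[symmetric] powr_mult ennreal_mult_top)

section \<open>From weak solutions to smooth approximations\<close>

lemma sobolev_trace_approximation:
  assumes W: "sobolev_W12 \<Omega> u Du" and tr: "has_trace \<Omega> u Du g"
  obtains \<phi> :: "nat \<Rightarrow> real^'n \<Rightarrow> real" where "\<And>k. \<phi> k \<in> test_functions UNIV" "w12 \<Omega> u Du"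
    "(\<lambda>k. sqint \<Omega> (\<lambda>x. \<phi> k x - u x)) \<longlonglongrightarrow> 0" "(\<lambda>k. sqint \<Omega> (\<lambda>x. grad (\<phi> k) x - Du x)) \<longlonglongrightarrow> 0"
    "g \<in> borel_measurable (surface_measure \<Omega>)"
    "(\<lambda>k. \<integral>\<^sup>+x. ennreal ((\<phi> k x - g x)\<^sup>2) \<partial>surface_measure \<Omega>) \<longlonglongrightarrow> 0"
proof -
  from tr obtain \<phi> where \<phi>: "\<And>k::nat. \<phi> k \<in> test_functions UNIV"
     and l: "(\<lambda>k. Lp_norm (lebesgue_on \<Omega>) 2 (\<lambda>x. ennreal \<bar>\<phi> k x - u x\<bar>)) \<longlonglongrightarrow> 0"
       "(\<lambda>k. Lp_norm (lebesgue_on \<Omega>) 2 (\<lambda>x. ennreal (norm (grad (\<phi> k) x - Du x)))) \<longlonglongrightarrow> 0"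
       "(\<lambda>k. Lp_norm (surface_measure \<Omega>) 2 (\<lambda>x. ennreal \<bar>\<phi> k x - g x\<bar>)) \<longlonglongrightarrow> 0"
     and g: "in_L2 (surface_measure \<Omega>) g"
    unfolding has_trace_def by blast
  note abs = Lp_norm_two[where 'b = real, unfolded real_norm_def power2_abs]
  have m: "u \<in> borel_measurable (lebesgue_on \<Omega>)" "Du \<in> borel_measurable (lebesgue_on \<Omega>)"
    "Lp_norm (lebesgue_on \<Omega>) 2 (\<lambda>x. ennreal (norm (Du x))) < \<infinity>"
    using W by (auto simp: sobolev_W12_def in_L2_def)
  have l1: "(\<lambda>k. sqint \<Omega> (\<lambda>x. \<phi> k x - u x)) \<longlonglongrightarrow> 0"
    using tendsto_epowr_half_zero[OF l(1)[unfolded abs]] by (simp add: sqint_def)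
  have l2: "(\<lambda>k. sqint \<Omega> (\<lambda>x. grad (\<phi> k) x - Du x)) \<longlonglongrightarrow> 0"
    using tendsto_epowr_half_zero[OF l(2)[unfolded Lp_norm_two]] by (simp add: sqint_def)
  have "w12 \<Omega> u Du" unfolding w12_def
    using m Lp_norm_two_finite[OF m(3)] l1 l2 test_functions_C1_fun[OF \<phi>] by (auto simp: sqint_def)
  with \<phi> l1 l2 g tendsto_epowr_half_zero[OF l(3)[unfolded abs]] show ?thesis
    by (intro that) (auto simp: in_L2_def)
qed

context robin_domain
begin

text \<open>Over the ball at a cone point y, u deviates from its mean by a multiple of \<delta> D in
  quadratic mean (Poincare), and this mean deviates from the one at \<open>ystar\<close> by the
  chain estimate. The majorant \<open>H\<close> bounds the p-th powers of both deviations at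
  once.\<close>

lemma nt_max_power_bound:
  assumes p: "0 < p"
  obtains C where "0 < C"
    "\<And>u Du. w12 \<Omega> u Du \<Longrightarrow> (\<integral>\<^sup>+x. epowr (nt_max \<Omega> u x) p \<partial>\<sigma>) \<le>
       ennreal C * ((\<integral>\<^sup>+x. epowr (nt_max \<Omega> Du x) p \<partial>\<sigma>) + ennreal (\<bar>bmean \<Omega> u ystar\<bar> powr p))"
proof -
  note dom = ahlfors_domain.open_dom[OF ahlfors_domain_axioms] bounded_dom
  obtain \<kappa> where \<kappa>: "0 < \<kappa>"
    "\<And>u Du w. w12 \<Omega> u Du \<Longrightarrow> w \<in> \<Omega> \<Longrightarrow>
        sqint (wball \<Omega> w) (\<lambda>x. u x - bmean \<Omega> u w)
          \<le> ennreal ((\<kappa> * bdist \<Omega> w * davg \<Omega> Du w)\<^sup>2 * measure lebesgue (wball \<Omega> w))"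
    by (rule hop_potential_w12[OF dom]) blast
  obtain C9 where C9: "0 < C9"
    "\<And>u Du. w12 \<Omega> u Du \<Longrightarrow> \<exists>H \<in> borel_measurable \<sigma>.
       (\<integral>\<^sup>+x. H x \<partial>\<sigma>) \<le> ennreal C9 * (\<integral>\<^sup>+x. epowr (nt_max \<Omega> Du x) p \<partial>\<sigma>) \<and>
       (\<forall>x\<in>frontier \<Omega>. \<forall>y\<in>wide_cone 2 \<Omega> x.
          ennreal (\<bar>bmean \<Omega> u y - bmean \<Omega> u ystar\<bar> powr p) \<le> H x \<and>
          ennreal ((bdist \<Omega> y * davg \<Omega> Du y) powr p) \<le> H x)"
    by (rule oscillation_nt_max[OF p, of 2]) (simp, blast)
  define S where "S = measure \<sigma> (frontier \<Omega>)"
  have S: "emeasure \<sigma> (frontier \<Omega>) = ennreal S" "0 \<le> S"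
    using surface_finite by (auto simp: S_def emeasure_eq_ennreal_measure)
  \<comment> \<open>2^p comes from estimating a quadratic mean by twice a sum, 3^p from the power of
    a sum of three terms. In \<open>k2\<close> the summands belong to the Poincare term and the
    oscillation of means.\<close>
  define k1 where "k1 = 2 powr p * 3 powr p"
  define k2 where "k2 = \<kappa> powr p + 1"
  have k: "0 < k1" "0 < k2" by (auto simp: k1_def k2_def add_nonneg_pos)
  define C where "C = k1 * k2 * C9 + k1 * S"
  show ?thesis
  proof (rule that[of C])
    show "0 < C" unfolding C_def using k C9(1) S(2) by (intro add_pos_nonneg mult_pos_pos mult_nonneg_nonneg) auto
    fix u Du assume w12: "w12 \<Omega> u Du"
    define \<rho> where "\<rho> = bmean \<Omega> u ystar"
    obtain H where H[measurable]: "H \<in> borel_measurable \<sigma>"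
      and Hi: "(\<integral>\<^sup>+x. H x \<partial>\<sigma>) \<le> ennreal C9 * (\<integral>\<^sup>+x. epowr (nt_max \<Omega> Du x) p \<partial>\<sigma>)"
      and Hb: "\<And>x y. x \<in> frontier \<Omega> \<Longrightarrow> y \<in> wide_cone 2 \<Omega> x \<Longrightarrow>
          ennreal (\<bar>bmean \<Omega> u y - \<rho>\<bar> powr p) \<le> H x \<and> ennreal ((bdist \<Omega> y * davg \<Omega> Du y) powr p) \<le> H x"
      using C9(2)[OF w12] unfolding \<rho>_def by blast
    have pw: "epowr (nt_max \<Omega> u x) p \<le> ennreal (k1 * k2) * H x + ennreal (k1 * \<bar>\<rho>\<bar> powr p)" (is "_ \<le> ?Z x")
      if x: "x \<in> frontier \<Omega>" for x
    proof -
      have "nt_avg u y \<le> epowr (?Z x) (1/p)" if y: "y \<in> nt_cone \<Omega> x" for y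
      proof -
        have yin: "y \<in> \<Omega>" and yc: "y \<in> wide_cone 2 \<Omega> x" using y by (auto simp: nt_cone_def wide_cone_def)
        define a where "a = \<kappa> * (bdist \<Omega> y * davg \<Omega> Du y)"
        define b where "b = \<bar>bmean \<Omega> u y - \<rho>\<bar>"
        define V where "V = measure lebesgue (wball \<Omega> y)"
        define B where "B = wball \<Omega> y"
        have a0: "0 \<le> a" using \<kappa>(1) bdist_nonneg[of \<Omega> y] davg_nonneg[of \<Omega> Du y] by (simp add: a_def)
        have "u \<in> borel_measurable (lebesgue_on \<Omega>)" using w12 by (simp add: w12_def)
        then have um: "u \<in> borel_measurable (lebesgue_on B)"
          unfolding B_def by (rule measurable_lebesgue_on_subset[OF _ wball_subset[OF yin]])
        have V: "emeasure lebesgue B = ennreal V" "0 \<le> V"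
          unfolding V_def B_def by (rule wball_measure(1)[OF yin], rule measure_nonneg)
        have "sqint B (\<lambda>z. u z - 0) \<le> 2 * sqint B (\<lambda>z. u z - bmean \<Omega> u y) + 2 * sqint B (\<lambda>z. bmean \<Omega> u y - 0)"
          by (rule sqint_triangle) (use um in auto)
        also have "\<dots> \<le> 2 * ennreal (a\<^sup>2 * V) + 2 * ennreal ((bmean \<Omega> u y)\<^sup>2 * V)"
        proof (intro add_mono mult_left_mono)
          show "sqint B (\<lambda>z. u z - bmean \<Omega> u y) \<le> ennreal (a\<^sup>2 * V)"
            using \<kappa>(2)[OF w12 yin] by (simp add: a_def V_def B_def mult.assoc)
          show "sqint B (\<lambda>z. bmean \<Omega> u y - 0) \<le> ennreal ((bmean \<Omega> u y)\<^sup>2 * V)"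
            using V by (subst sqint_const) (auto simp: B_def ennreal_mult)
        qed auto
        also have "\<dots> = ennreal (2 * (a\<^sup>2 + (bmean \<Omega> u y)\<^sup>2) * V)"
          using V(2) by (simp add: ennreal_mult ennreal_plus distrib_left distrib_right mult.assoc)
        also have "\<dots> \<le> ennreal ((2 * (a + \<bar>bmean \<Omega> u y\<bar>))\<^sup>2 * V)"
        proof (intro ennreal_leI mult_right_mono V(2))
          have "0 \<le> a * \<bar>bmean \<Omega> u y\<bar>" using a0 by simp
          moreover have "0 \<le> a\<^sup>2" "0 \<le> (bmean \<Omega> u y)\<^sup>2" by simp_all
          moreover have "(2 * (a + \<bar>bmean \<Omega> u y\<bar>))\<^sup>2 = 4 * a\<^sup>2 + 4 * (bmean \<Omega> u y)\<^sup>2 + 8 * (a * \<bar>bmean \<Omega> u y\<bar>)"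
            by (simp add: power_mult_distrib power2_sum)
          ultimately show "2 * (a\<^sup>2 + (bmean \<Omega> u y)\<^sup>2) \<le> (2 * (a + \<bar>bmean \<Omega> u y\<bar>))\<^sup>2"
            unfolding distrib_left by linarith
        qed
        finally have "nt_avg u y \<le> ennreal (2 * (a + \<bar>bmean \<Omega> u y\<bar>))"
          using a0 by (intro nt_avg_le[OF yin]) (auto simp: B_def V_def)
        also have "\<dots> \<le> ennreal (2 * (a + b + \<bar>\<rho>\<bar>))" 
          using abs_triangle_ineq[of "bmean \<Omega> u y - \<rho>" \<rho>] unfolding b_def by (intro ennreal_leI) simp
        finally have "epowr (nt_avg u y) p \<le> epowr (ennreal (2 * (a + b + \<bar>\<rho>\<bar>))) p" by (rule epowr_mono[OF p])
        also have "\<dots> = ennreal ((2 * (a + b + \<bar>\<rho>\<bar>)) powr p)"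
          using a0 by (intro epowr_ennreal) (simp add: b_def)
        also have "\<dots> \<le> ennreal (k1 * (a powr p + b powr p + \<bar>\<rho>\<bar> powr p))"
        proof (rule ennreal_leI)
          have "(2 * (a + b + \<bar>\<rho>\<bar>)) powr p = 2 powr p * (a + b + \<bar>\<rho>\<bar>) powr p"
            by (subst powr_mult) (use a0 in \<open>auto simp: b_def\<close>)
          also have "\<dots> \<le> 2 powr p * (3 powr p * (a powr p + b powr p + \<bar>\<rho>\<bar> powr p))"
            using a0 p by (intro mult_left_mono powr_sum3_le) (auto simp: b_def)
          finally show "(2 * (a + b + \<bar>\<rho>\<bar>)) powr p \<le> k1 * (a powr p + b powr p + \<bar>\<rho>\<bar> powr p)"
            by (simp add: k1_def mult.assoc)
        qed
        also have "\<dots> = ennreal k1 * (ennreal (a powr p) + ennreal (b powr p)) + ennreal (k1 * \<bar>\<rho>\<bar> powr p)"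
          using k by (simp add: distrib_left ennreal_mult ennreal_plus)
        also have "\<dots> \<le> ennreal k1 * (ennreal (\<kappa> powr p) * H x + H x) + ennreal (k1 * \<bar>\<rho>\<bar> powr p)"
        proof (intro add_mono mult_left_mono order_refl)
          have "a powr p = \<kappa> powr p * (bdist \<Omega> y * davg \<Omega> Du y) powr p"
            using \<kappa>(1) bdist_nonneg[of \<Omega> y] davg_nonneg[of \<Omega> Du y] by (simp add: a_def powr_mult)
          then have "ennreal (a powr p) = ennreal (\<kappa> powr p) * ennreal ((bdist \<Omega> y * davg \<Omega> Du y) powr p)"
            by (simp add: ennreal_mult)
          also have "\<dots> \<le> ennreal (\<kappa> powr p) * H x" using Hb[OF x yc] by (intro mult_left_mono) auto
          finally show "ennreal (a powr p) \<le> ennreal (\<kappa> powr p) * H x" .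
          show "ennreal (b powr p) \<le> H x" using Hb[OF x yc] by (simp add: b_def)
        qed auto
        also have "\<dots> = ?Z x"
          using k by (simp add: k2_def ennreal_mult ennreal_plus distrib_right mult.assoc)
        finally have "epowr (epowr (nt_avg u y) p) (1/p) \<le> epowr (?Z x) (1/p)"
          using p by (intro epowr_mono) auto
        then show ?thesis using p by (simp add: epowr_epowr)
      qed
      then have "nt_max \<Omega> u x \<le> epowr (?Z x) (1/p)" unfolding nt_max_eq by (rule SUP_least)
      then have "epowr (nt_max \<Omega> u x) p \<le> epowr (epowr (?Z x) (1/p)) p" by (rule epowr_mono[OF p])
      then show ?thesis using p by (simp add: epowr_epowr)
    qed
    define NN where "NN = (\<integral>\<^sup>+x. epowr (nt_max \<Omega> Du x) p \<partial>\<sigma>)"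
    define R where "R = ennreal (\<bar>\<rho>\<bar> powr p)"
    have "(\<integral>\<^sup>+x. epowr (nt_max \<Omega> u x) p \<partial>\<sigma>) \<le> (\<integral>\<^sup>+x. ?Z x \<partial>\<sigma>)"
      using pw by (intro nn_integral_mono) simp
    also have "\<dots> = ennreal (k1 * k2) * (\<integral>\<^sup>+x. H x \<partial>\<sigma>) + ennreal (k1 * \<bar>\<rho>\<bar> powr p) * ennreal S"
      by (simp add: nn_integral_add nn_integral_cmult S(1))
    also have "\<dots> \<le> ennreal (k1 * k2) * (ennreal C9 * NN) + ennreal (k1 * \<bar>\<rho>\<bar> powr p) * ennreal S"
      using Hi unfolding NN_def by (intro add_mono mult_left_mono) auto
    also have "\<dots> = ennreal (k1 * k2 * C9) * NN + ennreal (k1 * S) * R"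
      using k C9(1) S(2) by (simp add: R_def ennreal_mult mult_ac)
    also have "\<dots> \<le> ennreal C * NN + ennreal C * R"
      using k C9(1) S(2) by (intro add_mono mult_right_mono ennreal_leI) (auto simp: C_def)
    finally show "(\<integral>\<^sup>+x. epowr (nt_max \<Omega> u x) p \<partial>\<sigma>) \<le>
       ennreal C * ((\<integral>\<^sup>+x. epowr (nt_max \<Omega> Du x) p \<partial>\<sigma>) + ennreal (\<bar>bmean \<Omega> u ystar\<bar> powr p))"
      by (simp add: NN_def R_def \<rho>_def distrib_left)
  qed
qed

text \<open>With \<rho> the mean at \<open>ystar\<close>, on E0 one has |\<rho>| \<le> |g - \<rho>|
  + |g| and |g| \<le> \<alpha>|g|/c0. Integrating the constant |\<rho>| over E0 bounds it, up to the
  positive measure of E0, by the trace oscillation and the mass bound. The constant is fixed before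
  f and u.\<close>

lemma mean_value_bound:
  fixes A :: "real^'n \<Rightarrow> real^'n^'n"
  assumes ell: "uniformly_elliptic \<Omega> A" and rob: "robin_coefficient \<Omega> \<alpha>"
  obtains C where "0 < C"
    "\<And>f u Du. f \<in> Cc_boundary \<Omega> \<Longrightarrow> robin_weak_solution \<Omega> A \<alpha> f u Du \<Longrightarrow>
       w12 \<Omega> u Du \<and> ennreal \<bar>bmean \<Omega> u ystar\<bar> \<le> ennreal C * ((\<integral>\<^sup>+x. nt_max \<Omega> Du x \<partial>\<sigma>) + (\<integral>\<^sup>+x. ennreal \<bar>f x\<bar> \<partial>\<sigma>))"
proof -
  obtain C10 where C10: "0 < C10"
    "\<And>u Du g \<phi>. w12 \<Omega> u Du \<Longrightarrow> (\<And>k. C1_fun (\<phi> k)) \<Longrightarrow> (\<lambda>k::nat. sqint \<Omega> (\<lambda>x. \<phi> k x - u x)) \<longlonglongrightarrow> 0 \<Longrightarrow>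
       (\<lambda>k. sqint \<Omega> (\<lambda>x. grad (\<phi> k) x - Du x)) \<longlonglongrightarrow> 0 \<Longrightarrow> g \<in> borel_measurable \<sigma> \<Longrightarrow>
       (\<lambda>k. \<integral>\<^sup>+x. ennreal ((\<phi> k x - g x)\<^sup>2) \<partial>\<sigma>) \<longlonglongrightarrow> 0 \<Longrightarrow>
       (\<integral>\<^sup>+x. ennreal \<bar>g x - bmean \<Omega> u ystar\<bar> \<partial>\<sigma>) \<le> ennreal C10 * (\<integral>\<^sup>+x. nt_max \<Omega> Du x \<partial>\<sigma>)"
    by (rule trace_oscillation) blast
  from rob obtain c0 E0 where \<alpha>[measurable]: "\<alpha> \<in> borel_measurable \<sigma>" and \<alpha>0: "AE x in \<sigma>. 0 \<le> \<alpha> x"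
    and c0: "0 < c0" and E0[measurable]: "E0 \<in> sets \<sigma>" and E0p: "emeasure \<sigma> E0 > 0"
    and \<alpha>E: "AE x in \<sigma>. x \<in> E0 \<longrightarrow> c0 \<le> \<alpha> x"
    unfolding robin_coefficient_def by blast
  define e where "e = measure \<sigma> E0"
  have "emeasure \<sigma> E0 \<le> emeasure \<sigma> (space \<sigma>)" by (rule emeasure_space)
  then have "emeasure \<sigma> E0 < top" using surface_finite by (simp add: order_le_less_trans)
  then have e: "emeasure \<sigma> E0 = ennreal e" by (simp add: e_def emeasure_eq_ennreal_measure)
  then have e0: "0 < e" using E0p by simp
  define k where "k = C10 + 1 / c0"
  have k0: "0 < k" using C10(1) c0 by (simp add: k_def add_pos_pos)
  show ?thesis
  proof (rule that[of "k / e"])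
    show "0 < k / e" using k0 e0 by simp
    fix f u Du assume f: "f \<in> Cc_boundary \<Omega>" and sol: "robin_weak_solution \<Omega> A \<alpha> f u Du"
    have fc: "continuous_on (frontier \<Omega>) f" using f by (simp add: Cc_boundary_def)
    from sol obtain g where W: "sobolev_W12 \<Omega> u Du" and tr: "has_trace \<Omega> u Du g"
      and weak: "\<And>\<psi>. \<psi> \<in> test_functions UNIV \<Longrightarrow> integrable \<sigma> (\<lambda>x. \<alpha> x * g x * \<psi> x) \<and>
           integral\<^sup>L (lebesgue_on \<Omega>) (\<lambda>x. (A x *v Du x) \<bullet> grad \<psi> x)
             + integral\<^sup>L \<sigma> (\<lambda>x. \<alpha> x * g x * \<psi> x) = integral\<^sup>L \<sigma> (\<lambda>x. f x * \<psi> x)"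
      unfolding robin_weak_solution_def by blast
    obtain \<phi> :: "nat \<Rightarrow> real^'n \<Rightarrow> real" where \<phi>: "\<And>k. \<phi> k \<in> test_functions UNIV" and w12: "w12 \<Omega> u Du"
      and l1: "(\<lambda>k. sqint \<Omega> (\<lambda>x. \<phi> k x - u x)) \<longlonglongrightarrow> 0" and l2: "(\<lambda>k. sqint \<Omega> (\<lambda>x. grad (\<phi> k) x - Du x)) \<longlonglongrightarrow> 0"
      and g[measurable]: "g \<in> borel_measurable \<sigma>"
      and l3: "(\<lambda>k. \<integral>\<^sup>+x. ennreal ((\<phi> k x - g x)\<^sup>2) \<partial>\<sigma>) \<longlonglongrightarrow> 0"
      by (rule sobolev_trace_approximation[OF W tr]) blast
    have Du: "Du \<in> borel_measurable (lebesgue_on \<Omega>)" "sqint \<Omega> Du < \<infinity>" using w12 by (auto simp: w12_def)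
    note mass = trace_mass_bound[OF Du ell \<phi> l2 g l3 \<alpha> fc weak]
    define \<rho> where "\<rho> = bmean \<Omega> u ystar"
    define NN where "NN = (\<integral>\<^sup>+x. nt_max \<Omega> Du x \<partial>\<sigma>)"
    define F where "F = (\<integral>\<^sup>+x. ennreal \<bar>f x\<bar> \<partial>\<sigma>)"
    have osc: "(\<integral>\<^sup>+x. ennreal \<bar>g x - \<rho>\<bar> \<partial>\<sigma>) \<le> ennreal C10 * NN"
      unfolding NN_def \<rho>_def by (rule C10(2)[OF w12 test_functions_C1_fun[OF \<phi>] l1 l2 g l3])
    have fi: "integrable \<sigma> f" by (rule continuous_frontier_integrable[OF fc])
    have ag: "(\<integral>\<^sup>+x. ennreal (\<alpha> x * \<bar>g x\<bar>) \<partial>\<sigma>) \<le> F"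
    proof -
      have "integrable \<sigma> (\<lambda>x. \<alpha> x * \<bar>g x\<bar>)"
        by (rule Bochner_Integration.integrable_bound[OF mass(1)]) (auto simp: abs_mult)
      then have "(\<integral>\<^sup>+x. ennreal (\<alpha> x * \<bar>g x\<bar>) \<partial>\<sigma>) = ennreal (\<integral>x. \<alpha> x * \<bar>g x\<bar> \<partial>\<sigma>)"
        using \<alpha>0 by (intro nn_integral_eq_integral) (auto elim: eventually_mono)
      also have "\<dots> \<le> ennreal (\<integral>x. \<bar>f x\<bar> \<partial>\<sigma>)" by (intro ennreal_leI mass(2))
      also have "\<dots> = F" unfolding F_def using fi by (intro nn_integral_eq_integral[symmetric]) auto
      finally show ?thesis .
    qed
    have "ennreal \<bar>\<rho>\<bar> * ennreal e = (\<integral>\<^sup>+x. ennreal \<bar>\<rho>\<bar> * indicator E0 x \<partial>\<sigma>)"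
      by (simp add: nn_integral_cmult_indicator e)
    also have "\<dots> \<le> (\<integral>\<^sup>+x. ennreal \<bar>g x - \<rho>\<bar> + ennreal (1 / c0) * ennreal (\<alpha> x * \<bar>g x\<bar>) \<partial>\<sigma>)"
    proof (rule nn_integral_mono_AE)
      show "AE x in \<sigma>. ennreal \<bar>\<rho>\<bar> * indicator E0 x \<le> ennreal \<bar>g x - \<rho>\<bar> + ennreal (1 / c0) * ennreal (\<alpha> x * \<bar>g x\<bar>)"
        using \<alpha>E
      proof eventually_elim
        case (elim x)
        show ?case
        proof (cases "x \<in> E0")
          case True
          then have ax: "c0 \<le> \<alpha> x" using elim by simp
          have "c0 * \<bar>g x\<bar> \<le> \<alpha> x * \<bar>g x\<bar>" using ax by (intro mult_right_mono) auto
          then have "\<bar>g x\<bar> \<le> 1 / c0 * (\<alpha> x * \<bar>g x\<bar>)" using c0 by (simp add: field_simps)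
          then have "\<bar>\<rho>\<bar> \<le> \<bar>g x - \<rho>\<bar> + 1 / c0 * (\<alpha> x * \<bar>g x\<bar>)" by linarith
          then have "ennreal \<bar>\<rho>\<bar> \<le> ennreal (\<bar>g x - \<rho>\<bar> + 1 / c0 * (\<alpha> x * \<bar>g x\<bar>))" by (rule ennreal_leI)
          also have "\<dots> = ennreal \<bar>g x - \<rho>\<bar> + ennreal (1 / c0 * (\<alpha> x * \<bar>g x\<bar>))"
            using c0 ax by (intro ennreal_plus) auto
          also have "ennreal (1 / c0 * (\<alpha> x * \<bar>g x\<bar>)) = ennreal (1 / c0) * ennreal (\<alpha> x * \<bar>g x\<bar>)"
            using c0 ax by (intro ennreal_mult) auto
          finally show ?thesis using True by simp
        qed simp
      qed
    qed
    also have "\<dots> = (\<integral>\<^sup>+x. ennreal \<bar>g x - \<rho>\<bar> \<partial>\<sigma>) + ennreal (1 / c0) * (\<integral>\<^sup>+x. ennreal (\<alpha> x * \<bar>g x\<bar>) \<partial>\<sigma>)"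
      by (simp add: nn_integral_add nn_integral_cmult)
    also have "\<dots> \<le> ennreal C10 * NN + ennreal (1 / c0) * F"
      by (intro add_mono mult_left_mono osc ag) simp
    also have "\<dots> \<le> ennreal k * NN + ennreal k * F"
      using C10(1) c0 by (intro add_mono mult_right_mono ennreal_leI) (auto simp: k_def)
    finally have "ennreal (1 / e) * (ennreal \<bar>\<rho>\<bar> * ennreal e) \<le> ennreal (1 / e) * (ennreal k * (NN + F))"
      by (intro mult_left_mono) (simp_all add: distrib_left)
    moreover have "ennreal (1 / e) * (ennreal \<bar>\<rho>\<bar> * ennreal e) = ennreal \<bar>\<rho>\<bar>"
      using e0 by (simp add: ennreal_mult[symmetric])
    moreover have "ennreal (1 / e) * (ennreal k * (NN + F)) = ennreal (k / e) * (NN + F)"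
      using e0 k0 by (simp add: mult.assoc[symmetric] ennreal_mult[symmetric])
    ultimately show "w12 \<Omega> u Du \<and> ennreal \<bar>bmean \<Omega> u ystar\<bar> \<le> ennreal (k / e) * ((\<integral>\<^sup>+x. nt_max \<Omega> Du x \<partial>\<sigma>) + (\<integral>\<^sup>+x. ennreal \<bar>f x\<bar> \<partial>\<sigma>))"
      using w12 by (simp add: NN_def F_def \<rho>_def)
  qed
qed

text \<open>The chain estimate is used with exponent p for the maximal function and with exponent 1
  for the mean at \<open>ystar\<close>. Finite surface measure turns the integrals in the latter
  into L^p norms, and solvability then replaces the gradient by f.\<close>

lemma robin_solvable_imp_full:
  assumes p: "1 < p" and ell: "uniformly_elliptic \<Omega> A" and rob: "robin_coefficient \<Omega> \<alpha>"
    and solv: "robin_solvable p \<Omega> A \<alpha>"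
  shows "robin_solvable_full p \<Omega> A \<alpha>"
proof -
  from solv obtain C where C: "0 < C" and Cb: "\<And>f u Du. f \<in> Cc_boundary \<Omega> \<Longrightarrow> robin_weak_solution \<Omega> A \<alpha> f u Du \<Longrightarrow>
        Lp_norm \<sigma> p (nt_max \<Omega> Du) \<le> ennreal C * Lp_norm \<sigma> p (\<lambda>x. ennreal \<bar>f x\<bar>)"
    unfolding robin_solvable_def by blast
  have p0: "0 < p" "1 \<le> p" "0 < 1 / p" using p by auto
  obtain K1 where K1: "0 < K1" "\<And>u Du. w12 \<Omega> u Du \<Longrightarrow> (\<integral>\<^sup>+x. epowr (nt_max \<Omega> u x) p \<partial>\<sigma>) \<le>
       ennreal K1 * ((\<integral>\<^sup>+x. epowr (nt_max \<Omega> Du x) p \<partial>\<sigma>) + ennreal (\<bar>bmean \<Omega> u ystar\<bar> powr p))"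
    by (rule nt_max_power_bound[OF p0(1)]) blast
  obtain K2 where K2: "0 < K2"
    "\<And>f u Du. f \<in> Cc_boundary \<Omega> \<Longrightarrow> robin_weak_solution \<Omega> A \<alpha> f u Du \<Longrightarrow>
       w12 \<Omega> u Du \<and> ennreal \<bar>bmean \<Omega> u ystar\<bar> \<le> ennreal K2 * ((\<integral>\<^sup>+x. nt_max \<Omega> Du x \<partial>\<sigma>) + (\<integral>\<^sup>+x. ennreal \<bar>f x\<bar> \<partial>\<sigma>))"
    by (rule mean_value_bound[OF ell rob]) blast
  define S where "S = measure \<sigma> (frontier \<Omega>)"
  have S: "emeasure \<sigma> (frontier \<Omega>) = ennreal S" "0 \<le> S"
    using surface_finite by (auto simp: S_def emeasure_eq_ennreal_measure)
  \<comment> \<open>1 + S is the cost of passing from L^1 to L^p norms, and C + 1 combines the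
    gradient, already estimated by f, with f itself.\<close>
  define K3 where "K3 = K2 * (1 + S) * (C + 1)"
  have K3: "0 < K3" using K2(1) S(2) C by (simp add: K3_def)
  define K4 where "K4 = K1 * (C powr p + K3 powr p)"
  have K4: "0 < K4" unfolding K4_def using K1(1) C by (intro mult_pos_pos add_pos_nonneg) auto
  show ?thesis
    unfolding robin_solvable_full_def
  proof (intro exI conjI ballI allI impI)
    show "0 < C + K4 powr (1/p)" using C by (simp add: add_pos_nonneg)
    fix f u Du assume f: "f \<in> Cc_boundary \<Omega>" and sol: "robin_weak_solution \<Omega> A \<alpha> f u Du"
    define Fp where "Fp = Lp_norm \<sigma> p (\<lambda>x. ennreal \<bar>f x\<bar>)"
    define Np where "Np = Lp_norm \<sigma> p (nt_max \<Omega> Du)"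
    define \<rho> where "\<rho> = \<bar>bmean \<Omega> u ystar\<bar>"
    have fm[measurable]: "f \<in> borel_measurable \<sigma>"
      using continuous_frontier_integrable[of f] f by (simp add: Cc_boundary_def)
    have NF: "Np \<le> ennreal C * Fp" unfolding Np_def Fp_def by (rule Cb[OF f sol])
    have w12: "w12 \<Omega> u Du" using K2(2)[OF f sol] by simp
    have "ennreal \<rho> \<le> ennreal K2 * ((\<integral>\<^sup>+x. nt_max \<Omega> Du x \<partial>\<sigma>) + (\<integral>\<^sup>+x. ennreal \<bar>f x\<bar> \<partial>\<sigma>))"
      using K2(2)[OF f sol] by (simp add: \<rho>_def)
    also have "\<dots> \<le> ennreal K2 * (ennreal (1 + S) * Np + ennreal (1 + S) * Fp)"
    proof (intro mult_left_mono add_mono)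
      have s: "1 + emeasure \<sigma> (space \<sigma>) = ennreal (1 + S)" using S by (simp add: ennreal_plus)
      show "(\<integral>\<^sup>+x. nt_max \<Omega> Du x \<partial>\<sigma>) \<le> ennreal (1 + S) * Np"
        unfolding Np_def s[symmetric] by (rule nn_integral_le_Lp_norm[OF _ p0(2)]) measurable
      show "(\<integral>\<^sup>+x. ennreal \<bar>f x\<bar> \<partial>\<sigma>) \<le> ennreal (1 + S) * Fp"
        unfolding Fp_def s[symmetric] by (rule nn_integral_le_Lp_norm[OF _ p0(2)]) measurable
    qed simp
    also have "\<dots> \<le> ennreal K2 * (ennreal (1 + S) * (ennreal C * Fp) + ennreal (1 + S) * Fp)"
      by (intro mult_left_mono add_mono NF) auto
    also have "\<dots> = ennreal K3 * Fp"
      using K2(1) S(2) C by (simp add: K3_def ennreal_mult ennreal_plus distrib_left distrib_right mult.assoc)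
    finally have \<rho>F: "ennreal \<rho> \<le> ennreal K3 * Fp" .
    have Npp: "epowr Np p = (\<integral>\<^sup>+x. epowr (nt_max \<Omega> Du x) p \<partial>\<sigma>)"
      unfolding Np_def Lp_norm_def using p0 by (simp add: epowr_epowr)
    have "(\<integral>\<^sup>+x. epowr (nt_max \<Omega> u x) p \<partial>\<sigma>) \<le> ennreal K1 * (epowr Np p + epowr (ennreal \<rho>) p)"
      using K1(2)[OF w12] by (simp add: Npp \<rho>_def)
    also have "\<dots> \<le> ennreal K1 * (epowr (ennreal C * Fp) p + epowr (ennreal K3 * Fp) p)"
      by (intro mult_left_mono add_mono epowr_mono[OF p0(1)] NF \<rho>F) simp
    also have "\<dots> = ennreal K4 * epowr Fp p"
      using C K3 K1(1) by (simp add: epowr_cmult K4_def ennreal_mult ennreal_plus distrib_right distrib_left mult.assoc)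
    finally have "Lp_norm \<sigma> p (nt_max \<Omega> u) \<le> epowr (ennreal K4 * epowr Fp p) (1/p)"
      unfolding Lp_norm_def by (rule epowr_mono[OF p0(3)])
    also have "\<dots> = ennreal (K4 powr (1/p)) * Fp"
      using K4 p0 by (simp add: epowr_cmult epowr_epowr)
    finally have "Np + Lp_norm \<sigma> p (nt_max \<Omega> u) \<le> ennreal C * Fp + ennreal (K4 powr (1/p)) * Fp"
      by (intro add_mono NF)
    also have "\<dots> = ennreal (C + K4 powr (1/p)) * Fp" using C by (simp add: ennreal_plus distrib_right)
    finally show "Lp_norm \<sigma> p (nt_max \<Omega> Du) + Lp_norm \<sigma> p (nt_max \<Omega> u)
          \<le> ennreal (C + K4 powr (1/p)) * Lp_norm \<sigma> p (\<lambda>x. ennreal \<bar>f x\<bar>)"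
      by (simp add: Np_def Fp_def)
  qed
qed

end

theorem proposition4p1:
  fixes \<Omega> :: "(real^'n) set"
    and A :: "real^'n \<Rightarrow> real^'n^'n"
    and \<alpha> :: "real^'n \<Rightarrow> real"
    and p :: real
  assumes "CARD('n) \<ge> 2"
    and "1 < p"
    and "one_sided_CAD \<Omega>"
    and "bounded \<Omega>"
    and "uniformly_elliptic \<Omega> A"
    and "robin_coefficient \<Omega> \<alpha>"
  shows "robin_solvable p \<Omega> A \<alpha> \<longleftrightarrow> robin_solvable_full p \<Omega> A \<alpha>"
proof
  assume solv: "robin_solvable p \<Omega> A \<alpha>"
  have cad: "open \<Omega>" "\<Omega> \<noteq> {}" "corkscrew_condition \<Omega>" "harnack_chain_condition \<Omega>" "ahlfors_regular_boundary \<Omega>"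
    using assms(3) by (simp_all add: one_sided_CAD_def)
  obtain c D0 Y where fam: "corkscrew_family \<Omega> c D0 Y"
    by (rule corkscrew_family_exists[OF cad(1) assms(4) cad(2,3,4)])
  \<comment> \<open>Any point of \<Omega> can serve as the fixed interior point
    \<open>ystar\<close>.\<close>
  obtain y where y: "y \<in> \<Omega>" using cad(2) by auto
  interpret robin_domain \<Omega> c D0 Y y
    by (intro robin_domain.intro ahlfors_domain.intro fam robin_domain_axioms.intro y assms(1,4) cad)
  show "robin_solvable_full p \<Omega> A \<alpha>" by (rule robin_solvable_imp_full[OF assms(2,5,6) solv])
next
  assume "robin_solvable_full p \<Omega> A \<alpha>"
  then obtain C where C: "0 < C" "\<And>f u Du. f \<in> Cc_boundary \<Omega> \<Longrightarrow> robin_weak_solution \<Omega> A \<alpha> f u Du \<Longrightarrow>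
        Lp_norm (surface_measure \<Omega>) p (nt_max \<Omega> Du) + Lp_norm (surface_measure \<Omega>) p (nt_max \<Omega> u)
          \<le> ennreal C * Lp_norm (surface_measure \<Omega>) p (\<lambda>x. ennreal \<bar>f x\<bar>)"
    unfolding robin_solvable_full_def by blast
  show "robin_solvable p \<Omega> A \<alpha>"
    unfolding robin_solvable_def
    by (intro exI[of _ C] conjI ballI allI impI C(1) order_trans[OF _ C(2)]) auto
qed

end
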